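(* Let $F,G:(0,\infty)\to\mathbb{C}$ satisfy $\int_0^\infty(|F|^2+|F'|^2+|G|^2+|G'|^2)dx<\infty$. Let $(\psi,\phi)$ be the unique solution in the Rindler wedge $x>|t|$ of the system \[\partial_t\psi-\partial_x\psi=+\phi,\qquad \partial_t\phi+\partial_x\phi=-\psi\] with Cauchy data $\phi(0,x)=F(x)$, $\psi(0,x)=G(x)$ for $x>0$. Define the boundary values $g(u)=\phi(-u,u)$ ($u>0$) and $k(v)=\psi(v,v)$ ($v>0$). Then: (i) $\int_0^\infty(|g|^2+|g'|^2)du<\infty$, $\int_0^\infty(|k|^2+|k'|^2)dv<\infty$, and $g,k$ form an $\mathcal H$ transform pair: $k(v)=\int_0^\infty J_0(2\sqrt{uv})g(u)du$ and $g(u)=\int_0^\infty J_0(2\sqrt{uv})k(v)dv$. (ii) For any $a>0$, $F$ and $G$ both vanish identically on $(0,2a)$ if and only if $g$ vanishes identically on $(0,a)$ and $k$ vanishes identically on $(0,a)$. (iii) Every $\mathcal H$ pair $(g,k)$ with $\int_0^\infty(|g|^2+|g'|^2)<\infty$ and $\int_0^\infty(|k|^2+|k'|^2)<\infty$ arises in this way from some such $(F,G)$. (iv) For all $x,u,v>0$: \[F(x)=\int_{x/2}^\infty J_0(\sqrt{x(2v-x)})k(v)dv=g(\tfrac x2)-\int_{x/2}^\infty x\frac{J_1(\sqrt{x(2u-x)})}{\sqrt{x(2u-x)}}g(u)du,\] \[G(x)=k(\tfrac x2)-\int_{x/2}^\infty x\frac{J_1(\sqrt{x(2v-x)})}{\sqrt{x(2v-x)}}k(v)dv=\int_{x/2}^\infty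 J_0(\sqrt{x(2u-x)})g(u)du,\] \[g(u)=F(2u)+\tfrac12\int_0^{2u}J_0(\sqrt{x(2u-x)})G(x)dx-\tfrac12\int_0^{2u}x\frac{J_1(\sqrt{x(2u-x)})}{\sqrt{x(2u-x)}}F(x)dx,\] \[k(v)=G(2v)+\tfrac12\int_0^{2v}J_0(\sqrt{x(2v-x)})F(x)dx-\tfrac12\int_0^{2v}x\frac{J_1(\sqrt{x(2v-x)})}{\sqrt{x(2v-x)}}G(x)dx,\] where the integrals converge as improper Riemann integrals. (v) $2\int_0^\infty|k(v)|^2dv=\int_0^\infty(|F(x)|^2+|G(x)|^2)dx=2\int_0^\infty|g(u)|^2du$.
   Context: $J_0,J_1$ are the Bessel functions of order $0$ and $1$. The $\mathcal H$ transform is the unitary, self-reciprocal operator on $L^2(0,\infty;dx)$ given by $\mathcal H(f)(x)=\int_0^\infty J_0(2\sqrt{xy})f(y)dy$. The Rindler wedge is $\{(t,x):x>|t|\}$; its past boundary is $\{(-u,u):u>0\}$ and its future boundary is $\{(v,v):v>0\}$. The solution in the wedge is determined by the Cauchy data on $\{t=0,x>0\}$ by domain of dependence; it is continuous up to the boundary. *)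

theory Defs
  imports "HOL-Analysis.Analysis"
begin

definition J0 :: "real \<Rightarrow> real" where
  "J0 x = (\<Sum>m. (-1)^m / (fact m)^2 * (x/2)^(2*m))"

definition J1 :: "real \<Rightarrow> real" where
  "J1 x = (\<Sum>m. (-1)^m / (fact m * fact (m+1)) * (x/2)^(2*m+1))"

definition H1 :: "(real \<Rightarrow> complex) \<Rightarrow> bool" where
  "H1 f \<longleftrightarrow> (\<exists>f'. (\<lambda>x. (cmod (f x))^2) integrable_on {0<..}
     \<and> (\<lambda>x. (cmod (f' x))^2) integrable_on {0<..}
     \<and> (\<forall>a b. 0 < a \<longrightarrow> a \<le> b \<longrightarrow> (f' has_integral (f b - f a)) {a..b}))"

definition H_transf_to :: "(real \<Rightarrow> complex) \<Rightarrow> (real \<Rightarrow> complex) \<Rightarrow> bool" where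
  "H_transf_to g k \<longleftrightarrow>
     (\<forall>R>0. \<forall>v>0. (\<lambda>u. complex_of_real (J0 (2 * sqrt (u * v))) * g u) integrable_on {0..R}) \<and>
     (\<forall>e>0. \<exists>R0. \<forall>R\<ge>R0.
        (\<lambda>v. (cmod (k v - integral {0..R} (\<lambda>u. complex_of_real (J0 (2 * sqrt (u * v))) * g u)))^2)
           integrable_on {0<..}
      \<and> integral {0<..} (\<lambda>v. (cmod (k v - integral {0..R} (\<lambda>u. complex_of_real (J0 (2 * sqrt (u * v))) * g u)))^2) < e)"

definition H_pair :: "(real \<Rightarrow> complex) \<Rightarrow> (real \<Rightarrow> complex) \<Rightarrow> bool" where
  "H_pair g k \<longleftrightarrow> H_transf_to g k \<and> H_transf_to k g"

definition wedge :: "(real \<times> real) set" where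
  "wedge = {(t, x). \<bar>t\<bar> \<le> x \<and> 0 < x}"

text \<open>(psi, phi) is a (continuous, characteristic-integral-form) solution in the wedge of
  d_t psi - d_x psi = phi,  d_t phi + d_x phi = - psi, with phi(0,x)=F x, psi(0,x)=G x.\<close>
definition is_solution ::
  "(real \<Rightarrow> complex) \<Rightarrow> (real \<Rightarrow> complex) \<Rightarrow> (real \<Rightarrow> real \<Rightarrow> complex) \<Rightarrow> (real \<Rightarrow> real \<Rightarrow> complex) \<Rightarrow> bool"
  where
  "is_solution F G \<psi> \<phi> \<longleftrightarrow>
     continuous_on wedge (\<lambda>(t, x). \<psi> t x) \<and> continuous_on wedge (\<lambda>(t, x). \<phi> t x) \<and>
     (\<forall>t x s. (t, x) \<in> wedge \<longrightarrow> (t + s, x - s) \<in> wedge \<longrightarrow> 0 \<le> s \<longrightarrow>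
        ((\<lambda>r. \<phi> (t + r) (x - r)) has_integral (\<psi> (t + s) (x - s) - \<psi> t x)) {0..s}) \<and>
     (\<forall>t x s. (t, x) \<in> wedge \<longrightarrow> (t + s, x + s) \<in> wedge \<longrightarrow> 0 \<le> s \<longrightarrow>
        ((\<lambda>r. - \<psi> (t + r) (x + r)) has_integral (\<phi> (t + s) (x + s) - \<phi> t x)) {0..s}) \<and>
     (\<forall>x>0. \<phi> 0 x = F x \<and> \<psi> 0 x = G x)"

definition improper_int :: "(real \<Rightarrow> complex) \<Rightarrow> real \<Rightarrow> complex \<Rightarrow> bool" where
  "improper_int f a L \<longleftrightarrow> (\<forall>R\<ge>a. f integrable_on {a..R}) \<and>
     ((\<lambda>R. integral {a..R} f) \<longlongrightarrow> L) at_top"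

definition K0 :: "real \<Rightarrow> real \<Rightarrow> real" where
  "K0 x w = J0 (sqrt (x * (2 * w - x)))"

definition K1 :: "real \<Rightarrow> real \<Rightarrow> real" where
  "K1 x w = x * J1 (sqrt (x * (2 * w - x))) / sqrt (x * (2 * w - x))"

end

theory Submission
  imports Defs
begin

text \<open>In light-cone coordinates \<open>u = (x - t) / 2\<close>, \<open>v = (x + t) / 2\<close> the system reads \<open>\<partial>\<^sub>u \<psi> = - \<phi>\<close>, \<open>\<partial>\<^sub>v \<phi> = - \<psi>\<close>. For two solutions
  \<open>(A, B)\<close> and \<open>(\<phi>, \<psi>)\<close> the form \<open>A \<phi> du + B \<psi> dv\<close> is closed. Paired with the conjugate solution this
  gives an energy potential \<open>W\<close> with \<open>\<partial>\<^sub>u W = \<bar>\<phi>\<bar>\<^sup>2\<close> and \<open>\<partial>\<^sub>v W = \<bar>\<psi>\<bar>\<^sup>2\<close>, hence monotone in both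
  variables; paired with Riemann's function it gives the representation formulas.

  Translates of a solution are solutions, so bounds on difference quotients in \<open>L\<^sup>2\<close> propagate from the Cauchy
  line to the boundary and back, which carries the \<open>H\<^sup>1\<close> regularity. The flux of \<open>W\<close> through
  \<open>{u} \<times> [0, V]\<close> is integrable in \<open>u\<close> and converges, so no energy escapes: this is (v). Subtracting the solution
  with data \<open>g\<close> on \<open>[0, R]\<close> and no \<open>\<psi>\<close> on \<open>u = R\<close> leaves a remainder
  whose energy is the part of the energy not yet radiated through \<open>[0, R]\<close>; this gives the \<open>\<H>\<close> transform, and,
  with the decay of \<open>J\<^sub>0\<close>, the improper integrals. For (iii) the characteristic problem with data
  \<open>g\<close>, \<open>k\<close> is solved explicitly, and the \<open>\<H>\<close> relation bounds the energy on the Cauchy line.\<close>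

section \<open>The Bessel kernels\<close>

text \<open>Two obstacles shape the argument. For fixed \<open>v\<close> > 0 the kernel
  \<open>E0 (u * v)\<close> is not square integrable in \<open>u\<close>, so Cauchy-Schwarz does not
  control its integral against \<open>g\<close> over a half line. Each such integral is the limit of
  values of a solution cut off at \<open>u = R\<close>, with an error that lives on the line
  \<open>u = R\<close>. For \<open>\<phi>\<close> the flux bounds this error. For
  \<open>\<psi>\<close> it is an integral against the derivative of a kernel, and an integration by
  parts is needed before the decay of \<open>E0\<close> helps. The other obstacle is regularity.
  Bounds on difference quotients pass through energy estimates, but recovering a weak derivative
  from them would take a compactness argument. It is avoided because
  \<open>\<phi> u 0 - \<phi> u u\<close> is continuously differentiable: a boundary value inherits
  the weak derivative of the Cauchy datum up to a continuous term, and the difference bounds serve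
  to show that this term is square integrable. A translation in \<open>u\<close> alone leaves the
  Cauchy line, but the mismatch has a squared norm of order \<open>h^2\<close>, since
  \<open>\<partial>\<^sub>u \<psi> = - \<phi>\<close> has finite energy.\<close>

text \<open>\<open>J0 (2 * sqrt z) = E0 z\<close> and \<open>J1 (2 * sqrt z) = sqrt z * E1 z\<close>: the kernels become entire functions.\<close>

definition E0 :: "real \<Rightarrow> real" where
  "E0 z = (\<Sum>n. (-1)^n / (fact n)^2 * z^n)"

definition E1 :: "real \<Rightarrow> real" where
  "E1 z = (\<Sum>n. (-1)^n / (fact n * fact (n+1)) * z^n)"

definition E2 :: "real \<Rightarrow> real" where
  "E2 z = (\<Sum>n. diffs (\<lambda>n. (-1)^n / (fact n * fact (n+1))) n * z^n)"

lemma summable_E0: "summable (\<lambda>n. (-1)^n / (fact n)^2 * z^n :: real)"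
proof (rule summable_comparison_test')
  show "summable (\<lambda>n. inverse (fact n) * \<bar>z\<bar>^n)"
    by (rule summable_exp)
  show "norm ((-1)^n / (fact n)^2 * z^n) \<le> inverse (fact n) * \<bar>z\<bar>^n" if "0 \<le> n" for n
  proof -
    have "fact n * (1::real) \<le> (fact n)^2"
      unfolding power2_eq_square by (intro mult_left_mono) auto
    then have "1 / (fact n)^2 \<le> inverse (fact n :: real)"
      by (simp add: divide_simps)
    then show ?thesis
      using mult_right_mono[of "1 / (fact n)^2" "inverse (fact n)" "\<bar>z\<bar>^n"]
      by (simp add: abs_mult power_abs)
  qed
qed

lemma summable_E1: "summable (\<lambda>n. (-1)^n / (fact n * fact (n+1)) * z^n :: real)"
proof (rule summable_comparison_test')
  show "summable (\<lambda>n. inverse (fact n) * \<bar>z\<bar>^n)"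
    by (rule summable_exp)
  show "norm ((-1)^n / (fact n * fact (n+1)) * z^n) \<le> inverse (fact n) * \<bar>z\<bar>^n" if "0 \<le> n" for n
  proof -
    have "fact n * (1::real) \<le> fact n * fact (n+1)"
      using fact_ge_1[of "n+1"] by (intro mult_left_mono) (auto simp del: fact_Suc)
    then have "1 / (fact n * fact (n+1)) \<le> inverse (fact n :: real)"
      by (simp add: divide_simps del: fact_Suc)
    then show ?thesis
      using mult_right_mono[of "1 / (fact n * fact (n+1))" "inverse (fact n)" "\<bar>z\<bar>^n"]
      by (simp add: abs_mult power_abs del: fact_Suc)
  qed
qed

lemma DERIV_E0: "(E0 has_real_derivative - E1 z) (at z)"
proof -
  have "diffs (\<lambda>n. (-1)^n / (fact n)^2) n = - ((-1)^n / (fact n * fact (n+1)) :: real)" for n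
    by (simp add: diffs_def power2_eq_square divide_simps)
  then have "- E1 z = (\<Sum>n. diffs (\<lambda>n. (-1)^n / (fact n)^2) n * z^n)"
    unfolding E1_def using suminf_minus[OF summable_E1[of z]] by simp
  then show ?thesis
    using termdiffs_strong_converges_everywhere[OF summable_E0, of z]
    unfolding E0_def[abs_def] by simp
qed

lemma DERIV_E1: "(E1 has_real_derivative E2 z) (at z)"
  using termdiffs_strong_converges_everywhere[OF summable_E1, of z]
  unfolding E1_def[abs_def] E2_def .

text \<open>This says that \<open>z * E1 z\<close> has derivative \<open>E0 z\<close>. With
  \<open>DERIV_E0\<close> it is Bessel's equation of order 0, and it is the only identity behind the
  kernels that solve the system below.\<close>

lemma E1_plus_E2: "E1 z + z * E2 z = E0 z"
proof -
  let ?c = "\<lambda>n. (-1)^n / (fact n * fact (n+1)) :: real"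
  have "summable (\<lambda>n. diffs ?c n * z^n)"
    by (rule termdiff_converges_all[OF summable_E1])
  from sums_mult[OF diffs_equiv[OF this], of z]
  have "(\<lambda>n. of_nat n * ?c n * z^n) sums (z * E2 z)"
    unfolding E2_def
    by (rule sums_cong[THEN iffD1, rotated]) (case_tac n; simp)
  from sums_add[OF summable_sums[OF summable_E1[of z]] this]
  have "(\<lambda>n. ?c n * z^n + of_nat n * ?c n * z^n) sums (E1 z + z * E2 z)"
    unfolding E1_def .
  moreover have "?c n * z^n + of_nat n * ?c n * z^n = (-1)^n / (fact n)^2 * z^n" for n
  proof -
    have "?c n * z^n + of_nat n * ?c n * z^n = (1 + of_nat n) * ?c n * z^n"
      by (simp only: distrib_right mult_1_left)
    also have "(1 + of_nat n) * ?c n = (-1)^n / (fact n)^2"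
      by (simp add: power2_eq_square divide_simps)
    finally show ?thesis .
  qed
  ultimately show ?thesis
    unfolding E0_def by (simp add: sums_iff)
qed

lemma E0_0 [simp]: "E0 0 = 1" and E1_0 [simp]: "E1 0 = 1"
  unfolding E0_def E1_def
  using powser_zero[of "\<lambda>n. (-1)^n / (fact n)^2 :: real"]
    powser_zero[of "\<lambda>n. (-1)^n / (fact n * fact (n+1)) :: real"]
  by simp_all

lemma continuous_on_E0 [continuous_intros]:
  "continuous_on A f \<Longrightarrow> continuous_on A (\<lambda>x. E0 (f x))"
  by (rule continuous_on_compose2[of UNIV E0])
    (auto intro!: continuous_at_imp_continuous_on DERIV_isCont[OF DERIV_E0])

lemma continuous_on_E1 [continuous_intros]:
  "continuous_on A f \<Longrightarrow> continuous_on A (\<lambda>x. E1 (f x))"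
  by (rule continuous_on_compose2[of UNIV E1])
    (auto intro!: continuous_at_imp_continuous_on DERIV_isCont[OF DERIV_E1])

lemma continuous_on_E2 [continuous_intros]:
  assumes "continuous_on A f" shows "continuous_on A (\<lambda>x. E2 (f x))"
proof (rule continuous_on_compose2[of UNIV E2])
  have "(E2 has_real_derivative (\<Sum>n. diffs (diffs (\<lambda>n. (-1)^n / (fact n * fact (n+1)))) n * z^n)) (at z)" for z
    unfolding E2_def[abs_def]
    by (rule termdiffs_strong_converges_everywhere[OF termdiff_converges_all[OF summable_E1]])
  then show "continuous_on UNIV E2"
    by (auto intro!: continuous_at_imp_continuous_on DERIV_isCont)
qed (use assms in auto)

lemma J0_eq_E0: "J0 x = E0 (x^2 / 4)"
  unfolding J0_def E0_def by (simp add: power_mult power_divide)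

lemma J1_eq_E1: "J1 x = x / 2 * E1 (x^2 / 4)"
proof -
  have "J1 x = (\<Sum>m. x / 2 * ((-1)^m / (fact m * fact (m+1)) * (x^2/4)^m))"
    unfolding J1_def
    by (rule arg_cong[where f=suminf])
      (auto simp: power_mult power_divide fun_eq_iff divide_simps simp del: fact_Suc)
  also have "\<dots> = x / 2 * E1 (x^2 / 4)"
    unfolding E1_def by (rule suminf_mult[OF summable_E1])
  finally show ?thesis .
qed

text \<open>The energy of the equation \<open>z E'' + E' + E = 0\<close>.\<close>

definition EN :: "real \<Rightarrow> real" where
  "EN z = (E0 z)^2 + z * (E1 z)^2"

lemma DERIV_EN: "(EN has_real_derivative (- ((E1 z)^2))) (at z)"
proof -
  have "(EN has_real_derivative (2 * E0 z * (- E1 z) + ((E1 z)^2 + z * (2 * E1 z * E2 z)))) (at z)"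
    unfolding EN_def[abs_def]
    by (auto intro!: derivative_eq_intros DERIV_E0 DERIV_E1)
  moreover have "2 * E0 z * (- E1 z) + ((E1 z)^2 + z * (2 * E1 z * E2 z)) = - ((E1 z)^2)"
    unfolding E1_plus_E2[of z, symmetric] by (simp add: power2_eq_square algebra_simps)
  ultimately show ?thesis by metis
qed

lemma EN_antimono: "a \<le> b \<Longrightarrow> EN b \<le> EN a"
  by (rule DERIV_nonpos_imp_nonincreasing[where f=EN])
    (use DERIV_EN in \<open>auto intro!: exI\<close>)

lemma EN_le_1: "0 \<le> z \<Longrightarrow> EN z \<le> 1"
  using EN_antimono[of 0 z] by (simp add: EN_def)

lemma E0_square_le_EN: "0 \<le> z \<Longrightarrow> (E0 z)^2 \<le> EN z"
  by (simp add: EN_def)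

text \<open>The inequality of arithmetic and geometric means for the two squares in
  \<open>EN z\<close>, whose sum is at most 1.\<close>

lemma abs_E0_E1_le: 
  assumes "0 < z" shows "\<bar>E0 z * E1 z\<bar> \<le> 1 / (2 * sqrt z)"
proof -
  have "2 * \<bar>E0 z\<bar> * \<bar>sqrt z * E1 z\<bar> \<le> (E0 z)^2 + (sqrt z * E1 z)^2"
    using sum_squares_bound[of "\<bar>E0 z\<bar>" "\<bar>sqrt z * E1 z\<bar>"] by simp
  also have "\<dots> = EN z"
    using assms by (simp add: EN_def power_mult_distrib)
  also have "\<dots> \<le> 1" using assms by (intro EN_le_1) simp
  finally show ?thesis
    using assms by (simp add: abs_mult field_simps)
qed

text \<open>The corrections to \<open>EN z * ln z\<close> in the Lyapunov function below cancel the term \<open>EN z / z\<close> of its derivative.\<close>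

lemma EN_ln_le:
  assumes "1 \<le> z" shows "EN z * ln z \<le> 5"
proof -
  define L where "L = (\<lambda>z. EN z * ln z + 2 * EN z - E0 z * E1 z + 1 / sqrt z)"
  have "L z \<le> L 1"
  proof (rule DERIV_nonpos_imp_nonincreasing[OF assms])
    fix x :: real assume x: "1 \<le> x" "x \<le> z"
    let ?D = "EN x / x - (E1 x)^2 * ln x - 2 * (E1 x)^2 - (- ((E1 x)^2) + E0 x * E2 x) - 1 / (2 * x * sqrt x)"
    have sq: "((\<lambda>z. 1 / sqrt z) has_real_derivative (- (1 / (2 * x * sqrt x)))) (at x)"
      using x by (auto intro!: derivative_eq_intros simp: field_simps)
    have "(L has_real_derivative (- ((E1 x)^2) * ln x + 1 / x * EN x + 2 * (- ((E1 x)^2))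
        - (- E1 x * E1 x + E2 x * E0 x) + - (1 / (2 * x * sqrt x)))) (at x)"
      unfolding L_def using x
      by (intro DERIV_add DERIV_diff DERIV_mult DERIV_cmult DERIV_E0 DERIV_E1 DERIV_EN DERIV_ln_divide sq) simp
    then have "(L has_real_derivative ?D) (at x)"
      by (rule DERIV_cong) (simp add: power2_eq_square)
    moreover have "?D \<le> 0"
    proof -
      have E2: "E2 x = (E0 x - E1 x) / x" using E1_plus_E2[of x] x by (simp add: field_simps)
      \<comment> \<open>All squares without a logarithm cancel. What remains of indefinite sign is
        \<open>E0 x * E1 x / x\<close>, and \<open>1 / sqrt z\<close> is in \<open>L\<close> to
        absorb it.\<close>
      have "?D = E0 x * E1 x / x - (E1 x)^2 * ln x - 1 / (2 * x * sqrt x)"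
        using x unfolding EN_def E2 by (simp add: divide_simps power2_eq_square) (simp add: algebra_simps)
      moreover have "E0 x * E1 x / x \<le> 1 / (2 * sqrt x) / x"
        using abs_E0_E1_le[of x] x by (intro divide_right_mono) auto
      moreover have "1 / (2 * sqrt x) / x = 1 / (2 * x * sqrt x)" by simp
      moreover have "(E1 x)^2 * ln x \<ge> 0" using x by simp
      ultimately show ?thesis by linarith
    qed
    ultimately show "\<exists>y. (L has_real_derivative y) (at x) \<and> y \<le> 0" by blast
  qed
  \<comment> \<open>With the lower bound for \<open>L z\<close> below, this gives even 4 as a bound;
    only boundedness matters, since it makes \<open>EN\<close> tend to 0.\<close>
  moreover have "L 1 \<le> 2 + 1/2 + 1"
    using EN_le_1[of 1] abs_E0_E1_le[of 1] by (simp add: L_def)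
  moreover have "L z \<ge> EN z * ln z + 0 - 1/2 + 0"
  proof -
    have "1 / (2 * sqrt z) \<le> 1/2" using assms by (simp add: divide_simps)
    then have "E0 z * E1 z \<le> 1/2" using abs_E0_E1_le[of z] assms by linarith
    moreover have "EN z \<ge> 0" using assms by (simp add: EN_def)
    moreover have "0 \<le> 1 / sqrt z" using assms by simp
    ultimately show ?thesis unfolding L_def by linarith
  qed
  ultimately show ?thesis by linarith
qed

lemma EN_nonneg: "0 \<le> z \<Longrightarrow> 0 \<le> EN z"
  by (simp add: EN_def)

lemma EN_tendsto_0: "(EN \<longlongrightarrow> 0) at_top"
proof (rule tendsto_sandwich[where f = "\<lambda>_. 0" and h = "\<lambda>z. 5 / ln z"])
  show "((\<lambda>z::real. 5 / ln z) \<longlongrightarrow> 0) at_top"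
    by (intro real_tendsto_divide_at_top[OF tendsto_const] ln_at_top)
  show "\<forall>\<^sub>F z in at_top. EN z \<le> 5 / ln z"
    using eventually_gt_at_top[of 1]
  proof eventually_elim
    case (elim z)
    then show ?case using EN_ln_le[of z] by (simp add: field_simps)
  qed
  show "\<forall>\<^sub>F z in at_top. 0 \<le> EN z"
    using eventually_ge_at_top[of 0] by eventually_elim (rule EN_nonneg)
qed auto

lemma E0_tendsto_0: "(E0 \<longlongrightarrow> 0) at_top"
proof -
  have "((\<lambda>z. (E0 z)^2) \<longlongrightarrow> 0) at_top"
    by (rule tendsto_sandwich[OF _ _ tendsto_const EN_tendsto_0])
      (auto intro: eventually_mono[OF eventually_ge_at_top[of 0]] E0_square_le_EN)
  then show ?thesis by simp
qed

text \<open>The derivative of \<open>z * EN z\<close> is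
  \<open>EN z - z * (E1 z)^2 = (E0 z)^2\<close>. Hence the mean square of the kernel over a segment
  is again a value of \<open>EN\<close>, and it tends to 0 as \<open>r\<close> grows while
  \<open>V\<close> > 0 stays fixed.\<close>

lemma E0_square_has_integral:
  assumes "0 \<le> V"
  shows "((\<lambda>v. (E0 (r * (V - v)))^2) has_integral V * EN (r * V)) {0..V}"
proof -
  have "((\<lambda>v. - ((V - v) * EN (r * (V - v)))) has_vector_derivative (E0 (r * (V - v)))^2) (at v within {0..V})" for v
  proof -
    let ?y = "V - v"
    have "((\<lambda>v. EN (r * (V - v))) has_real_derivative (- ((E1 (r * ?y))^2) * (- r))) (at v)"
      by (rule DERIV_chain'[where g=EN, OF _ DERIV_EN]) (auto intro!: derivative_eq_intros)
    then have "((\<lambda>v. - ((V - v) * EN (r * (V - v)))) has_real_derivative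
        EN (r * ?y) - (E1 (r * ?y))^2 * r * ?y) (at v)"
      by (auto intro!: derivative_eq_intros)
    moreover have "EN (r * ?y) - (E1 (r * ?y))^2 * r * ?y = (E0 (r * ?y))^2"
      by (simp add: EN_def)
    ultimately show ?thesis
      by (simp add: has_real_derivative_iff_has_vector_derivative has_vector_derivative_at_within)
  qed
  from fundamental_theorem_of_calculus[OF assms this] show ?thesis by simp
qed

section \<open>Signed integrals and exact forms\<close>

text \<open>The integral from \<open>a\<close> to \<open>b\<close> for either order of the endpoints; one of the two terms is always \<open>0\<close>.\<close>

definition sint :: "real \<Rightarrow> real \<Rightarrow> (real \<Rightarrow> 'a::banach) \<Rightarrow> 'a" where
  "sint a b h = integral {a..b} h - integral {b..a} h"

lemma sint_le: "a \<le> b \<Longrightarrow> sint a b h = integral {a..b} h"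
  by (cases "a = b") (auto simp: sint_def)

lemma sint_refl [simp]: "sint a a h = 0"
  by (simp add: sint_def)

lemma sint_swap: "sint b a h = - sint a b h"
  by (simp add: sint_def)

lemma sint_antiderivative:
  assumes "\<And>x. (p has_vector_derivative h x) (at x)"
  shows "sint a b h = p b - p a"
proof -
  have "integral {c..d} h = p d - p c" if "c \<le> d" for c d
    by (rule integral_unique[OF fundamental_theorem_of_calculus[OF that]])
      (use assms in \<open>blast intro: has_vector_derivative_at_within\<close>)
  then show ?thesis
    by (cases a b rule: linorder_cases) (auto simp: sint_def)
qed

lemma sint_has_vector_derivative:
  fixes h :: "real \<Rightarrow> 'a::banach"
  assumes h: "continuous_on UNIV h"
  shows "((\<lambda>x. sint a x h) has_vector_derivative h x) (at x)"
proof -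
  define m M where "m = min a x - 1" and "M = max a x + 1"
  have mM: "m < x" "x < M" "m < a" "a < M" by (auto simp: m_def M_def)
  have cont: "continuous_on S h" for S by (rule continuous_on_subset[OF h]) simp
  have "((\<lambda>u. integral {m..u} h) has_vector_derivative h x) (at x within {m..M})"
    by (rule integral_has_vector_derivative) (use mM cont in auto)
  then have "((\<lambda>u. integral {m..u} h) has_vector_derivative h x) (at x)"
    using mM by (simp add: at_within_Icc_at)
  then have "((\<lambda>u. integral {m..u} h - integral {m..a} h) has_vector_derivative h x) (at x)"
    by (simp add: has_vector_derivative_diff_const)
  then show ?thesis
  proof (rule has_vector_derivative_transform_within_open[where S="{m<..<M}"])
    fix y assume y: "y \<in> {m<..<M}"
    have int: "h integrable_on {c..d}" for c d
      by (rule integrable_continuous_real[OF cont])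
    show "integral {m..y} h - integral {m..a} h = sint a y h"
    proof (cases "a \<le> y")
      case True
      then show ?thesis
        using Henstock_Kurzweil_Integration.integral_combine[of m a y h] int mM
        by (simp add: sint_le algebra_simps)
    next
      case False
      then show ?thesis
        using Henstock_Kurzweil_Integration.integral_combine[of m y a h] int y
        by (simp add: sint_le sint_swap[of a y] algebra_simps)
    qed
  qed (use mM in auto)
qed

text \<open>The substitution moves the endpoints into the integrand over a fixed interval, so
  continuity in parameters that also occur in the endpoints reduces to the case of fixed
  endpoints.\<close>

lemma sint_unit_interval:
  fixes h :: "real \<Rightarrow> 'a::banach"
  assumes h: "continuous_on UNIV h"
  shows "sint a b h = (b - a) *\<^sub>R integral {0..1} (\<lambda>r. h (a + r * (b - a)))"
proof -
  have "((\<lambda>r. sint a (a + r * (b - a)) h) has_vector_derivative (b - a) *\<^sub>R h (a + r * (b - a))) (at r within S)" for r S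
  proof -
    have "((\<lambda>r. a + r * (b - a)) has_vector_derivative (b - a)) (at r)"
      by (auto intro!: derivative_eq_intros)
    from vector_diff_chain_at[OF this sint_has_vector_derivative[OF h]]
    show ?thesis by (auto simp: o_def intro: has_vector_derivative_at_within)
  qed
  from fundamental_theorem_of_calculus[OF _ this, of 0 1]
  have "((\<lambda>r. (b - a) *\<^sub>R h (a + r * (b - a))) has_integral sint a b h) {0..1}"
    by simp
  from integral_unique[OF this] show ?thesis by (simp add: integral_cmul)
qed

lemma continuous_on_sint:
  fixes f :: "'t::topological_space \<Rightarrow> real \<Rightarrow> 'a::banach"
  assumes f: "continuous_on (S \<times> UNIV) (\<lambda>(x, s). f x s)"
    and a: "continuous_on S a" and b: "continuous_on S b"
  shows "continuous_on S (\<lambda>x. sint (a x) (b x) (f x))"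
proof -
  have fx: "continuous_on UNIV (f x)" if "x \<in> S" for x
  proof -
    have "continuous_on UNIV (\<lambda>s. (x, s))" by (intro continuous_intros)
    from continuous_on_compose[OF this continuous_on_subset[OF f]] that
    show ?thesis by (auto simp: o_def)
  qed
  have "continuous_on (S \<times> cbox 0 1) (\<lambda>p. (fst p, a (fst p) + snd p * (b (fst p) - a (fst p))))"
    by (intro continuous_intros continuous_on_compose2[OF a, of _ fst] continuous_on_compose2[OF b, of _ fst])
      auto
  moreover have "(\<lambda>p. (fst p, a (fst p) + snd p * (b (fst p) - a (fst p)))) ` (S \<times> cbox 0 1) \<subseteq> S \<times> UNIV"
    by auto
  ultimately have "continuous_on (S \<times> cbox 0 1) ((\<lambda>(x, s). f x s) \<circ> (\<lambda>p. (fst p, a (fst p) + snd p * (b (fst p) - a (fst p)))))"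
    by (intro continuous_on_compose continuous_on_subset[OF f])
  then have "continuous_on (S \<times> cbox 0 1) (\<lambda>(x, r). f x (a x + r * (b x - a x)))"
    by (auto simp: o_def split_beta)
  from integral_continuous_on_param[OF this]
  have "continuous_on S (\<lambda>x. (b x - a x) *\<^sub>R integral {0..1} (\<lambda>r. f x (a x + r * (b x - a x))))"
    by (auto intro!: continuous_intros a b)
  then show ?thesis
    by (rule continuous_on_eq) (simp add: sint_unit_interval[OF fx])
qed

lemma sint_param_has_vector_derivative:
  fixes f :: "real \<Rightarrow> real \<Rightarrow> 'a::banach"
  assumes f: "\<And>x s. ((\<lambda>x. f x s) has_vector_derivative fx x s) (at x)"
    and cf: "\<And>x. continuous_on UNIV (f x)"
    and cfx: "continuous_on UNIV (\<lambda>(x, s). fx x s)"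
  shows "((\<lambda>x. sint a b (f x)) has_vector_derivative sint a b (fx x)) (at x)"
proof -
  have "((\<lambda>x. integral (cbox c d) (f x)) has_vector_derivative integral (cbox c d) (fx x)) (at x within UNIV)" for c d
    by (rule leibniz_rule_vector_derivative)
      (use f in \<open>auto intro!: integrable_continuous_real continuous_on_subset[OF cf] continuous_on_subset[OF cfx]\<close>)
  then show ?thesis
    unfolding sint_def by (auto intro!: has_vector_derivative_diff)
qed

text \<open>Continuity of one partial derivative is enough for total differentiability, and the
  chain rule along \<open>s \<mapsto> (s, s)\<close> adds the two partials. This serves the Cauchy
  line \<open>u = v\<close> and also integrals in which one variable is both an endpoint and a
  parameter.\<close>

lemma partials_diagonal:
  fixes W :: "real \<Rightarrow> real \<Rightarrow> 'a::banach"
  assumes x: "\<And>x y. ((\<lambda>x. W x y) has_vector_derivative P x y) (at x)"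
    and y: "\<And>x y. ((\<lambda>y. W x y) has_vector_derivative Q x y) (at y)"
    and Q: "continuous_on UNIV (\<lambda>(x, y). Q x y)"
  shows "((\<lambda>s. W s s) has_vector_derivative P s s + Q s s) (at s)"
proof -
  have "((\<lambda>(x, y). W x y) has_derivative
      (\<lambda>(tx, ty). tx *\<^sub>R P s s + blinfun_apply (blinfun_scaleR_left (Q s s)) ty)) (at (s, s) within UNIV \<times> UNIV)"
  proof (rule has_derivative_partialsI[where f=W and fx="\<lambda>t. t *\<^sub>R P s s" and fy="\<lambda>x y. blinfun_scaleR_left (Q x y)"])
    show "((\<lambda>x. W x s) has_derivative (\<lambda>t. t *\<^sub>R P s s)) (at s)"
      using x by (simp add: has_vector_derivative_def)
    show "((\<lambda>y. W x y) has_derivative blinfun_apply (blinfun_scaleR_left (Q x y))) (at y)" for x y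
      using y by (simp add: has_vector_derivative_def)
    show "continuous (at (s, s) within UNIV \<times> UNIV) (\<lambda>(x, y). blinfun_scaleR_left (Q x y))"
      using Q unfolding split_beta
      by (intro bounded_linear.continuous[OF bounded_linear_blinfun_scaleR_left])
        (simp add: continuous_on_eq_continuous_at split_beta)
  qed auto
  moreover have "((\<lambda>s. (s, s)) has_derivative (\<lambda>t. (t, t))) (at s)"
    by (auto intro!: derivative_eq_intros)
  ultimately have "((\<lambda>(x, y). W x y) \<circ> (\<lambda>s. (s, s)) has_derivative
     (\<lambda>(tx, ty). tx *\<^sub>R P s s + ty *\<^sub>R Q s s) \<circ> (\<lambda>t. (t, t))) (at s)"
    by (intro diff_chain_at) simp_all
  then show ?thesis
    by (simp add: o_def has_vector_derivative_def scaleR_add_right)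
qed

lemma continuous_on_section1:
  assumes "continuous_on UNIV (\<lambda>(x, y). f x y)" shows "continuous_on A (\<lambda>x. f x y)"
proof -
  have "continuous_on A (\<lambda>x. (x, y))" by (intro continuous_intros)
  from continuous_on_compose[OF this continuous_on_subset[OF assms subset_UNIV]]
  show ?thesis by (simp add: o_def)
qed

lemma continuous_on_section2:
  assumes "continuous_on UNIV (\<lambda>(x, y). f x y)" shows "continuous_on A (f x)"
proof -
  have "continuous_on A (\<lambda>y. (x, y))" by (intro continuous_intros)
  from continuous_on_compose[OF this continuous_on_subset[OF assms subset_UNIV]]
  show ?thesis by (simp add: o_def)
qed

text \<open>Endpoint and parameter are first treated as independent variables and then identified by
  \<open>partials_diagonal\<close>.\<close>

lemma sint_lower_param_has_vector_derivative:
  fixes f :: "real \<Rightarrow> real \<Rightarrow> 'a::banach"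
  assumes f: "\<And>x s. ((\<lambda>x. f x s) has_vector_derivative fx x s) (at x)"
    and cf: "continuous_on UNIV (\<lambda>(x, s). f x s)"
    and cfx: "continuous_on UNIV (\<lambda>(x, s). fx x s)"
  shows "((\<lambda>x. sint x b (f x)) has_vector_derivative sint x b (fx x) - f x x) (at x)"
proof -
  have "((\<lambda>s. sint s b (f s)) has_vector_derivative (\<lambda>a x. - f x a) x x + (\<lambda>a x. sint a b (fx x)) x x) (at x)"
  proof (rule partials_diagonal[where W="\<lambda>a x. sint a b (f x)" and P="\<lambda>a x. - f x a" and Q="\<lambda>a x. sint a b (fx x)"])
    show "((\<lambda>a. sint a b (f x)) has_vector_derivative - f x a) (at a)" for x a
      using has_vector_derivative_minus[OF sint_has_vector_derivative[OF continuous_on_section2[OF cf]], of b x a]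
      by (simp add: sint_swap[symmetric])
    show "((\<lambda>x. sint a b (f x)) has_vector_derivative sint a b (fx x)) (at x)" for x a
      by (rule sint_param_has_vector_derivative[OF f continuous_on_section2[OF cf] cfx])
    have "continuous_on UNIV (\<lambda>z. sint (fst z) b (fx (snd z)))"
      using cfx
      by (intro continuous_on_sint continuous_intros)
        (auto simp: split_beta intro!: continuous_on_compose2[OF cfx, of _ "\<lambda>z. (snd (fst z), snd z)", simplified split_beta fst_conv snd_conv] continuous_intros)
    then show "continuous_on UNIV (\<lambda>(a, x). sint a b (fx x))"
      by (simp add: split_beta)
  qed
  then show ?thesis by simp
qed

text \<open>The potential integrates along \<open>v = 0\<close> and then along a vertical segment.
  Its \<open>v\<close>-derivative is immediate; in the \<open>u\<close>-derivative the integral of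
  \<open>H\<close> equals \<open>P u v - P u 0\<close> and cancels the contribution of the base
  line.\<close>

lemma exact_potential:
  fixes P Q H :: "real \<Rightarrow> real \<Rightarrow> 'a::banach"
  assumes P: "\<And>u v. ((\<lambda>v. P u v) has_vector_derivative H u v) (at v)"
    and Q: "\<And>u v. ((\<lambda>u. Q u v) has_vector_derivative H u v) (at u)"
    and cP: "continuous_on UNIV (\<lambda>(u, v). P u v)"
    and cQ: "continuous_on UNIV (\<lambda>(u, v). Q u v)"
    and cH: "continuous_on UNIV (\<lambda>(u, v). H u v)"
  obtains W where
    "\<And>u v. ((\<lambda>u. W u v) has_vector_derivative P u v) (at u)"
    "\<And>u v. ((\<lambda>v. W u v) has_vector_derivative Q u v) (at v)"
    "\<And>s. ((\<lambda>s. W s s) has_vector_derivative P s s + Q s s) (at s)"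
    "W 0 0 = 0"
proof
  define W where "W u v = sint 0 u (\<lambda>r. P r 0) + sint 0 v (Q u)" for u v
  show 1: "((\<lambda>u. W u v) has_vector_derivative P u v) (at u)" for u v
  proof -
    have "sint 0 v (H u) = P u v - P u 0"
      by (rule sint_antiderivative[OF P])
    then show ?thesis
      unfolding W_def
      using has_vector_derivative_add[OF sint_has_vector_derivative[OF continuous_on_section1[OF cP], of 0 0 u]
         sint_param_has_vector_derivative[OF Q continuous_on_section2[OF cQ] cH, of 0 v u]]
      by simp
  qed
  show 2: "((\<lambda>v. W u v) has_vector_derivative Q u v) (at v)" for u v
    unfolding W_def
    using has_vector_derivative_add[OF has_vector_derivative_const sint_has_vector_derivative[OF continuous_on_section2[OF cQ]]]
    by simp
  show "((\<lambda>s. W s s) has_vector_derivative P s s + Q s s) (at s)" for s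
    by (rule partials_diagonal[OF 1 2 cQ])
  show "W 0 0 = 0" by (simp add: W_def)
qed

section \<open>The system in light-cone coordinates\<close>

lemma has_vector_derivative_scaleR_const:
  assumes "(f has_real_derivative f') (at x)"
  shows "((\<lambda>x. f x *\<^sub>R a) has_vector_derivative f' *\<^sub>R a) (at x)"
  using has_vector_derivative_scaleR[OF assms has_vector_derivative_const[of a]] by simp

lemma sint_zero:
  assumes "\<And>s. min a b \<le> s \<Longrightarrow> s \<le> max a b \<Longrightarrow> h s = 0"
  shows "sint a b h = 0"
proof -
  have "integral {a..b} h = integral {a..b} (\<lambda>_. 0)" "integral {b..a} h = integral {b..a} (\<lambda>_. 0)"
    by (rule integral_cong; use assms in simp)+
  then show ?thesis by (simp add: sint_def)
qed

lemma continuous_on_compose_UNIV: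
  "continuous_on UNIV g \<Longrightarrow> continuous_on A h \<Longrightarrow> continuous_on A (\<lambda>x. g (h x))"
  by (rule continuous_on_compose2[of UNIV g]) auto

text \<open>Solutions are considered on the whole plane, for Cauchy data extended continuously beyond the half line.\<close>

definition csol :: "(real \<Rightarrow> real \<Rightarrow> complex) \<Rightarrow> (real \<Rightarrow> real \<Rightarrow> complex) \<Rightarrow> bool" where
  "csol \<phi> \<psi> \<longleftrightarrow>
     continuous_on UNIV (\<lambda>(u, v). \<phi> u v) \<and> continuous_on UNIV (\<lambda>(u, v). \<psi> u v) \<and>
     (\<forall>u v. ((\<lambda>u. \<psi> u v) has_vector_derivative - \<phi> u v) (at u)) \<and>
     (\<forall>u v. ((\<lambda>v. \<phi> u v) has_vector_derivative - \<psi> u v) (at v))"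

lemma csolI:
  assumes "continuous_on UNIV (\<lambda>(u, v). \<phi> u v)" "continuous_on UNIV (\<lambda>(u, v). \<psi> u v)"
    "\<And>u v. ((\<lambda>u. \<psi> u v) has_vector_derivative - \<phi> u v) (at u)"
    "\<And>u v. ((\<lambda>v. \<phi> u v) has_vector_derivative - \<psi> u v) (at v)"
  shows "csol \<phi> \<psi>"
  using assms by (simp add: csol_def)

lemma csolD:
  assumes "csol \<phi> \<psi>"
  shows "continuous_on UNIV (\<lambda>(u, v). \<phi> u v)" "continuous_on UNIV (\<lambda>(u, v). \<psi> u v)"
    "((\<lambda>u. \<psi> u v) has_vector_derivative - \<phi> u v) (at u)"
    "((\<lambda>v. \<phi> u v) has_vector_derivative - \<psi> u v) (at v)"
  using assms by (auto simp: csol_def)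

lemma csol_continuous:
  assumes "csol \<phi> \<psi>" "continuous_on A f" "continuous_on A h"
  shows "continuous_on A (\<lambda>x. \<phi> (f x) (h x))" "continuous_on A (\<lambda>x. \<psi> (f x) (h x))"
  using continuous_on_compose_UNIV[OF csolD(1)[OF assms(1)] continuous_on_Pair[OF assms(2,3)]]
    continuous_on_compose_UNIV[OF csolD(2)[OF assms(1)] continuous_on_Pair[OF assms(2,3)]]
  by simp_all

text \<open>Both equations carry the same sign in light-cone coordinates, so reflection in
  \<open>u = v\<close> is a symmetry. Estimates are proved for one component or one boundary and
  transferred by it.\<close>

lemma csol_swap:
  assumes "csol \<phi> \<psi>" shows "csol (\<lambda>u v. \<psi> v u) (\<lambda>u v. \<phi> v u)"
  by (rule csolI)
    (auto simp: split_beta intro!: continuous_intros csol_continuous[OF assms] csolD(3,4)[OF assms])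

lemma csol_add:
  assumes "csol \<phi> \<psi>" "csol \<phi>' \<psi>'"
  shows "csol (\<lambda>u v. \<phi> u v + \<phi>' u v) (\<lambda>u v. \<psi> u v + \<psi>' u v)"
proof (rule csolI)
  show "((\<lambda>u. \<psi> u v + \<psi>' u v) has_vector_derivative - (\<phi> u v + \<phi>' u v)) (at u)"
    "((\<lambda>v. \<phi> u v + \<phi>' u v) has_vector_derivative - (\<psi> u v + \<psi>' u v)) (at v)" for u v
    using has_vector_derivative_add[OF csolD(3)[OF assms(1)] csolD(3)[OF assms(2)]]
      has_vector_derivative_add[OF csolD(4)[OF assms(1)] csolD(4)[OF assms(2)]]
    by (simp_all add: algebra_simps)
qed (auto simp: split_beta intro!: continuous_intros csol_continuous[OF assms(1)] csol_continuous[OF assms(2)])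

lemma csol_diff:
  assumes "csol \<phi> \<psi>" "csol \<phi>' \<psi>'"
  shows "csol (\<lambda>u v. \<phi> u v - \<phi>' u v) (\<lambda>u v. \<psi> u v - \<psi>' u v)"
proof (rule csolI)
  show "((\<lambda>u. \<psi> u v - \<psi>' u v) has_vector_derivative - (\<phi> u v - \<phi>' u v)) (at u)"
    "((\<lambda>v. \<phi> u v - \<phi>' u v) has_vector_derivative - (\<psi> u v - \<psi>' u v)) (at v)" for u v
    using has_vector_derivative_diff[OF csolD(3)[OF assms(1)] csolD(3)[OF assms(2)]]
      has_vector_derivative_diff[OF csolD(4)[OF assms(1)] csolD(4)[OF assms(2)]]
    by (simp_all add: algebra_simps)
qed (auto simp: split_beta intro!: continuous_intros csol_continuous[OF assms(1)] csol_continuous[OF assms(2)])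

lemma csol_shift:
  assumes "csol \<phi> \<psi>" shows "csol (\<lambda>u v. \<phi> (u + h) v) (\<lambda>u v. \<psi> (u + h) v)"
proof (rule csolI)
  show "((\<lambda>u. \<psi> (u + h) v) has_vector_derivative - \<phi> (u + h) v) (at u)" for u v
  proof -
    have "((\<lambda>u. u + h) has_vector_derivative 1) (at u)"
      by (auto intro!: derivative_eq_intros)
    from vector_diff_chain_at[OF this csolD(3)[OF assms]] show ?thesis by (simp add: o_def)
  qed
qed (auto simp: split_beta intro!: continuous_intros csol_continuous[OF assms] csolD(4)[OF assms])

definition energy_potential ::
  "(real \<Rightarrow> real \<Rightarrow> complex) \<Rightarrow> (real \<Rightarrow> real \<Rightarrow> complex) \<Rightarrow> (real \<Rightarrow> real \<Rightarrow> real) \<Rightarrow> bool" where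
  "energy_potential \<phi> \<psi> W \<longleftrightarrow> W 0 0 = 0 \<and>
     (\<forall>u v. ((\<lambda>u. W u v) has_vector_derivative (cmod (\<phi> u v))^2) (at u)) \<and>
     (\<forall>u v. ((\<lambda>v. W u v) has_vector_derivative (cmod (\<psi> u v))^2) (at v)) \<and>
     (\<forall>s. ((\<lambda>s. W s s) has_vector_derivative (cmod (\<phi> s s))^2 + (cmod (\<psi> s s))^2) (at s))"

lemma energy_potential_exists:
  assumes "csol \<phi> \<psi>" obtains W where "energy_potential \<phi> \<psi> W"
proof -
  have P: "((\<lambda>v. (cmod (\<phi> u v))^2) has_vector_derivative - 2 * inner (\<phi> u v) (\<psi> u v)) (at v)" for u v
    using bounded_bilinear.has_vector_derivative[OF bounded_bilinear_inner csolD(4)[OF assms, of u v] csolD(4)[OF assms, of u v]]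
    by (simp add: power2_norm_eq_inner inner_commute)
  have Q: "((\<lambda>u. (cmod (\<psi> u v))^2) has_vector_derivative - 2 * inner (\<phi> u v) (\<psi> u v)) (at u)" for u v
    using bounded_bilinear.has_vector_derivative[OF bounded_bilinear_inner csolD(3)[OF assms, of v u] csolD(3)[OF assms, of v u]]
    by (simp add: power2_norm_eq_inner inner_commute)
  obtain W where W: "\<And>u v. ((\<lambda>u. W u v) has_vector_derivative (cmod (\<phi> u v))^2) (at u)"
    "\<And>u v. ((\<lambda>v. W u v) has_vector_derivative (cmod (\<psi> u v))^2) (at v)"
    "\<And>s. ((\<lambda>s. W s s) has_vector_derivative (cmod (\<phi> s s))^2 + (cmod (\<psi> s s))^2) (at s)"
    "W 0 0 = 0"
    by (rule exact_potential[OF P Q])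
      (auto simp: split_beta intro!: continuous_intros csol_continuous[OF assms])
  show thesis
    by (rule that[of W]) (use W in \<open>simp add: energy_potential_def\<close>)
qed

context
  fixes \<phi> \<psi> W assumes W: "energy_potential \<phi> \<psi> W"
begin

lemma energy_u: "a \<le> b \<Longrightarrow> ((\<lambda>u. (cmod (\<phi> u v))^2) has_integral (W b v - W a v)) {a..b}"
  by (rule fundamental_theorem_of_calculus)
    (use W in \<open>auto simp: energy_potential_def intro: has_vector_derivative_at_within\<close>)

lemma energy_v: "a \<le> b \<Longrightarrow> ((\<lambda>v. (cmod (\<psi> u v))^2) has_integral (W u b - W u a)) {a..b}"
  by (rule fundamental_theorem_of_calculus)
    (use W in \<open>auto simp: energy_potential_def intro: has_vector_derivative_at_within\<close>)

lemma energy_diag: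
  "a \<le> b \<Longrightarrow> ((\<lambda>s. (cmod (\<phi> s s))^2 + (cmod (\<psi> s s))^2) has_integral (W b b - W a a)) {a..b}"
  by (rule fundamental_theorem_of_calculus)
    (use W in \<open>auto simp: energy_potential_def intro: has_vector_derivative_at_within\<close>)

lemma energy_mono: "u \<le> u' \<Longrightarrow> v \<le> v' \<Longrightarrow> W u v \<le> W u' v'"
  using has_integral_nonneg[OF energy_u[of u u' v]] has_integral_nonneg[OF energy_v[of v v' u']]
  by simp

lemma energy_nonneg: "0 \<le> u \<Longrightarrow> 0 \<le> v \<Longrightarrow> 0 \<le> W u v"
  using energy_mono[of 0 u 0 v] W by (simp add: energy_potential_def)

lemma energy_0: "W 0 0 = 0"
  using W by (simp add: energy_potential_def)

lemma energy_continuous: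
  "continuous_on A (\<lambda>u. W u v)" "continuous_on A (\<lambda>v. W u v)" "continuous_on A (\<lambda>s. W s s)"
  using W unfolding energy_potential_def
  by (auto intro!: continuous_at_imp_continuous_on has_vector_derivative_continuous)

end

lemma energy_swap: "energy_potential \<phi> \<psi> W \<Longrightarrow> energy_potential (\<lambda>u v. \<psi> v u) (\<lambda>u v. \<phi> v u) (\<lambda>u v. W v u)"
  by (auto simp: energy_potential_def add.commute)

text \<open>The product is bilinear, without conjugation. \<open>X\<close> is a potential of the
  closed form, so the integrals over the four sides of any rectangle balance.\<close>

lemma csol_pairing:
  assumes "csol A B" "csol \<phi> \<psi>"
  obtains X where "\<And>u u' v. sint u u' (\<lambda>r. A r v * \<phi> r v) = X u' v - X u v"
    "\<And>u v v'. sint v v' (\<lambda>r. B u r * \<psi> u r) = X u v' - X u v"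
proof -
  have P: "((\<lambda>v. A u v * \<phi> u v) has_vector_derivative - (A u v * \<psi> u v + B u v * \<phi> u v)) (at v)" for u v
    using has_vector_derivative_mult[OF csolD(4)[OF assms(1), of u v] csolD(4)[OF assms(2), of u v]]
    by (simp add: algebra_simps)
  have Q: "((\<lambda>u. B u v * \<psi> u v) has_vector_derivative - (A u v * \<psi> u v + B u v * \<phi> u v)) (at u)" for u v
    using has_vector_derivative_mult[OF csolD(3)[OF assms(1), of v u] csolD(3)[OF assms(2), of v u]]
    by (simp add: algebra_simps)
  obtain W where W: "\<And>u v. ((\<lambda>u. W u v) has_vector_derivative A u v * \<phi> u v) (at u)"
    "\<And>u v. ((\<lambda>v. W u v) has_vector_derivative B u v * \<psi> u v) (at v)"
    by (rule exact_potential[OF P Q])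
      (auto simp: split_beta intro!: continuous_intros csol_continuous[OF assms(1)] csol_continuous[OF assms(2)])
  show thesis
    by (rule that[of W]; rule sint_antiderivative) (rule W)+
qed

text \<open>The choice is made for its values on two lines: the first component is 1 on
  \<open>v = V\<close> and the second is 0 on \<open>u = R\<close>, so in a pairing the first side
  gives a plain integral and the second gives nothing.\<close>

lemma csol_riemann:
  "csol (\<lambda>u v. of_real (E0 ((u - R) * (V - v)))) (\<lambda>u v. of_real (- ((u - R) * E1 ((u - R) * (V - v)))))"
proof (rule csolI)
  show "((\<lambda>u. complex_of_real (- ((u - R) * E1 ((u - R) * (V - v))))) has_vector_derivative
      - complex_of_real (E0 ((u - R) * (V - v)))) (at u)" for u v
  proof -
    have "((\<lambda>u. E1 ((u - R) * (V - v))) has_real_derivative E2 ((u - R) * (V - v)) * (V - v)) (at u)"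
      by (rule DERIV_chain'[where g=E1, OF _ DERIV_E1]) (auto intro!: derivative_eq_intros)
    then have "((\<lambda>u. - ((u - R) * E1 ((u - R) * (V - v)))) has_real_derivative
      - E0 ((u - R) * (V - v))) (at u)"
      by (auto intro!: derivative_eq_intros simp: E1_plus_E2[symmetric] algebra_simps)
    from has_vector_derivative_of_real[OF this]
    show ?thesis by simp
  qed
  show "((\<lambda>v. complex_of_real (E0 ((u - R) * (V - v)))) has_vector_derivative
      - complex_of_real (- ((u - R) * E1 ((u - R) * (V - v))))) (at v)" for u v
  proof -
    have "((\<lambda>v. E0 ((u - R) * (V - v))) has_real_derivative (- E1 ((u - R) * (V - v)) * (- (u - R)))) (at v)"
      by (rule DERIV_chain'[where g=E0, OF _ DERIV_E0]) (auto intro!: derivative_eq_intros)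
    from has_vector_derivative_of_real[OF this]
    show ?thesis by (simp add: algebra_simps)
  qed
qed (auto simp: split_beta intro!: continuous_intros)

text \<open>Riemann's method on the rectangle between \<open>u\<close> and \<open>R\<close> over
  \<open>[0, V]\<close>, with the Riemann function centred at \<open>(u, V)\<close>. The sides at
  \<open>v = 0\<close> and at \<open>u\<close> contribute nothing, the side \<open>v = V\<close>
  gives the difference of \<open>b\<close> at its ends, and the side at \<open>R\<close> gives the
  kernel integral. The order of \<open>u\<close> and \<open>R\<close> is left open, so that the
  formula also carries data from \<open>R = 0\<close> to larger \<open>u\<close>.\<close>

lemma csol_characteristic_formula:
  assumes "csol a b" and zero: "\<And>s. min u R \<le> s \<Longrightarrow> s \<le> max u R \<Longrightarrow> a s 0 = 0"
  shows "b u V = b R V - sint 0 V (\<lambda>v. of_real ((R - u) * E1 ((R - u) * (V - v))) * b R v)"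
proof -
  obtain X where X: "\<And>w w' v. sint w w' (\<lambda>r. of_real (E0 ((r - u) * (V - v))) * a r v) = X w' v - X w v"
    "\<And>w v v'. sint v v' (\<lambda>r. of_real (- ((w - u) * E1 ((w - u) * (V - r)))) * b w r) = X w v' - X w v"
    by (rule csol_pairing[OF csol_riemann[of u V] assms(1)]) blast
  define S where "S = sint 0 V (\<lambda>v. of_real ((R - u) * E1 ((R - u) * (V - v))) * b R v)"
  have "X R 0 - X u 0 = 0"
    unfolding X[symmetric] by (rule sint_zero) (simp add: zero)
  moreover have "X R V - X u V = - b R V - (- b u V)"
    unfolding X[symmetric]
    by (rule sint_antiderivative)
      (use has_vector_derivative_minus[OF csolD(3)[OF assms(1)], of V] in simp)
  moreover have "X u V - X u 0 = 0"
    unfolding X[symmetric] by (rule sint_zero) simp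
  moreover have "X R V - X R 0 = - S"
    unfolding X[symmetric] S_def by (simp add: sint_def)
  ultimately have "b u V = b R V - S" by algebra
  then show ?thesis by (simp only: S_def)
qed

text \<open>The solution with \<open>\<phi> = g\<close> on \<open>v = 0\<close> and \<open>\<psi> = 0\<close> on \<open>u = R\<close>; the sum of such a solution for \<open>R = 0\<close>
  and a mirrored one solves the characteristic problem.\<close>

definition charsol_phi :: "(real \<Rightarrow> complex) \<Rightarrow> real \<Rightarrow> real \<Rightarrow> real \<Rightarrow> complex" where
  "charsol_phi g R u v = g u - sint u R (\<lambda>s. (v * E1 (v * (s - u))) *\<^sub>R g s)"

definition charsol_psi :: "(real \<Rightarrow> complex) \<Rightarrow> real \<Rightarrow> real \<Rightarrow> real \<Rightarrow> complex" where
  "charsol_psi g R u v = sint u R (\<lambda>s. E0 (v * (s - u)) *\<^sub>R g s)"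

lemma csol_charsol:
  assumes g: "continuous_on UNIV g"
  shows "csol (charsol_phi g R) (charsol_psi g R)"
proof (rule csolI)
  note [continuous_intros] = continuous_on_compose_UNIV[OF g]
  show "continuous_on UNIV (\<lambda>(u, v). charsol_phi g R u v)" "continuous_on UNIV (\<lambda>(u, v). charsol_psi g R u v)"
    unfolding charsol_phi_def charsol_psi_def split_beta
    by (intro continuous_intros continuous_on_sint; simp add: split_beta; intro continuous_intros)+
  show "((\<lambda>u. charsol_psi g R u v) has_vector_derivative - charsol_phi g R u v) (at u)" for u v
  proof -
    have "((\<lambda>u. E0 (v * (s - u)) *\<^sub>R g s) has_vector_derivative (v * E1 (v * (s - u))) *\<^sub>R g s) (at u)" for u s
    proof (rule has_vector_derivative_scaleR_const)
      have "((\<lambda>u. E0 (v * (s - u))) has_real_derivative - E1 (v * (s - u)) * (- v)) (at u)"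
        by (rule DERIV_chain'[where g=E0, OF _ DERIV_E0]) (auto intro!: derivative_eq_intros)
      then show "((\<lambda>u. E0 (v * (s - u))) has_real_derivative v * E1 (v * (s - u))) (at u)"
        by (simp add: mult.commute)
    qed
    then have "((\<lambda>u. sint u R (\<lambda>s. E0 (v * (s - u)) *\<^sub>R g s)) has_vector_derivative
        sint u R (\<lambda>s. (v * E1 (v * (s - u))) *\<^sub>R g s) - E0 (v * (u - u)) *\<^sub>R g u) (at u)"
      by (rule sint_lower_param_has_vector_derivative) (auto simp: split_beta intro!: continuous_intros)
    then show ?thesis
      unfolding charsol_phi_def charsol_psi_def by simp
  qed
  show "((\<lambda>v. charsol_phi g R u v) has_vector_derivative - charsol_psi g R u v) (at v)" for u v
  proof -
    have "((\<lambda>v. (v * E1 (v * (s - u))) *\<^sub>R g s) has_vector_derivative E0 (v * (s - u)) *\<^sub>R g s) (at v)" for v s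
    proof (rule has_vector_derivative_scaleR_const)
      have "((\<lambda>v. E1 (v * (s - u))) has_real_derivative E2 (v * (s - u)) * (s - u)) (at v)"
        by (rule DERIV_chain'[where g=E1, OF _ DERIV_E1]) (auto intro!: derivative_eq_intros)
      then show "((\<lambda>v. v * E1 (v * (s - u))) has_real_derivative E0 (v * (s - u))) (at v)"
        by (auto intro!: derivative_eq_intros simp: E1_plus_E2[symmetric] algebra_simps)
    qed
    then have "((\<lambda>v. sint u R (\<lambda>s. (v * E1 (v * (s - u))) *\<^sub>R g s)) has_vector_derivative
        sint u R (\<lambda>s. E0 (v * (s - u)) *\<^sub>R g s)) (at v)"
      by (rule sint_param_has_vector_derivative) (auto simp: split_beta intro!: continuous_intros)
    from has_vector_derivative_diff[OF has_vector_derivative_const this]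
    show ?thesis
      unfolding charsol_phi_def charsol_psi_def by simp
  qed
qed

lemma charsol_phi_0 [simp]: "charsol_phi g R u 0 = g u"
  by (simp add: charsol_phi_def sint_zero)

lemma charsol_psi_R [simp]: "charsol_psi g R R v = 0"
  by (simp add: charsol_psi_def)

text \<open>Riemann's formula for the Cauchy data \<open>F\<close>, \<open>G\<close> on \<open>u = v\<close>. Reflection in \<open>u = v\<close> exchanges the roles of
  \<open>\<phi>\<close> and \<open>\<psi>\<close>, so the second component is \<open>cauchy_phi G F v u\<close>.\<close>

definition cauchy_phi :: "(real \<Rightarrow> complex) \<Rightarrow> (real \<Rightarrow> complex) \<Rightarrow> real \<Rightarrow> real \<Rightarrow> complex" where
  "cauchy_phi F G u v = F (2 * u) + sint v u (\<lambda>s.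
     E0 ((s - v) * (u - s)) *\<^sub>R G (2 * s) - ((s - v) * E1 ((s - v) * (u - s))) *\<^sub>R F (2 * s))"

text \<open>At the lower limit \<open>s = v\<close> the two kernels are 1 and 0, which produces
  \<open>G (2 * v)\<close>. The differentiated integrand is the mirrored one because
  \<open>(s - v) * (u - s) = (s - u) * (v - s)\<close>. By this symmetry one computation proves both
  equations of the system.\<close>

lemma cauchy_phi_v:
  assumes F: "continuous_on UNIV F" and G: "continuous_on UNIV G"
  shows "((\<lambda>v. cauchy_phi F G u v) has_vector_derivative - cauchy_phi G F v u) (at v)"
proof -
  note [continuous_intros] = continuous_on_compose_UNIV[OF F] continuous_on_compose_UNIV[OF G]
  let ?z = "\<lambda>v s. (s - v) * (u - s)"
  let ?f = "\<lambda>v s. E0 (?z v s) *\<^sub>R G (2 * s) - ((s - v) * E1 (?z v s)) *\<^sub>R F (2 * s)"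
  let ?fv = "\<lambda>v s. ((u - s) * E1 (?z v s)) *\<^sub>R G (2 * s) - (- E0 (?z v s)) *\<^sub>R F (2 * s)"
  have "((\<lambda>v. ?f v s) has_vector_derivative ?fv v s) (at v)" for v s
  proof (rule has_vector_derivative_diff; rule has_vector_derivative_scaleR_const)
    have "((\<lambda>v. E0 (?z v s)) has_real_derivative - E1 (?z v s) * (- (u - s))) (at v)"
      by (rule DERIV_chain'[where g=E0, OF _ DERIV_E0]) (auto intro!: derivative_eq_intros)
    then show "((\<lambda>v. E0 (?z v s)) has_real_derivative (u - s) * E1 (?z v s)) (at v)"
      by (simp add: algebra_simps)
    have "((\<lambda>v. E1 (?z v s)) has_real_derivative E2 (?z v s) * (- (u - s))) (at v)"
      by (rule DERIV_chain'[where g=E1, OF _ DERIV_E1]) (auto intro!: derivative_eq_intros)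
    then show "((\<lambda>v. (s - v) * E1 (?z v s)) has_real_derivative - E0 (?z v s)) (at v)"
      by (auto intro!: derivative_eq_intros simp: E1_plus_E2[symmetric] algebra_simps)
  qed
  then have 1: "((\<lambda>v. sint v u (?f v)) has_vector_derivative sint v u (?fv v) - ?f v v) (at v)"
    by (rule sint_lower_param_has_vector_derivative) (auto simp: split_beta intro!: continuous_intros)
  have "sint v u (?fv v) = - sint u v (?fv v)"
    by (rule sint_swap)
  also have "\<dots> = - sint u v (\<lambda>s. E0 ((s - u) * (v - s)) *\<^sub>R F (2 * s)
      - ((s - u) * E1 ((s - u) * (v - s))) *\<^sub>R G (2 * s))"
  proof -
    have "?fv v = (\<lambda>s. E0 ((s - u) * (v - s)) *\<^sub>R F (2 * s)
      - ((s - u) * E1 ((s - u) * (v - s))) *\<^sub>R G (2 * s))"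
    proof
      fix s
      have "(s - u) * (v - s) = ?z v s" by algebra
      moreover have "s - u = - (u - s)" by simp
      ultimately show "?fv v s = E0 ((s - u) * (v - s)) *\<^sub>R F (2 * s)
        - ((s - u) * E1 ((s - u) * (v - s))) *\<^sub>R G (2 * s)"
        by (simp only: mult_minus_left scaleR_minus_left diff_minus_eq_add add.commute)
    qed
    then show ?thesis by simp
  qed
  finally have "sint v u (?fv v) - ?f v v = - cauchy_phi G F v u"
    by (simp add: cauchy_phi_def)
  with has_vector_derivative_add[OF has_vector_derivative_const 1] show ?thesis
    unfolding cauchy_phi_def[of F G] by simp
qed

lemma csol_cauchy:
  assumes F: "continuous_on UNIV F" and G: "continuous_on UNIV G"
  shows "csol (cauchy_phi F G) (\<lambda>u v. cauchy_phi G F v u)"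
proof (rule csolI)
  note [continuous_intros] = continuous_on_compose_UNIV[OF F] continuous_on_compose_UNIV[OF G]
  show "continuous_on UNIV (\<lambda>(u, v). cauchy_phi F G u v)" "continuous_on UNIV (\<lambda>(u, v). cauchy_phi G F v u)"
    unfolding cauchy_phi_def split_beta
    by (intro continuous_intros continuous_on_sint; simp add: split_beta; intro continuous_intros)+
qed (rule cauchy_phi_v assms)+

lemma cauchy_phi_diag [simp]: "cauchy_phi F G s s = F (2 * s)"
  by (simp add: cauchy_phi_def)

section \<open>Square integrability and difference quotients\<close>

text \<open>The best choice is \<open>t = X / A\<close>. This derives Cauchy-Schwarz from a
  pointwise bound that is integrated for each \<open>t\<close>.\<close>

lemma square_le_of_amgm:
  fixes X A B :: real
  assumes le: "\<And>t. 0 < t \<Longrightarrow> 2 * X \<le> t * A + B / t" and "0 \<le> X" "0 \<le> A" "0 \<le> B"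
  shows "X^2 \<le> A * B"
proof (cases "X = 0")
  case True
  then show ?thesis using assms by simp
next
  case False
  then have X: "0 < X" using assms by simp
  show ?thesis
  proof (cases "A = 0")
    case True
    \<comment> \<open>Any large \<open>t\<close> would do when \<open>A\<close> is 0; the summand 1
      keeps this one positive when \<open>B\<close> is 0 as well.\<close>
    have "2 * X \<le> B / (B / X + 1)"
      using le[of "B / X + 1"] True X \<open>0 \<le> B\<close> by (simp add: add_nonneg_pos)
    also have "\<dots> \<le> X"
      using X \<open>0 \<le> B\<close> by (simp add: field_simps)
    finally show ?thesis using X by simp
  next
    case False
    then have A: "0 < A" using assms by simp
    have "2 * X \<le> X + B * A / X"
      using le[of "X / A"] X A by (simp add: field_simps)
    then have "X \<le> B * A / X" by simp
    then show ?thesis using X by (simp add: field_simps power2_eq_square)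
  qed
qed

text \<open>Integrability of \<open>p\<close> and of its square is all that is assumed, because
  \<open>p\<close> will also be a weak derivative.\<close>

lemma cauchy_schwarz_integral_length:
  fixes p :: "real \<Rightarrow> complex"
  assumes p: "p integrable_on {a..b}" and p2: "(\<lambda>x. (cmod (p x))^2) integrable_on {a..b}" and "a \<le> b"
  shows "(cmod (integral {a..b} p))^2 \<le> (b - a) * integral {a..b} (\<lambda>x. (cmod (p x))^2)"
proof (rule square_le_of_amgm)
  fix t :: real assume t: "0 < t"
  have "cmod (integral {a..b} p) \<le> integral {a..b} (\<lambda>x. t / 2 + (cmod (p x))^2 * (1 / (2 * t)))"
  proof (rule integral_norm_bound_integral[OF p])
    show "(\<lambda>x. t / 2 + (cmod (p x))^2 * (1 / (2 * t))) integrable_on {a..b}"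
      by (intro integrable_add integrable_on_mult_left p2 integrable_const_ivl)
    fix x
    have "2 * t * cmod (p x) \<le> t^2 + (cmod (p x))^2"
      using sum_squares_bound[of t "cmod (p x)"] by simp
    then show "cmod (p x) \<le> t / 2 + (cmod (p x))^2 * (1 / (2 * t))"
      using t by (simp add: field_simps power2_eq_square)
  qed
  also have "\<dots> = (b - a) * (t / 2) + integral {a..b} (\<lambda>x. (cmod (p x))^2) * (1 / (2 * t))"
    using integral_add[OF integrable_const_ivl integrable_on_mult_left[OF p2], of "t / 2" "1 / (2 * t)"] assms(3)
    by simp
  finally show "2 * cmod (integral {a..b} p) \<le> t * (b - a) + integral {a..b} (\<lambda>x. (cmod (p x))^2) / t"
    using t by (simp add: field_simps)
qed (use assms in \<open>auto intro!: integral_nonneg\<close>)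

lemma cauchy_schwarz_integral:
  fixes p :: "real \<Rightarrow> real" and f :: "real \<Rightarrow> complex"
  assumes p: "continuous_on {a..b} p" and f: "continuous_on {a..b} f"
  shows "(cmod (integral {a..b} (\<lambda>x. p x *\<^sub>R f x)))^2
    \<le> integral {a..b} (\<lambda>x. (p x)^2) * integral {a..b} (\<lambda>x. (cmod (f x))^2)"
proof (rule square_le_of_amgm)
  fix t :: real assume t: "0 < t"
  have "cmod (integral {a..b} (\<lambda>x. p x *\<^sub>R f x))
    \<le> integral {a..b} (\<lambda>x. (p x)^2 * (t / 2) + (cmod (f x))^2 * (1 / (2 * t)))"
  proof (rule integral_norm_bound_integral)
    fix x
    have "2 * (t * \<bar>p x\<bar>) * cmod (f x) \<le> (t * \<bar>p x\<bar>)^2 + (cmod (f x))^2"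
      using sum_squares_bound[of "t * \<bar>p x\<bar>" "cmod (f x)"] by simp
    then show "cmod (p x *\<^sub>R f x) \<le> (p x)^2 * (t / 2) + (cmod (f x))^2 * (1 / (2 * t))"
      using t by (simp add: field_simps power2_eq_square)
  qed (use t in \<open>auto intro!: integrable_continuous_real continuous_intros p f\<close>)
  also have "\<dots> = integral {a..b} (\<lambda>x. (p x)^2) * (t / 2) + integral {a..b} (\<lambda>x. (cmod (f x))^2) * (1 / (2 * t))"
    using t by (subst integral_add) (auto intro!: integrable_continuous_real continuous_intros p f)
  finally show "2 * cmod (integral {a..b} (\<lambda>x. p x *\<^sub>R f x))
    \<le> t * integral {a..b} (\<lambda>x. (p x)^2) + integral {a..b} (\<lambda>x. (cmod (f x))^2) / t"
    using t by (simp add: field_simps)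
qed (auto intro!: integral_nonneg integrable_continuous_real continuous_intros p f)

lemma tendsto_mono_bounded_at_top:
  fixes f :: "real \<Rightarrow> real"
  assumes mono: "\<And>x y. 0 \<le> x \<Longrightarrow> x \<le> y \<Longrightarrow> f x \<le> f y" and bdd: "\<And>x. 0 \<le> x \<Longrightarrow> f x \<le> K"
  obtains L where "(f \<longlongrightarrow> L) at_top" "L \<le> K" "\<And>x. 0 \<le> x \<Longrightarrow> f x \<le> L"
proof -
  define L where "L = (SUP x\<in>{0..}. f x)"
  have bd: "bdd_above (f ` {0..})" using bdd by (auto intro!: bdd_aboveI2)
  have le: "f x \<le> L" if "0 \<le> x" for x
    unfolding L_def using that by (intro cSUP_upper bd) auto
  have LK: "L \<le> K" unfolding L_def using bdd by (intro cSUP_least) auto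
  have "(f \<longlongrightarrow> L) at_top"
  proof (rule increasing_tendsto)
    show "\<forall>\<^sub>F n in at_top. f n \<le> L"
      using eventually_ge_at_top[of 0] by eventually_elim (rule le)
    fix x assume "x < L"
    then obtain y where y: "y \<in> {0..}" "x < f y"
      unfolding L_def by (subst (asm) less_cSUP_iff[OF _ bd]) auto
    show "\<forall>\<^sub>F n in at_top. x < f n"
      using eventually_ge_at_top[of y] by eventually_elim (use y mono[of y] in force)
  qed
  with LK le that show thesis by blast
qed

lemma has_integral_Ici_Ioi:
  fixes f :: "real \<Rightarrow> 'a::banach"
  shows "(f has_integral I) {a..} \<longleftrightarrow> (f has_integral I) {a<..}"
  by (rule has_integral_spike_set_eq; rule negligible_subset[of "{a}"]) auto

lemma has_integral_Ioi_bounded: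
  fixes p :: "real \<Rightarrow> real"
  assumes p: "continuous_on {0..} p" and nonneg: "\<And>x. 0 \<le> x \<Longrightarrow> 0 \<le> p x"
    and K: "\<And>U. 0 \<le> U \<Longrightarrow> integral {0..U} p \<le> K"
  obtains L where "(p has_integral L) {0<..}" "((\<lambda>U. integral {0..U} p) \<longlongrightarrow> L) at_top" "L \<le> K"
proof -
  have int: "p integrable_on {0..U}" for U
    by (rule integrable_continuous_real[OF continuous_on_subset[OF p]]) auto
  obtain L where L: "((\<lambda>U. integral {0..U} p) \<longlongrightarrow> L) at_top" "L \<le> K"
  proof (rule tendsto_mono_bounded_at_top)
    show "integral {0..x} p \<le> integral {0..y} p" if "0 \<le> x" "x \<le> y" for x y
      using that by (intro integral_subset_le int) (auto intro: nonneg)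
  qed (use K in auto)
  then show thesis
    using that has_integral_to_inf[OF int L(1) nonneg] by (simp add: has_integral_Ici_Ioi)
qed

text \<open>After the shift only two end strips of width \<open>h\<close> survive. Where
  Cauchy-Schwarz bounds a squared increment by \<open>h\<close> times the increment of a bounded
  function, this supplies the second factor \<open>h\<close>.\<close>

lemma integral_increment_bound:
  fixes P :: "real \<Rightarrow> real"
  assumes P: "continuous_on {0..} P" and "0 < h" "0 \<le> U"
    and bdd: "\<And>x. 0 \<le> x \<Longrightarrow> 0 \<le> P x" "\<And>x. 0 \<le> x \<Longrightarrow> P x \<le> M"
  shows "integral {0..U} (\<lambda>x. P (x + h) - P x) \<le> h * M"
proof -
  have int: "P integrable_on {a..b}" if "0 \<le> a" for a b
    by (rule integrable_continuous_real[OF continuous_on_subset[OF P]]) (use that in auto)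
  have sh: "((\<lambda>x. P (x + h)) has_integral integral {h..U+h} P) {0..U}"
    using has_integral_shift_Icc_real[of P h "integral {h..U+h} P" 0 U] int[of h "U+h"] \<open>0 < h\<close>
    by (simp add: o_def add.commute integrable_integral)
  have "integral {0..U} (\<lambda>x. P (x + h) - P x) = integral {h..U+h} P - integral {0..U} P"
    using integral_diff[OF has_integral_integrable[OF sh] int[of 0 U]] integral_unique[OF sh] by simp
  also have "integral {h..U+h} P = integral {0..U+h} P - integral {0..h} P"
    using Henstock_Kurzweil_Integration.integral_combine[of 0 h "U+h" P] int assms by simp
  also have "integral {0..U+h} P = integral {0..U} P + integral {U..U+h} P"
    using Henstock_Kurzweil_Integration.integral_combine[of 0 U "U+h" P] int assms by simp
  finally have "integral {0..U} (\<lambda>x. P (x + h) - P x) = integral {U..U+h} P - integral {0..h} P"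
    by simp
  moreover have "integral {U..U+h} P \<le> integral {U..U+h} (\<lambda>_. M)"
    by (rule integral_le) (use int assms in auto)
  moreover have "integral {0..h} P \<ge> 0"
    by (rule integral_nonneg) (use int assms in auto)
  ultimately show ?thesis using assms by simp
qed

section \<open>Uniform square bounds and difference quotients\<close>

definition square_bounded :: "(real \<Rightarrow> complex) \<Rightarrow> real \<Rightarrow> bool" where
  "square_bounded f K \<longleftrightarrow> (\<forall>U\<ge>0. integral {0..U} (\<lambda>x. (cmod (f x))^2) \<le> K)"

text \<open>A quantitative substitute for a square integrable derivative. It mentions no derivative,
  so energy estimates for the difference of a solution and its translate can propagate it.\<close>

definition diff_bounded :: "(real \<Rightarrow> complex) \<Rightarrow> real \<Rightarrow> bool" where
  "diff_bounded f K \<longleftrightarrow> (\<forall>h. 0 < h \<longrightarrow> h \<le> 1 \<longrightarrow> square_bounded (\<lambda>x. f (x + h) - f x) (K * h^2))"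

lemma square_boundedD: "square_bounded f K \<Longrightarrow> 0 \<le> U \<Longrightarrow> integral {0..U} (\<lambda>x. (cmod (f x))^2) \<le> K"
  by (simp add: square_bounded_def)

lemma square_bounded_mono: "square_bounded f K \<Longrightarrow> K \<le> K' \<Longrightarrow> square_bounded f K'"
  by (force simp: square_bounded_def)

lemma diff_boundedD: "diff_bounded f K \<Longrightarrow> 0 < h \<Longrightarrow> h \<le> 1 \<Longrightarrow> square_bounded (\<lambda>x. f (x + h) - f x) (K * h^2)"
  by (simp add: diff_bounded_def)

lemma cmod_add_square_le: "(cmod (x + y))^2 \<le> 2 * (cmod x)^2 + 2 * (cmod y)^2"
proof -
  have "(cmod (x + y))^2 \<le> (cmod x + cmod y)^2"
    by (intro power_mono norm_triangle_ineq) auto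
  also have "\<dots> \<le> 2 * (cmod x)^2 + 2 * (cmod y)^2"
    using sum_squares_bound[of "cmod x" "cmod y"] by (simp add: power2_sum)
  finally show ?thesis .
qed

lemma square_integral_add_le:
  fixes f g :: "real \<Rightarrow> complex"
  assumes "continuous_on {a..b} f" "continuous_on {a..b} g"
  shows "integral {a..b} (\<lambda>x. (cmod (f x + g x))^2) \<le>
    2 * integral {a..b} (\<lambda>x. (cmod (f x))^2) + 2 * integral {a..b} (\<lambda>x. (cmod (g x))^2)"
proof -
  have "integral {a..b} (\<lambda>x. (cmod (f x + g x))^2) \<le> integral {a..b} (\<lambda>x. 2 * (cmod (f x))^2 + 2 * (cmod (g x))^2)"
    by (rule integral_le) (auto intro!: integrable_continuous_real continuous_intros assms cmod_add_square_le)
  also have "\<dots> = 2 * integral {a..b} (\<lambda>x. (cmod (f x))^2) + 2 * integral {a..b} (\<lambda>x. (cmod (g x))^2)"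
    by (subst integral_add) (auto intro!: integrable_continuous_real continuous_intros assms)
  finally show ?thesis .
qed

lemma square_bounded_add:
  assumes "continuous_on UNIV f" "continuous_on UNIV g" "square_bounded f K" "square_bounded g L"
  shows "square_bounded (\<lambda>x. f x + g x) (2 * K + 2 * L)"
  unfolding square_bounded_def
proof safe
  fix U :: real assume U: "0 \<le> U"
  show "integral {0..U} (\<lambda>x. (cmod (f x + g x))^2) \<le> 2 * K + 2 * L"
    using square_integral_add_le[OF continuous_on_subset[OF assms(1) subset_UNIV] continuous_on_subset[OF assms(2) subset_UNIV], of 0 U]
      square_boundedD[OF assms(3) U] square_boundedD[OF assms(4) U] by linarith
qed

text \<open>Difference quotients in a form that makes sense at \<open>h = 0\<close>.\<close>

definition average :: "(real \<Rightarrow> complex) \<Rightarrow> real \<Rightarrow> real \<Rightarrow> complex" where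
  "average c h x = integral {0..1} (\<lambda>r. c (x + r * h))"

lemma average_0 [simp]: "average c 0 x = c x"
  by (simp add: average_def)

lemma continuous_on_average:
  assumes "continuous_on UNIV c" shows "continuous_on UNIV (\<lambda>(h, x). average c h x)"
proof -
  have "continuous_on (UNIV \<times> cbox 0 1) (\<lambda>(p, r). c (snd p + r * fst p))"
    unfolding split_beta by (intro continuous_intros continuous_on_compose_UNIV[OF assms])
  from integral_continuous_on_param[OF this] show ?thesis
    by (simp add: average_def split_beta)
qed

lemma scaleR_average:
  assumes "continuous_on UNIV c" shows "h *\<^sub>R average c h x = sint x (x + h) c"
  using sint_unit_interval[OF assms, of x "x + h"] by (simp add: average_def)

text \<open>\<open>B\<close> is a difference quotient that has been extended continuously to
  \<open>h = 0\<close>. The factor \<open>h^2\<close> cancels on both sides, and the bound survives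
  the limit.\<close>

lemma square_integral_le_at_0:
  fixes B :: "real \<Rightarrow> real \<Rightarrow> complex"
  assumes B: "continuous_on UNIV (\<lambda>(h, x). B h x)"
    and le: "\<And>h. 0 < h \<Longrightarrow> h < 1 \<Longrightarrow> integral {0..U} (\<lambda>x. (cmod (h *\<^sub>R B h x))^2) \<le> K * h^2"
  shows "integral {0..U} (\<lambda>x. (cmod (B 0 x))^2) \<le> K"
proof -
  define N where "N h = integral {0..U} (\<lambda>x. (cmod (B h x))^2)" for h
  have "continuous_on (UNIV \<times> cbox 0 U) (\<lambda>(h, x). (cmod (B h x))^2)"
    using continuous_on_subset[OF B, of "UNIV \<times> cbox 0 U"]
    unfolding split_beta by (intro continuous_intros) auto
  from integral_continuous_on_param[OF this] have "continuous_on UNIV N"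
    by (simp add: N_def[abs_def])
  then have "(N \<longlongrightarrow> N 0) (at_right 0)"
    by (auto simp: continuous_on_def intro: filterlim_mono[OF _ order_refl at_le])
  moreover have "\<forall>\<^sub>F h in at_right 0. N h \<le> K"
  proof (rule eventually_at_rightI[of 0 1])
    fix h :: real assume h: "h \<in> {0<..<1}"
    have "h^2 * N h = integral {0..U} (\<lambda>x. (cmod (h *\<^sub>R B h x))^2)"
      by (simp add: N_def power_mult_distrib)
    also have "\<dots> \<le> K * h^2"
      using le[of h] h by simp
    finally show "N h \<le> K" using h by (simp add: mult.commute)
  qed simp
  ultimately have "N 0 \<le> K"
    by (rule tendsto_upperbound) simp
  then show ?thesis by (simp add: N_def)
qed

lemma diff_quotient_limit:
  assumes c: "continuous_on UNIV c" and C: "\<And>x. (C has_vector_derivative c x) (at x)"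
    and bd: "diff_bounded C K"
  shows "square_bounded c K"
  unfolding square_bounded_def
proof safe
  fix U :: real assume U: "0 \<le> U"
  have "integral {0..U} (\<lambda>x. (cmod (average c 0 x))^2) \<le> K"
  proof (rule square_integral_le_at_0[OF continuous_on_average[OF c]])
    fix h :: real assume h: "0 < h" "h < 1"
    have "h *\<^sub>R average c h x = C (x + h) - C x" for x
      unfolding scaleR_average[OF c] by (rule sint_antiderivative[OF C])
    then show "integral {0..U} (\<lambda>x. (cmod (h *\<^sub>R average c h x))^2) \<le> K * h^2"
      using square_boundedD[OF diff_boundedD[OF bd, of h] U] h by simp
  qed
  then show "integral {0..U} (\<lambda>x. (cmod (c x))^2) \<le> K" by simp
qed

text \<open>The left side is what integration by parts would turn into the integral of
  \<open>p\<close> times the derivative of \<open>f\<close>, so this is Cauchy-Schwarz for that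
  integral. As \<open>f\<close> need not be differentiable, it is replaced by its mean over
  \<open>[x, x + h]\<close>, whose derivative is the difference quotient, and \<open>h\<close> tends
  to 0.\<close>

lemma parts_bound:
  fixes p :: "real \<Rightarrow> real" and f :: "real \<Rightarrow> complex"
  assumes f: "continuous_on UNIV f" and bd: "diff_bounded f K"
    and p: "\<And>x. (p has_real_derivative p' x) (at x)" and p': "continuous_on UNIV p'" and V: "0 \<le> V"
  shows "(cmod (p V *\<^sub>R f V - p 0 *\<^sub>R f 0 - integral {0..V} (\<lambda>x. p' x *\<^sub>R f x)))^2
    \<le> integral {0..V} (\<lambda>x. (p x)^2) * K"
proof -
  have cp: "continuous_on A p" for A
    by (auto intro!: continuous_at_imp_continuous_on DERIV_isCont[OF p])
  define D where "D h = p V *\<^sub>R average f h V - p 0 *\<^sub>R average f h 0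
     - integral {0..V} (\<lambda>x. p' x *\<^sub>R average f h x)" for h
  have "continuous_on (UNIV \<times> cbox 0 V) (\<lambda>(h, x). p' x *\<^sub>R average f h x)"
    using continuous_on_subset[OF continuous_on_average[OF f], of "UNIV \<times> cbox 0 V"]
    unfolding split_beta by (intro continuous_intros continuous_on_compose_UNIV[OF p']) auto
  from integral_continuous_on_param[OF this] have "continuous_on UNIV D"
    unfolding D_def
    by (intro continuous_intros continuous_on_section1[OF continuous_on_average[OF f]]) simp
  then have "((\<lambda>h. (cmod (D h))^2) \<longlongrightarrow> (cmod (D 0))^2) (at_right 0)"
    by (auto simp: continuous_on_def intro!: tendsto_intros intro: filterlim_mono[OF _ order_refl at_le])
  moreover have "\<forall>\<^sub>F h in at_right 0. (cmod (D h))^2 \<le> integral {0..V} (\<lambda>x. (p x)^2) * K"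
  proof (rule eventually_at_rightI[of 0 1])
    fix h :: real assume h: "h \<in> {0<..<1}"
    define q where "q x = sint 0 x f" for x
    have q: "(q has_vector_derivative f x) (at x)" for x
      unfolding q_def by (rule sint_has_vector_derivative[OF f])
    have avg: "average f h x = (1 / h) *\<^sub>R (q (x + h) - q x)" for x
    proof -
      have "average f h x = (1 / h) *\<^sub>R (h *\<^sub>R average f h x)" using h by simp
      also have "h *\<^sub>R average f h x = q (x + h) - q x"
        unfolding scaleR_average[OF f] by (rule sint_antiderivative[OF q])
      finally show ?thesis .
    qed
    have davg: "((\<lambda>x. average f h x) has_vector_derivative (1 / h) *\<^sub>R (f (x + h) - f x)) (at x)" for x
    proof -
      have "((\<lambda>x. x + h) has_vector_derivative 1) (at x)"
        by (auto intro!: derivative_eq_intros)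
      from vector_diff_chain_at[OF this q]
      have "((\<lambda>x. q (x + h)) has_vector_derivative f (x + h)) (at x)" by (simp add: o_def)
      then show ?thesis
        unfolding avg
        by (intro bounded_linear.has_vector_derivative[OF bounded_linear_scaleR_right] has_vector_derivative_diff q)
    qed
    have 1: "((\<lambda>x. p x *\<^sub>R ((1 / h) *\<^sub>R (f (x + h) - f x)) + p' x *\<^sub>R average f h x) has_integral
      (p V *\<^sub>R average f h V - p 0 *\<^sub>R average f h 0)) {0..V}"
      by (rule fundamental_theorem_of_calculus[OF V])
        (intro has_vector_derivative_at_within[OF has_vector_derivative_scaleR] p davg)
    have 2: "((\<lambda>x. p' x *\<^sub>R average f h x) has_integral integral {0..V} (\<lambda>x. p' x *\<^sub>R average f h x)) {0..V}"
      by (intro integrable_integral integrable_continuous_real continuous_intros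
         continuous_on_subset[OF p'] continuous_on_section2[OF continuous_on_average[OF f]]) auto
    have "((\<lambda>x. p x *\<^sub>R ((1 / h) *\<^sub>R (f (x + h) - f x))) has_integral D h) {0..V}"
      using has_integral_diff[OF 1 2] by (simp add: D_def)
    then have "(cmod (D h))^2 = (cmod (integral {0..V} (\<lambda>x. p x *\<^sub>R ((1 / h) *\<^sub>R (f (x + h) - f x)))))^2"
      by (simp add: integral_unique)
    also have "\<dots> \<le> integral {0..V} (\<lambda>x. (p x)^2) * integral {0..V} (\<lambda>x. (cmod ((1 / h) *\<^sub>R (f (x + h) - f x)))^2)"
      by (intro cauchy_schwarz_integral cp continuous_intros continuous_on_compose_UNIV[OF f])
    also have "integral {0..V} (\<lambda>x. (cmod ((1 / h) *\<^sub>R (f (x + h) - f x)))^2)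
        = (1 / h)^2 * integral {0..V} (\<lambda>x. (cmod (f (x + h) - f x))^2)"
      using h by (simp add: power_mult_distrib norm_divide power_divide)
    finally have "(cmod (D h))^2 \<le> integral {0..V} (\<lambda>x. (p x)^2) *
        ((1 / h)^2 * integral {0..V} (\<lambda>x. (cmod (f (x + h) - f x))^2))" .
    also have "\<dots> \<le> integral {0..V} (\<lambda>x. (p x)^2) * ((1 / h)^2 * (K * h^2))"
    proof (intro mult_left_mono)
      show "integral {0..V} (\<lambda>x. (cmod (f (x + h) - f x))^2) \<le> K * h^2"
        using square_boundedD[OF diff_boundedD[OF bd, of h] V] h by simp
    qed (auto intro!: integral_nonneg integrable_continuous_real continuous_on_power cp)
    finally show "(cmod (D h))^2 \<le> integral {0..V} (\<lambda>x. (p x)^2) * K"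
      using h by (simp add: power_divide)
  qed simp
  ultimately have "(cmod (D 0))^2 \<le> integral {0..V} (\<lambda>x. (p x)^2) * K"
    by (rule tendsto_upperbound) simp
  then show ?thesis by (simp add: D_def)
qed

section \<open>Square integrable weak derivatives on the half line\<close>

lemma H1_derivative:
  assumes "H1 f"
  obtains p where "(\<lambda>x. (cmod (f x))^2) integrable_on {0<..}"
    "(\<lambda>x. (cmod (p x))^2) integrable_on {0..}" "p \<in> borel_measurable lebesgue"
    "\<And>a b. 0 < a \<Longrightarrow> a \<le> b \<Longrightarrow> (p has_integral (f b - f a)) {a..b}"
proof -
  from assms obtain q where f: "(\<lambda>x. (cmod (f x))^2) integrable_on {0<..}"
    and q2: "(\<lambda>x. (cmod (q x))^2) integrable_on {0<..}"
    and q: "\<And>a b. 0 < a \<Longrightarrow> a \<le> b \<Longrightarrow> (q has_integral (f b - f a)) {a..b}"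
    unfolding H1_def by blast
  \<comment> \<open>\<open>H1\<close> constrains its witness only on the positive axis. With the
    value 0 elsewhere, \<open>p\<close> is the pointwise limit of its restrictions to
    \<open>[1 / (n + 1), n + 1]\<close>, and these are measurable as integrable functions.\<close>
  define p where "p x = (if 0 < x then q x else 0)" for x
  have p: "(p has_integral (f b - f a)) {a..b}" if "0 < a" "a \<le> b" for a b
    using has_integral_eq[OF _ q[OF that], of p] that by (simp add: p_def)
  have "(\<lambda>x. (cmod (p x))^2) integrable_on {0<..}"
    using q2 by (rule integrable_eq) (simp add: p_def)
  then have p2: "(\<lambda>x. (cmod (p x))^2) integrable_on {0..}"
    by (auto simp: integrable_on_def has_integral_Ici_Ioi)
  have "p \<in> borel_measurable lebesgue"
  proof (rule borel_measurable_LIMSEQ_metric)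
    fix n
    have "(p has_integral f (real (Suc n)) - f (1 / real (Suc n))) {1 / real (Suc n)..real (Suc n)}"
      by (rule p) (auto simp: field_simps)
    from has_integral_implies_lebesgue_measurable[OF this]
    show "(\<lambda>x. indicator {1 / real (Suc n)..real (Suc n)} x *\<^sub>R p x) \<in> borel_measurable lebesgue" .
  next
    fix x :: real
    show "(\<lambda>n. indicator {1 / real (Suc n)..real (Suc n)} x *\<^sub>R p x) \<longlonglongrightarrow> p x"
    proof (cases "0 < x")
      case True
      have "\<forall>\<^sub>F n in sequentially. 1 / real (Suc n) < x"
        using order_tendstoD(2)[OF LIMSEQ_inverse_real_of_nat True] by (simp add: inverse_eq_divide)
      moreover have "\<forall>\<^sub>F n in sequentially. x < real (Suc n)"
        using eventually_gt_at_top[of "nat \<lceil>x\<rceil>"] by eventually_elim linarith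
      ultimately have "\<forall>\<^sub>F n in sequentially. indicator {1 / real (Suc n)..real (Suc n)} x *\<^sub>R p x = p x"
        by eventually_elim auto
      then show ?thesis by (rule tendsto_eventually)
    qed (simp add: p_def)
  qed
  with f p2 p that show thesis by blast
qed

lemma diff_bounded_mono:
  assumes "diff_bounded f K" "K \<le> L" shows "diff_bounded f L"
  unfolding diff_bounded_def
proof safe
  fix h :: real assume h: "0 < h" "h \<le> 1"
  show "square_bounded (\<lambda>x. f (x + h) - f x) (L * h^2)"
    by (rule square_bounded_mono[OF diff_boundedD[OF assms(1) h]]) (simp add: assms(2) mult_right_mono)
qed

lemma continuous_on_indefinite_integral:
  fixes r :: "real \<Rightarrow> 'b::banach"
  assumes "\<And>b. r integrable_on {0..b}"
  shows "continuous_on UNIV (\<lambda>x. integral {0..max 0 x} r)"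
proof -
  have "continuous_on {..<M} (\<lambda>x. integral {0..max 0 x} r)" for M :: real
    by (rule continuous_on_compose2[OF indefinite_integral_continuous_1[OF assms, of "max 0 M"], of _ "\<lambda>x. max 0 x"])
      (auto intro!: continuous_intros)
  then have "isCont (\<lambda>x. integral {0..max 0 x} r) x" for x
    using continuous_on_eq_continuous_at[OF open_lessThan[of "x + 1"], of "\<lambda>x. integral {0..max 0 x} r"]
    by simp
  then show ?thesis by (simp add: continuous_at_imp_continuous_on)
qed

text \<open>From \<open>cmod p \<le> 1 + (cmod p)^2\<close> the weak derivative \<open>p\<close> is
  integrable up to 0, so \<open>F\<close> has a limit there and extends continuously. Extended data
  let all solutions live on the whole plane.\<close>

lemma H1_extend:
  assumes "H1 F"
  obtains F' K where "continuous_on UNIV F'" "\<And>x. 0 < x \<Longrightarrow> F' x = F x"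
    "square_bounded F' K" "diff_bounded F' K"
proof -
  obtain p where F2: "(\<lambda>x. (cmod (F x))^2) integrable_on {0<..}"
    and p2: "(\<lambda>x. (cmod (p x))^2) integrable_on {0..}" and pm: "p \<in> borel_measurable lebesgue"
    and p: "\<And>a b. 0 < a \<Longrightarrow> a \<le> b \<Longrightarrow> (p has_integral (F b - F a)) {a..b}"
    by (rule H1_derivative[OF assms]) (rule that)
  have p2i: "(\<lambda>x. (cmod (p x))^2) integrable_on {a..b}" if "0 \<le> a" for a b
    by (rule integrable_on_subinterval[OF p2]) (use that in auto)
  have pi: "p integrable_on {a..b}" if "0 \<le> a" for a b
  proof (rule measurable_bounded_by_integrable_imp_integrable)
    show "p \<in> borel_measurable (lebesgue_on {a..b})"
      by (rule measurable_restrict_space1[OF pm])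
    show "(\<lambda>x. 1 + (cmod (p x))^2) integrable_on {a..b}"
      by (intro integrable_add p2i that integrable_const_ivl)
    show "cmod (p x) \<le> 1 + (cmod (p x))^2" for x
    proof -
      have "2 * cmod (p x) \<le> 1 + (cmod (p x))^2"
        using sum_squares_bound[of 1 "cmod (p x)"] by simp
      then show ?thesis using norm_ge_zero[of "p x"] by linarith
    qed
  qed auto
  \<comment> \<open>\<open>F'\<close> denotes the extension, not a derivative: the primitive of
    \<open>p\<close> normalised at 1, continued by a constant to the left of 0.\<close>
  define F' where "F' x = (F 1 - integral {0..1} p) + integral {0..max 0 x} p" for x
  have F'_diff: "F' b - F' a = integral {a..b} p" if "0 \<le> a" "a \<le> b" for a b
    using Henstock_Kurzweil_Integration.integral_combine[OF that pi[of 0 b]] that by (simp add: F'_def algebra_simps)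
  have F'_F: "F' x = F x" if "0 < x" for x
  proof (cases "x \<le> 1")
    case True
    have "F' 1 - F' x = F 1 - F x"
      using F'_diff[of x 1] p[of x 1] True that by (simp add: integral_unique)
    moreover have "F' 1 = F 1" by (simp add: F'_def)
    ultimately have "F 1 - F' x = F 1 - F x" by simp
    then show ?thesis by simp
  next
    case False
    have "F' x - F' 1 = F x - F 1"
      using F'_diff[of 1 x] p[of 1 x] False that by (simp add: integral_unique)
    moreover have "F' 1 = F 1" by (simp add: F'_def)
    ultimately show ?thesis by simp
  qed
  have contF': "continuous_on UNIV F'"
    unfolding F'_def by (intro continuous_on_add continuous_on_const continuous_on_indefinite_integral pi) simp
  define K1 where "K1 = integral {0<..} (\<lambda>x. (cmod (F x))^2)"
  have "square_bounded F' K1"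
    unfolding square_bounded_def
  proof safe
    fix U :: real assume "0 \<le> U"
    have "((\<lambda>x. (cmod (F x))^2) has_integral K1) {0..}"
      using F2 by (simp add: K1_def integrable_integral has_integral_Ici_Ioi)
    then have F0: "((\<lambda>x. (cmod (F' x))^2) has_integral K1) {0..}"
      by (rule has_integral_spike[OF negligible_sing[of 0], rotated]) (auto simp: F'_F)
    show "integral {0..U} (\<lambda>x. (cmod (F' x))^2) \<le> K1"
      using integral_subset_le[of "{0..U}" "{0..}" "\<lambda>x. (cmod (F' x))^2"] F0
        integrable_on_subinterval[of "\<lambda>x. (cmod (F' x))^2" "{0..}" 0 U]
      by (auto simp: has_integral_integrable integral_unique)
  qed
  define P where "P x = integral {0..max 0 x} (\<lambda>x. (cmod (p x))^2)" for x
  define K2 where "K2 = integral {0..} (\<lambda>x. (cmod (p x))^2)"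
  have "diff_bounded F' K2"
    unfolding diff_bounded_def square_bounded_def
  proof safe
    fix h U :: real assume h: "0 < h" "h \<le> 1" and U: "0 \<le> U"
    have contP': "continuous_on UNIV P"
      unfolding P_def by (intro continuous_on_indefinite_integral p2i) simp
    have "integral {0..U} (\<lambda>x. (cmod (F' (x + h) - F' x))^2) \<le> integral {0..U} (\<lambda>x. h * (P (x + h) - P x))"
    proof (rule integral_le)
      fix x assume x: "x \<in> {0..U}"
      have "(cmod (integral {x..x+h} p))^2 \<le> (x + h - x) * integral {x..x+h} (\<lambda>x. (cmod (p x))^2)"
        by (rule cauchy_schwarz_integral_length) (use x h in \<open>auto intro: pi p2i\<close>)
      also have "integral {x..x+h} (\<lambda>x. (cmod (p x))^2) = P (x + h) - P x"
        using Henstock_Kurzweil_Integration.integral_combine[of 0 x "x + h", OF _ _ p2i[of 0 "x + h"]] x h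
        by (simp add: P_def)
      finally show "(cmod (F' (x + h) - F' x))^2 \<le> h * (P (x + h) - P x)"
        using F'_diff[of x "x + h"] x h by simp
    qed (auto intro!: integrable_continuous_real continuous_intros continuous_on_compose_UNIV[OF contF'] continuous_on_compose_UNIV[OF contP'])
    also have "\<dots> = h * integral {0..U} (\<lambda>x. P (x + h) - P x)"
      by simp
    also have "\<dots> \<le> h * (h * K2)"
    proof (intro mult_left_mono integral_increment_bound)
      show "continuous_on {0..} P" by (rule continuous_on_subset[OF contP']) simp
      show "0 \<le> P x" for x unfolding P_def by (intro integral_nonneg p2i) auto
      show "P x \<le> K2" for x unfolding P_def K2_def by (intro integral_subset_le p2i p2) auto
    qed (use h U in auto)
    also have "h * (h * K2) = K2 * h^2"
      by (simp add: power2_eq_square)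
    finally show "integral {0..U} (\<lambda>x. (cmod (F' (x + h) - F' x))^2) \<le> K2 * h^2" .
  qed
  then have "diff_bounded F' (max K1 K2)"
    by (rule diff_bounded_mono) simp
  moreover have "square_bounded F' (max K1 K2)"
    by (rule square_bounded_mono[OF \<open>square_bounded F' K1\<close>]) simp
  ultimately show thesis using contF' F'_F that by blast
qed

text \<open>A weak derivative of \<open>f\<close> is already at hand, namely that of
  \<open>f0\<close> plus \<open>c\<close>. The difference bounds for \<open>f\<close> and
  \<open>f0\<close> give one for \<open>C\<close>, and for a continuously differentiable function
  this bounds the integral of \<open>(cmod (c x))^2\<close>.\<close>

lemma H1_perturb:
  assumes f0: "H1 f0" and f: "continuous_on UNIV f" and sf: "square_bounded f K" and df: "diff_bounded f K"
    and c: "continuous_on UNIV c" and C: "\<And>x. (C has_vector_derivative c x) (at x)"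
    and eq: "\<And>x. 0 < x \<Longrightarrow> f x = f0 x + C x"
  shows "H1 f"
proof -
  obtain F0 K0 where F0: "continuous_on UNIV F0" "\<And>x. 0 < x \<Longrightarrow> F0 x = f0 x"
    "square_bounded F0 K0" "diff_bounded F0 K0"
    by (rule H1_extend[OF f0]) (rule that)
  have contC: "continuous_on UNIV C"
    using C by (auto intro!: continuous_at_imp_continuous_on has_vector_derivative_continuous)
  have "f x = F0 x + C x" if "0 \<le> x" for x
  proof -
    have "continuous_on UNIV (\<lambda>x. f x - F0 x - C x)"
      by (intro continuous_intros f F0 contC)
    then have "((\<lambda>x. f x - F0 x - C x) \<longlongrightarrow> f x - F0 x - C x) (at_right x)"
      by (auto simp: continuous_on_def intro: filterlim_mono[OF _ order_refl at_le])
    moreover have "\<forall>\<^sub>F y in at_right x. f y - F0 y - C y = 0"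
      using eventually_at_right_less[of x] by eventually_elim (use that eq F0 in auto)
    then have "((\<lambda>x. f x - F0 x - C x) \<longlongrightarrow> 0) (at_right x)"
      by (rule tendsto_eventually)
    ultimately have "f x - F0 x - C x = 0"
      by (rule tendsto_unique[rotated]) simp
    then show ?thesis by (simp only: diff_diff_eq right_minus_eq)
  qed
  then have CF: "C x = f x - F0 x" if "0 \<le> x" for x using that by simp
  have dC: "diff_bounded C (2 * K + 2 * K0)"
    unfolding diff_bounded_def
  proof safe
    fix h :: real assume h: "0 < h" "h \<le> 1"
    have "square_bounded (\<lambda>x. (f (x + h) - f x) + (F0 x - F0 (x + h))) (2 * (K * h^2) + 2 * (K0 * h^2))"
    proof (rule square_bounded_add)
      show "square_bounded (\<lambda>x. F0 x - F0 (x + h)) (K0 * h^2)"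
        using diff_boundedD[OF F0(4) h] by (simp add: square_bounded_def norm_minus_commute)
    qed (intro continuous_intros continuous_on_compose_UNIV[OF f] continuous_on_compose_UNIV[OF F0(1)]
          diff_boundedD[OF df h])+
    moreover have "integral {0..U} (\<lambda>x. (cmod (C (x + h) - C x))^2)
        = integral {0..U} (\<lambda>x. (cmod ((f (x + h) - f x) + (F0 x - F0 (x + h))))^2)" for U
      by (rule integral_cong) (use h in \<open>simp add: CF algebra_simps\<close>)
    ultimately show "square_bounded (\<lambda>x. C (x + h) - C x) ((2 * K + 2 * K0) * h^2)"
      by (simp add: square_bounded_def algebra_simps)
  qed
  have sc: "square_bounded c (2 * K + 2 * K0)"
    by (rule diff_quotient_limit[OF c C dC])
  obtain p where p2: "(\<lambda>x. (cmod (p x))^2) integrable_on {0..}" and pm: "p \<in> borel_measurable lebesgue"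
    and p: "\<And>a b. 0 < a \<Longrightarrow> a \<le> b \<Longrightarrow> (p has_integral (f0 b - f0 a)) {a..b}"
    by (rule H1_derivative[OF f0]) (rule that)
  have sq: "(\<lambda>x. (cmod (r x))^2) integrable_on {0<..}"
    if "continuous_on UNIV r" "square_bounded r L" for r L
  proof (rule has_integral_Ioi_bounded[of "\<lambda>x. (cmod (r x))^2" L])
    show "continuous_on {0..} (\<lambda>x. (cmod (r x))^2)"
      by (intro continuous_intros continuous_on_subset[OF that(1)]) simp
    show "integral {0..U} (\<lambda>x. (cmod (r x))^2) \<le> L" if "0 \<le> U" for U
      by (rule square_boundedD[OF \<open>square_bounded r L\<close> that])
  qed (auto intro: has_integral_integrable)
  have c_meas: "c \<in> borel_measurable lebesgue"
  proof (rule measurable_completion)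
    show "c \<in> borel_measurable lborel"
      using borel_measurable_continuous_onI[OF c] by simp
  qed
  show ?thesis
    unfolding H1_def
  proof (intro exI[of _ "\<lambda>x. p x + c x"] conjI allI impI)
    show "(\<lambda>x. (cmod (f x))^2) integrable_on {0<..}" by (rule sq[OF f sf])
    show "(\<lambda>x. (cmod (p x + c x))^2) integrable_on {0<..}"
    proof (rule measurable_bounded_by_integrable_imp_integrable)
      show "(\<lambda>x. (cmod (p x + c x))^2) \<in> borel_measurable (lebesgue_on {0<..})"
      proof (rule measurable_restrict_space1)
        note [measurable] = pm c_meas
        show "(\<lambda>x. (cmod (p x + c x))^2) \<in> borel_measurable lebesgue" by measurable
      qed
      show "(\<lambda>x. 2 * (cmod (p x))^2 + 2 * (cmod (c x))^2) integrable_on {0<..}"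
        using p2 sq[OF c sc] by (intro integrable_add integrable_on_mult_right)
          (auto simp: integrable_on_def has_integral_Ici_Ioi)
      show "norm ((cmod (p x + c x))^2) \<le> 2 * (cmod (p x))^2 + 2 * (cmod (c x))^2" for x
        using cmod_add_square_le by simp
    qed auto
    fix a b :: real assume ab: "0 < a" "a \<le> b"
    have "(c has_integral (C b - C a)) {a..b}"
      by (rule fundamental_theorem_of_calculus[OF ab(2)]) (use C in \<open>blast intro: has_vector_derivative_at_within\<close>)
    from has_integral_add[OF p[OF ab] this]
    show "((\<lambda>x. p x + c x) has_integral (f b - f a)) {a..b}"
      using eq[of a] eq[of b] ab by (simp add: algebra_simps)
  qed
qed

lemma integrable_scale_Ioi:
  fixes p :: "real \<Rightarrow> real"
  assumes "p integrable_on {0<..}" and nonneg: "\<And>x. 0 \<le> p x" and a: "0 < a"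
  shows "(\<lambda>x. p (a * x)) integrable_on {0<..}"
proof -
  have im: "(\<lambda>x. a * x) ` {0<..} = {0<..}"
  proof safe
    fix x :: real assume "0 < x"
    then show "x \<in> (\<lambda>x. a * x) ` {0<..}" using a by (intro image_eqI[of _ _ "x / a"]) auto
  qed (use a in auto)
  have "p absolutely_integrable_on (\<lambda>x. a * x) ` {0<..}"
    unfolding im using assms by (intro nonnegative_absolutely_integrable_1) auto
  then have "(\<lambda>x. \<bar>a\<bar> * p (a * x)) absolutely_integrable_on {0<..}"
    by (subst (asm) absolutely_integrable_change_of_variables_1'[where h="\<lambda>_. a"])
      (use a in \<open>auto intro!: derivative_eq_intros inj_onI\<close>)
  from integrable_on_mult_right[OF set_lebesgue_integral_eq_integral(1)[OF this], of "1 / a"] a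
  show ?thesis by simp
qed

lemma H1_scale:
  assumes "H1 f" "0 < a" shows "H1 (\<lambda>x. f (a * x))"
proof -
  from assms obtain q where f: "(\<lambda>x. (cmod (f x))^2) integrable_on {0<..}"
    and q2: "(\<lambda>x. (cmod (q x))^2) integrable_on {0<..}"
    and q: "\<And>a b. 0 < a \<Longrightarrow> a \<le> b \<Longrightarrow> (q has_integral (f b - f a)) {a..b}"
    unfolding H1_def by blast
  show ?thesis
    unfolding H1_def
  proof (intro exI[of _ "\<lambda>x. a *\<^sub>R q (a * x)"] conjI allI impI)
    show "(\<lambda>x. (cmod (f (a * x)))^2) integrable_on {0<..}"
      using integrable_scale_Ioi[OF f] assms by simp
    show "(\<lambda>x. (cmod (a *\<^sub>R q (a * x)))^2) integrable_on {0<..}"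
      using integrable_on_mult_right[OF integrable_scale_Ioi[OF q2 _ assms(2)], of "a^2"]
      by (simp add: power_mult_distrib)
    fix b c :: real assume bc: "0 < b" "b \<le> c"
    have "(\<lambda>x. x / a) ` {a * b..a * c} = {b..c}"
      using assms(2) bc image_divide_atLeastAtMost[of a "a * b" "a * c"] by simp
    then have "((\<lambda>x. q (a * x)) has_integral (1 / \<bar>a\<bar>) *\<^sub>R (f (a * c) - f (a * b))) {b..c}"
      using has_integral_stretch_real[OF q[of "a * b" "a * c"], of a] assms bc by simp
    from has_integral_cmul[OF this, of a]
    show "((\<lambda>x. a *\<^sub>R q (a * x)) has_integral f (a * c) - f (a * b)) {b..c}"
      using assms(2) by simp
  qed
qed

section \<open>Energy estimates\<close>

text \<open>Cauchy-Schwarz along a characteristic, on which the derivative of \<open>\<phi>\<close>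
  is \<open>- \<psi>\<close>.\<close>

lemma increment_phi:
  assumes sol: "csol \<phi> \<psi>" and W: "energy_potential \<phi> \<psi> W" and v: "v \<le> v'"
  shows "(cmod (\<phi> u v' - \<phi> u v))^2 \<le> (v' - v) * (W u v' - W u v)"
proof -
  have "((\<lambda>r. - \<psi> u r) has_integral (\<phi> u v' - \<phi> u v)) {v..v'}"
    by (rule fundamental_theorem_of_calculus[OF v])
      (auto intro: has_vector_derivative_at_within csolD(4)[OF sol])
  then have "(cmod (\<phi> u v' - \<phi> u v))^2 = (cmod (integral {v..v'} (\<lambda>r. - \<psi> u r)))^2"
    by (simp only: integral_unique)
  also have "\<dots> \<le> (v' - v) * integral {v..v'} (\<lambda>r. (cmod (- \<psi> u r))^2)"
    by (rule cauchy_schwarz_integral_length)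
      (auto intro!: v integrable_continuous_real continuous_intros csol_continuous[OF sol])
  also have "integral {v..v'} (\<lambda>r. (cmod (- \<psi> u r))^2) = W u v' - W u v"
    using integral_unique[OF energy_v[OF W v]] by simp
  finally show ?thesis .
qed

lemma increment_psi:
  assumes sol: "csol \<phi> \<psi>" and W: "energy_potential \<phi> \<psi> W" and u: "u \<le> u'"
  shows "(cmod (\<psi> u' v - \<psi> u v))^2 \<le> (u' - u) * (W u' v - W u v)"
  using increment_phi[OF csol_swap[OF sol] energy_swap[OF W] u] .

lemma energy_le:
  assumes W: "energy_potential \<phi> \<psi> W" and WM: "\<And>s. 0 \<le> s \<Longrightarrow> W s s \<le> M" and "0 \<le> u" "0 \<le> v"
  shows "W u v \<le> M"
  using energy_mono[OF W, of u "max u v" v "max u v"] WM[of "max u v"] assms(3) by linarith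

lemma energy_square_bounded:
  assumes W: "energy_potential \<phi> \<psi> W" and WM: "\<And>s. 0 \<le> s \<Longrightarrow> W s s \<le> M"
  shows "0 \<le> v \<Longrightarrow> square_bounded (\<lambda>u. \<phi> u v) M" "0 \<le> u \<Longrightarrow> square_bounded (\<lambda>v. \<psi> u v) M"
  unfolding square_bounded_def
  using integral_unique[OF energy_u[OF W]] integral_unique[OF energy_v[OF W]]
    energy_le[OF W WM] energy_nonneg[OF W]
  by (auto simp: diff_le_eq add_increasing2)

lemma diagonal_energy_bound:
  assumes sol: "csol \<phi> \<psi>" and W: "energy_potential \<phi> \<psi> W"
    and A: "square_bounded (\<lambda>s. \<phi> s s) A" and B: "square_bounded (\<lambda>s. \<psi> s s) B" and s: "0 \<le> s"
  shows "W s s \<le> A + B"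
proof -
  have "W s s = integral {0..s} (\<lambda>s. (cmod (\<phi> s s))^2 + (cmod (\<psi> s s))^2)"
    using integral_unique[OF energy_diag[OF W s]] energy_0[OF W] by simp
  also have "\<dots> = integral {0..s} (\<lambda>s. (cmod (\<phi> s s))^2) + integral {0..s} (\<lambda>s. (cmod (\<psi> s s))^2)"
    by (rule integral_add) (auto intro!: integrable_continuous_real continuous_intros csol_continuous[OF sol])
  also have "\<dots> \<le> A + B"
    using square_boundedD[OF A s] square_boundedD[OF B s] by simp
  finally show ?thesis .
qed

lemma energy_increment_integral:
  assumes W: "energy_potential \<phi> \<psi> W" and WM: "\<And>s. 0 \<le> s \<Longrightarrow> W s s \<le> M" and "0 < h" "0 \<le> U"
  shows "integral {0..U} (\<lambda>s. h * (W (s + h) (s + h) - W s s)) \<le> M * h^2"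
proof -
  have "integral {0..U} (\<lambda>s. W (s + h) (s + h) - W s s) \<le> h * M"
    by (rule integral_increment_bound)
      (use assms energy_continuous(3)[OF W] energy_nonneg[OF W] in auto)
  then have "h * integral {0..U} (\<lambda>s. W (s + h) (s + h) - W s s) \<le> h * (h * M)"
    using assms by (intro mult_left_mono) auto
  then show ?thesis by (simp add: power2_eq_square mult.commute mult.left_commute)
qed

text \<open>Translating a solution by \<open>h\<close> in \<open>u\<close> moves the diagonal point
  \<open>(s, s)\<close> to \<open>(s + h, s)\<close>. The step from a diagonal point along one
  characteristic has a square of at most \<open>h\<close> times the energy between two diagonal
  points, by monotonicity of \<open>W\<close>; integrating over \<open>s\<close> gives the second
  factor \<open>h\<close>.\<close>

lemma near_diagonal:
  assumes sol: "csol \<phi> \<psi>" and W: "energy_potential \<phi> \<psi> W" and WM: "\<And>s. 0 \<le> s \<Longrightarrow> W s s \<le> M"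
    and h: "0 < h"
  shows "square_bounded (\<lambda>s. \<psi> (s + h) s - \<psi> s s) (M * h^2)"
    and "square_bounded (\<lambda>s. \<phi> (s + h) s - \<phi> (s + h) (s + h)) (M * h^2)"
proof -
  note cont = csol_continuous[OF sol]
  have "continuous_on A (\<lambda>s. s + h)" for A by (intro continuous_intros)
  note contW = continuous_on_compose_UNIV[OF energy_continuous(3)[OF W] this] energy_continuous(3)[OF W]
  have bound: "square_bounded f (M * h^2)"
    if f: "continuous_on UNIV f" and le: "\<And>s. 0 \<le> s \<Longrightarrow> (cmod (f s))^2 \<le> h * (W (s + h) (s + h) - W s s)" for f
    unfolding square_bounded_def
  proof safe
    fix U :: real assume U: "0 \<le> U"
    have "integral {0..U} (\<lambda>s. (cmod (f s))^2) \<le> integral {0..U} (\<lambda>s. h * (W (s + h) (s + h) - W s s))"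
      by (rule integral_le)
        (auto intro!: integrable_continuous_real continuous_intros contW continuous_on_subset[OF f] le)
    also have "\<dots> \<le> M * h^2"
      by (rule energy_increment_integral[OF W WM h U])
    finally show "integral {0..U} (\<lambda>s. (cmod (f s))^2) \<le> M * h^2" .
  qed
  show "square_bounded (\<lambda>s. \<psi> (s + h) s - \<psi> s s) (M * h^2)"
  proof (rule bound)
    fix s :: real assume "0 \<le> s"
    have "(cmod (\<psi> (s + h) s - \<psi> s s))^2 \<le> h * (W (s + h) s - W s s)"
      using increment_psi[OF sol W, of s "s + h" s] h by simp
    also have "\<dots> \<le> h * (W (s + h) (s + h) - W s s)"
      using energy_mono[OF W, of "s + h" "s + h" s "s + h"] h by (intro mult_left_mono) auto
    finally show "(cmod (\<psi> (s + h) s - \<psi> s s))^2 \<le> h * (W (s + h) (s + h) - W s s)" .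
  qed (intro continuous_intros cont)
  show "square_bounded (\<lambda>s. \<phi> (s + h) s - \<phi> (s + h) (s + h)) (M * h^2)"
  proof (rule bound)
    fix s :: real assume "0 \<le> s"
    have "(cmod (\<phi> (s + h) s - \<phi> (s + h) (s + h)))^2 \<le> h * (W (s + h) (s + h) - W (s + h) s)"
      using increment_phi[OF sol W, of s "s + h" "s + h"] h by (simp add: norm_minus_commute)
    also have "\<dots> \<le> h * (W (s + h) (s + h) - W s s)"
      using energy_mono[OF W, of s "s + h" s s] h by (intro mult_left_mono) auto
    finally show "(cmod (\<phi> (s + h) s - \<phi> (s + h) (s + h)))^2 \<le> h * (W (s + h) (s + h) - W s s)" .
  qed (intro continuous_intros cont)
qed

lemma shifted_diagonal:
  assumes sol: "csol \<phi> \<psi>" and W: "energy_potential \<phi> \<psi> W" and WM: "\<And>s. 0 \<le> s \<Longrightarrow> W s s \<le> M"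
    and L: "diff_bounded (\<lambda>s. \<phi> s s) L" and h: "0 < h" "h \<le> 1"
  shows "square_bounded (\<lambda>s. \<phi> (s + h) s - \<phi> s s) ((2 * L + 2 * M) * h^2)"
proof -
  have "square_bounded (\<lambda>s. (\<phi> (s + h) (s + h) - \<phi> s s) + (\<phi> (s + h) s - \<phi> (s + h) (s + h)))
     (2 * (L * h^2) + 2 * (M * h^2))"
    by (rule square_bounded_add[OF _ _ diff_boundedD[OF L h] near_diagonal(2)[OF sol W WM h(1)]])
      (intro continuous_intros csol_continuous[OF sol])+
  then show "square_bounded (\<lambda>s. \<phi> (s + h) s - \<phi> s s) ((2 * L + 2 * M) * h^2)"
    by (simp add: algebra_simps)
qed

text \<open>The difference of the translate in \<open>u\<close> and the solution is a solution. On
  the Cauchy line its two components contribute \<open>(2 * L + 2 * M) * h^2\<close> and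
  \<open>M * h^2\<close>. Only difference quotients of \<open>\<phi>\<close> enter, because
  \<open>\<psi>\<close> changes in the \<open>u\<close> direction by an integral of
  \<open>\<phi>\<close>.\<close>

lemma shifted_energy:
  assumes sol: "csol \<phi> \<psi>" and W: "energy_potential \<phi> \<psi> W" and WM: "\<And>s. 0 \<le> s \<Longrightarrow> W s s \<le> M"
    and L: "diff_bounded (\<lambda>s. \<phi> s s) L"
  shows "0 \<le> v \<Longrightarrow> diff_bounded (\<lambda>u. \<phi> u v) (2 * L + 3 * M)"
    and "0 < h \<Longrightarrow> h \<le> 1 \<Longrightarrow> 0 \<le> u \<Longrightarrow> square_bounded (\<lambda>v. \<psi> (u + h) v - \<psi> u v) ((2 * L + 3 * M) * h^2)"
proof -
  have *: "(0 \<le> v \<longrightarrow> square_bounded (\<lambda>u. \<phi> (u + h) v - \<phi> u v) ((2 * L + 3 * M) * h^2)) \<and>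
     (0 \<le> u \<longrightarrow> square_bounded (\<lambda>v. \<psi> (u + h) v - \<psi> u v) ((2 * L + 3 * M) * h^2))"
    if h: "0 < h" "h \<le> 1" for h u v
  proof -
    have sol': "csol (\<lambda>u v. \<phi> (u + h) v - \<phi> u v) (\<lambda>u v. \<psi> (u + h) v - \<psi> u v)"
      by (rule csol_diff[OF csol_shift[OF sol] sol])
    obtain W' where W': "energy_potential (\<lambda>u v. \<phi> (u + h) v - \<phi> u v) (\<lambda>u v. \<psi> (u + h) v - \<psi> u v) W'"
      by (rule energy_potential_exists[OF sol'])
    have "W' s s \<le> (2 * L + 3 * M) * h^2" if "0 \<le> s" for s
      using diagonal_energy_bound[OF sol' W' shifted_diagonal[OF sol W WM L h] near_diagonal(1)[OF sol W WM h(1)] that] by (simp add: algebra_simps)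
    from energy_square_bounded[OF W' this] show ?thesis by blast
  qed
  show "0 \<le> v \<Longrightarrow> diff_bounded (\<lambda>u. \<phi> u v) (2 * L + 3 * M)"
    using * by (simp add: diff_bounded_def)
  show "0 < h \<Longrightarrow> h \<le> 1 \<Longrightarrow> 0 \<le> u \<Longrightarrow> square_bounded (\<lambda>v. \<psi> (u + h) v - \<psi> u v) ((2 * L + 3 * M) * h^2)"
    using * by blast
qed

text \<open>The energy controls \<open>\<psi>\<close> along lines of constant \<open>u\<close>; here
  it is needed along lines of constant \<open>v\<close>. There \<open>\<psi>\<close> is minus the
  \<open>v\<close>-derivative of \<open>\<phi>\<close>, and the reflected
  \<open>shifted_energy\<close> bounds the \<open>v\<close>-differences of \<open>\<phi>\<close>
  along such lines.\<close>

lemma square_bounded_psi_u: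
  assumes sol: "csol \<phi> \<psi>" and W: "energy_potential \<phi> \<psi> W" and WM: "\<And>s. 0 \<le> s \<Longrightarrow> W s s \<le> M"
    and L: "diff_bounded (\<lambda>s. \<psi> s s) L" and v: "0 \<le> v"
  shows "square_bounded (\<lambda>u. \<psi> u v) (2 * L + 3 * M)"
  unfolding square_bounded_def
proof safe
  fix U :: real assume U: "0 \<le> U"
  define B where "B h u = average (\<psi> u) h v" for h u
  have cont\<psi>: "continuous_on UNIV (\<psi> u)" for u
    by (intro csol_continuous[OF sol] continuous_intros)
  have "continuous_on (UNIV \<times> cbox 0 1) (\<lambda>(p, r). \<psi> (snd p) (v + r * fst p))"
    unfolding split_beta by (intro csol_continuous[OF sol] continuous_intros)
  from integral_continuous_on_param[OF this] have "continuous_on UNIV (\<lambda>(h, u). B h u)"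
    by (simp add: B_def average_def split_beta)
  then have "integral {0..U} (\<lambda>u. (cmod (B 0 u))^2) \<le> 2 * L + 3 * M"
  proof (rule square_integral_le_at_0)
    fix h :: real assume h: "0 < h" "h < 1"
    have "h *\<^sub>R B h u = \<phi> u v - \<phi> u (v + h)" for u
      unfolding B_def scaleR_average[OF cont\<psi>]
      using sint_antiderivative[of "\<lambda>v. - \<phi> u v" "\<psi> u" v "v + h"]
        has_vector_derivative_minus[OF csolD(4)[OF sol]] by simp
    then have "(cmod (h *\<^sub>R B h u))^2 = (cmod (\<phi> u (v + h) - \<phi> u v))^2" for u
      by (simp add: norm_minus_commute del: norm_scaleR)
    then show "integral {0..U} (\<lambda>x. (cmod (h *\<^sub>R B h x))^2) \<le> (2 * L + 3 * M) * h^2"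
      using square_boundedD[OF shifted_energy(2)[OF csol_swap[OF sol] energy_swap[OF W] WM L, of h v] U] h v
      by simp
  qed
  then show "integral {0..U} (\<lambda>u. (cmod (\<psi> u v))^2) \<le> 2 * L + 3 * M" by (simp add: B_def)
qed

text \<open>The flux through the segment \<open>{u} \<times> [0, V]\<close> converges as \<open>u\<close> tends to infinity, and it is integrable
  in \<open>u\<close>, so that its limit is \<open>0\<close>.\<close>

lemma energy_flux_tendsto_0:
  assumes sol: "csol \<phi> \<psi>" and W: "energy_potential \<phi> \<psi> W" and WM: "\<And>s. 0 \<le> s \<Longrightarrow> W s s \<le> M"
    and L: "diff_bounded (\<lambda>s. \<psi> s s) L" and V: "0 \<le> V"
  shows "((\<lambda>u. W u V - W u 0) \<longlongrightarrow> 0) at_top"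
proof -
  have "\<exists>l. ((\<lambda>u. W u v) \<longlongrightarrow> l) at_top" if v: "0 \<le> v" for v
  proof (rule tendsto_mono_bounded_at_top)
    show "W x v \<le> W y v" if "x \<le> y" for x y by (rule energy_mono[OF W that order_refl])
    show "W x v \<le> M" if "0 \<le> x" for x by (rule energy_le[OF W WM that v])
  qed blast
  then obtain l1 l2 where "((\<lambda>u. W u V) \<longlongrightarrow> l1) at_top" "((\<lambda>u. W u 0) \<longlongrightarrow> l2) at_top"
    using V by (meson order_refl)
  then have l: "((\<lambda>u. W u V - W u 0) \<longlongrightarrow> l1 - l2) at_top"
    by (intro tendsto_diff)
  define w where "w u = W u V - W u 0" for u
  have w0: "0 \<le> w u" for u
    unfolding w_def using energy_mono[OF W order_refl V] by simp
  have contw: "continuous_on A w" for A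
    unfolding w_def by (intro continuous_intros energy_continuous(1)[OF W])
  have wV: "integral {0..U} w \<le> V * (2 * L + 3 * M)" if U: "0 \<le> U" for U
  proof -
    \<comment> \<open>Exchanging the order of integration replaces the flux by integrals along lines
      of constant \<open>v\<close>, which are bounded independently of \<open>U\<close>.\<close>
    have "integral {0..U} w = integral (cbox 0 U) (\<lambda>u. integral (cbox 0 V) (\<lambda>v. (cmod (\<psi> u v))^2))"
      unfolding w_def using integral_unique[OF energy_v[OF W V]] by simp
    also have "\<dots> = integral (cbox 0 V) (\<lambda>v. integral (cbox 0 U) (\<lambda>u. (cmod (\<psi> u v))^2))"
      by (rule integral_swap_continuous)
        (auto simp: split_beta intro!: continuous_intros csol_continuous[OF sol])
    also have "\<dots> \<le> integral (cbox 0 V) (\<lambda>v. 2 * L + 3 * M)"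
    proof (rule integral_le)
      have "continuous_on (UNIV \<times> cbox 0 U) (\<lambda>(v, u). (cmod (\<psi> u v))^2)"
        unfolding split_beta by (intro continuous_intros csol_continuous[OF sol])
      from continuous_on_subset[OF integral_continuous_on_param[OF this] subset_UNIV]
      show "(\<lambda>v. integral (cbox 0 U) (\<lambda>u. (cmod (\<psi> u v))^2)) integrable_on cbox 0 V"
        by (rule integrable_continuous)
    qed (use square_boundedD[OF square_bounded_psi_u[OF sol W WM L]] U in auto)
    also have "\<dots> = V * (2 * L + 3 * M)" using V by simp
    finally show ?thesis .
  qed
  have "l1 - l2 = 0"
  proof (rule ccontr)
    assume "l1 - l2 \<noteq> 0"
    moreover have "0 \<le> l1 - l2"
      by (rule tendsto_lowerbound[OF l]) (use w0 in \<open>auto simp: w_def\<close>)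
    ultimately have pos: "0 < (l1 - l2) / 2" by simp
    then have "\<forall>\<^sub>F u in at_top. (l1 - l2) / 2 < w u"
      unfolding w_def by (intro order_tendstoD(1)[OF l]) simp
    then obtain U0 where U0: "\<And>u. U0 \<le> u \<Longrightarrow> (l1 - l2) / 2 < w u"
      by (auto simp: eventually_at_top_linorder)
    \<comment> \<open>The interval is so long that a flux above half of its limit would integrate
      over it to more than the bound by 1.\<close>
    define a b where "a = max 0 U0" and "b = a + (V * (2 * L + 3 * M) + 1) / ((l1 - l2) / 2)"
    have nn: "0 \<le> V * (2 * L + 3 * M)" using wV[of 0] by simp
    then have ab: "0 \<le> a" "a \<le> b" using pos by (auto simp: a_def b_def)
    have "(b - a) * ((l1 - l2) / 2) = integral {a..b} (\<lambda>_. (l1 - l2) / 2)"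
      using ab by simp
    also have "\<dots> \<le> integral {a..b} w"
      by (rule integral_le) (use U0 in \<open>auto intro!: integrable_continuous_real contw less_imp_le simp: a_def\<close>)
    also have "\<dots> \<le> integral {0..b} w"
      by (rule integral_subset_le) (use ab w0 in \<open>auto intro!: integrable_continuous_real contw\<close>)
    also have "\<dots> \<le> V * (2 * L + 3 * M)"
      using wV[of b] ab by simp
    finally show False using pos by (simp add: b_def)
  qed
  with l show ?thesis by simp
qed

text \<open>One inequality is monotonicity of \<open>W\<close>. For the other, \<open>W V V\<close>
  with fixed \<open>V\<close> is at most \<open>W u V\<close>, which differs from
  \<open>W u 0\<close> by a flux that vanishes as \<open>u\<close> grows.\<close>

lemma energy_limits:
  assumes sol: "csol \<phi> \<psi>" and W: "energy_potential \<phi> \<psi> W" and WM: "\<And>s. 0 \<le> s \<Longrightarrow> W s s \<le> M"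
    and L: "diff_bounded (\<lambda>s. \<psi> s s) L" and lim: "((\<lambda>s. W s s) \<longlongrightarrow> E) at_top"
  shows "((\<lambda>u. W u 0) \<longlongrightarrow> E) at_top"
proof -
  obtain l where l: "((\<lambda>u. W u 0) \<longlongrightarrow> l) at_top"
  proof (rule tendsto_mono_bounded_at_top)
    show "W x 0 \<le> W y 0" if "x \<le> y" for x y by (rule energy_mono[OF W that order_refl])
    show "W x 0 \<le> M" if "0 \<le> x" for x by (rule energy_le[OF W WM that order_refl])
  qed blast
  have "l \<le> E"
  proof (rule tendsto_le[OF _ lim l])
    show "\<forall>\<^sub>F u in at_top. W u 0 \<le> W u u"
      using eventually_ge_at_top[of 0] by eventually_elim (rule energy_mono[OF W order_refl])
  qed simp
  moreover have "E \<le> l"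
  proof (rule tendsto_upperbound[OF lim])
    have "W V V \<le> l" if V: "0 \<le> V" for V
    proof (rule tendsto_lowerbound)
      show "((\<lambda>u. (W u V - W u 0) + W u 0) \<longlongrightarrow> l) at_top"
        using tendsto_add[OF energy_flux_tendsto_0[OF sol W WM L V] l] by simp
      show "\<forall>\<^sub>F u in at_top. W V V \<le> (W u V - W u 0) + W u 0"
        using eventually_ge_at_top[of V] by eventually_elim (simp add: energy_mono[OF W])
    qed simp
    then show "\<forall>\<^sub>F V in at_top. W V V \<le> l"
      using eventually_ge_at_top[of 0] by (rule eventually_mono[rotated])
  qed simp
  ultimately show ?thesis using l by simp
qed

section \<open>The transform of the boundary values\<close>

text \<open>The remainder has no \<open>\<phi>\<close> on \<open>v = 0\<close> and equals
  \<open>\<psi>\<close> on \<open>u = R\<close>. Since it gains no energy along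
  \<open>v = 0\<close>, its flux through \<open>{u} \<times> [0, V]\<close> is at most that through
  \<open>{R} \<times> [0, V]\<close>, which is the flux of the solution itself. The second bound
  integrates from \<open>v = 0\<close>, where the remainder of \<open>\<phi>\<close>
  vanishes.\<close>

lemma charsol_error:
  assumes sol: "csol \<phi> \<psi>" and W: "energy_potential \<phi> \<psi> W" and V: "0 \<le> V" and u: "u \<le> R"
  shows "integral {0..V} (\<lambda>v. (cmod (\<psi> u v - charsol_psi (\<lambda>u. \<phi> u 0) R u v))^2) \<le> W R V - W R 0"
    and "(cmod (\<phi> u V - charsol_phi (\<lambda>u. \<phi> u 0) R u V))^2 \<le> V * (W R V - W R 0)"
proof -
  let ?g = "\<lambda>u. \<phi> u 0"
  let ?a = "\<lambda>u v. \<phi> u v - charsol_phi ?g R u v" and ?b = "\<lambda>u v. \<psi> u v - charsol_psi ?g R u v"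
  have sol': "csol ?a ?b"
    by (intro csol_diff sol csol_charsol csol_continuous[OF sol] continuous_intros)
  obtain W' where W': "energy_potential ?a ?b W'"
    by (rule energy_potential_exists[OF sol'])
  have "W' u V - W' u 0 \<le> W' R V - W' R 0"
    using integral_unique[OF energy_u[OF W' u, of 0]] energy_mono[OF W' u, of V V] by simp
  also have "\<dots> = W R V - W R 0"
    using integral_unique[OF energy_v[OF W' V, of R]] integral_unique[OF energy_v[OF W V, of R]] by simp
  finally have le: "W' u V - W' u 0 \<le> W R V - W R 0" .
  then show "integral {0..V} (\<lambda>v. (cmod (?b u v))^2) \<le> W R V - W R 0"
    using integral_unique[OF energy_v[OF W' V, of u]] by simp
  have "(cmod (?a u V - ?a u 0))^2 \<le> (V - 0) * (W' u V - W' u 0)"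
    by (rule increment_phi[OF sol' W' V])
  also have "\<dots> \<le> V * (W R V - W R 0)"
    using mult_left_mono[OF le V] by simp
  finally show "(cmod (?a u V))^2 \<le> V * (W R V - W R 0)" by simp
qed

lemma tendsto_of_cmod_square_le:
  fixes f :: "real \<Rightarrow> complex"
  assumes e: "(e \<longlongrightarrow> 0) F" and le: "\<forall>\<^sub>F x in F. (cmod (l - f x))^2 \<le> e x"
  shows "(f \<longlongrightarrow> l) F"
proof -
  have "((\<lambda>x. (cmod (l - f x))^2) \<longlongrightarrow> 0) F"
    by (rule tendsto_sandwich[OF _ le tendsto_const e]) simp
  then have "((\<lambda>x. cmod (l - f x)) \<longlongrightarrow> 0) F" by simp
  then have "((\<lambda>x. l - f x) \<longlongrightarrow> 0) F" by (rule tendsto_norm_zero_cancel)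
  from tendsto_diff[OF tendsto_const[of l] this] show ?thesis by simp
qed

lemma charsol_phi_tendsto:
  assumes sol: "csol \<phi> \<psi>" and W: "energy_potential \<phi> \<psi> W" and WM: "\<And>s. 0 \<le> s \<Longrightarrow> W s s \<le> M"
    and L: "diff_bounded (\<lambda>s. \<psi> s s) L" and V: "0 \<le> V"
  shows "((\<lambda>R. charsol_phi (\<lambda>u. \<phi> u 0) R u V) \<longlongrightarrow> \<phi> u V) at_top"
proof (rule tendsto_of_cmod_square_le)
  show "((\<lambda>R. V * (W R V - W R 0)) \<longlongrightarrow> 0) at_top"
    using tendsto_mult_left[OF energy_flux_tendsto_0[OF sol W WM L V], of V] by simp
  show "\<forall>\<^sub>F R in at_top. (cmod (\<phi> u V - charsol_phi (\<lambda>u. \<phi> u 0) R u V))^2 \<le> V * (W R V - W R 0)"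
    using eventually_ge_at_top[of u] by eventually_elim (rule charsol_error(2)[OF sol W V])
qed

text \<open>An elementary Sobolev estimate: \<open>\<psi> R 0\<close> is compared with the values on
  \<open>[R, R + 1]\<close>, where \<open>\<psi>\<close> and its derivative \<open>- \<phi>\<close>
  have bounded square integrals.\<close>

lemma psi_boundary_bounded:
  assumes sol: "csol \<phi> \<psi>" and W: "energy_potential \<phi> \<psi> W" and WM: "\<And>s. 0 \<le> s \<Longrightarrow> W s s \<le> M"
    and L: "diff_bounded (\<lambda>s. \<psi> s s) L" and R: "0 \<le> R"
  shows "(cmod (\<psi> R 0))^2 \<le> 2 * (2 * L + 3 * M) + 2 * M"
proof -
  note cont = csol_continuous[OF sol]
  have int: "(\<lambda>s. (cmod (\<psi> s 0))^2) integrable_on {a..b}" for a b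
    by (intro integrable_continuous_real continuous_intros cont)
  have M: "0 \<le> M" using WM[of 0] energy_0[OF W] by simp
  have "(cmod (\<psi> R 0))^2 = integral {R..R+1} (\<lambda>_. (cmod (\<psi> R 0))^2)" by simp
  also have "\<dots> \<le> integral {R..R+1} (\<lambda>s. 2 * (cmod (\<psi> s 0))^2 + 2 * M)"
  proof (rule integral_le)
    fix s assume s: "s \<in> {R..R+1}"
    have "(cmod (\<psi> s 0 - \<psi> R 0))^2 \<le> (s - R) * (W s 0 - W R 0)"
      using increment_psi[OF sol W, of R s 0] s by simp
    also have "\<dots> \<le> 1 * (M - 0)"
      using s R energy_le[OF W WM, of s 0] energy_nonneg[OF W R order_refl] energy_mono[OF W, of R s 0 0]
      by (intro mult_mono) auto
    finally have "(cmod (\<psi> R 0 - \<psi> s 0))^2 \<le> M" by (simp add: norm_minus_commute)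
    then show "(cmod (\<psi> R 0))^2 \<le> 2 * (cmod (\<psi> s 0))^2 + 2 * M"
      using cmod_add_square_le[of "\<psi> s 0" "\<psi> R 0 - \<psi> s 0"] by simp
  qed (auto intro!: integrable_add integrable_on_mult_right int)
  also have "\<dots> = 2 * integral {R..R+1} (\<lambda>s. (cmod (\<psi> s 0))^2) + 2 * M"
    by (subst integral_add) (auto intro!: integrable_on_mult_right int)
  also have "integral {R..R+1} (\<lambda>s. (cmod (\<psi> s 0))^2) \<le> integral {0..R+1} (\<lambda>s. (cmod (\<psi> s 0))^2)"
    by (rule integral_subset_le) (use R int in auto)
  also have "\<dots> \<le> 2 * L + 3 * M"
    by (rule square_boundedD[OF square_bounded_psi_u[OF sol W WM L order_refl]]) (use R in auto)
  finally show ?thesis by simp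
qed

text \<open>The remainder at \<open>(u, V)\<close> is \<open>\<psi> R V\<close> minus an integral of
  \<open>\<psi> R\<close> against \<open>p'\<close>, and the mean square of \<open>p'\<close> grows
  with \<open>R\<close>, so small flux is not enough. Integration by parts moves the derivative to
  \<open>\<psi> R\<close>, whose difference quotients are bounded uniformly in \<open>R\<close>. The
  term at \<open>v = V\<close>, where \<open>p\<close> is 1, cancels \<open>\<psi> R V\<close>; the
  term at \<open>v = 0\<close> decays with \<open>E0\<close>, and the integral of \<open>p^2\<close>
  with \<open>EN\<close>.\<close>

lemma charsol_psi_tendsto:
  assumes sol: "csol \<phi> \<psi>" and W: "energy_potential \<phi> \<psi> W" and WM: "\<And>s. 0 \<le> s \<Longrightarrow> W s s \<le> M"
    and L: "diff_bounded (\<lambda>s. \<psi> s s) L" and V: "0 < V"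
  shows "((\<lambda>R. charsol_psi (\<lambda>u. \<phi> u 0) R u V) \<longlongrightarrow> \<psi> u V) at_top"
proof (rule tendsto_of_cmod_square_le)
  define N where "N = 2 * L + 3 * M"
  let ?e = "\<lambda>R. 2 * ((E0 ((R - u) * V))^2 * (2 * N + 2 * M)) + 2 * (V * EN ((R - u) * V) * N)"
  have lim: "filterlim (\<lambda>R. (R - u) * V) at_top at_top"
    by (intro filterlim_at_top_mult_tendsto_pos[OF tendsto_const V]
        filterlim_tendsto_add_at_top[OF tendsto_const[of "- u"] filterlim_ident, simplified])
  from filterlim_compose[OF E0_tendsto_0 this] filterlim_compose[OF EN_tendsto_0 this]
  have "((\<lambda>R. E0 ((R - u) * V)) \<longlongrightarrow> 0) at_top" "((\<lambda>R. EN ((R - u) * V)) \<longlongrightarrow> 0) at_top" .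
  then show "(?e \<longlongrightarrow> 0) at_top"
    by (auto intro!: tendsto_eq_intros)
  show "\<forall>\<^sub>F R in at_top. (cmod (\<psi> u V - charsol_psi (\<lambda>u. \<phi> u 0) R u V))^2 \<le> ?e R"
    using eventually_ge_at_top[of 0]
  proof eventually_elim
    case (elim R)
    let ?g = "\<lambda>u. \<phi> u 0"
    let ?a = "\<lambda>u v. \<phi> u v - charsol_phi ?g R u v" and ?b = "\<lambda>u v. \<psi> u v - charsol_psi ?g R u v"
    have sol': "csol ?a ?b"
      by (intro csol_diff sol csol_charsol csol_continuous[OF sol] continuous_intros)
    define p where "p v = E0 ((R - u) * (V - v))" for v
    define p' where "p' v = (R - u) * E1 ((R - u) * (V - v))" for v
    have p: "(p has_real_derivative p' v) (at v)" for v
    proof -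
      have "(p has_real_derivative - E1 ((R - u) * (V - v)) * (- (R - u))) (at v)"
        unfolding p_def
        by (rule DERIV_chain'[where g=E0, OF _ DERIV_E0]) (auto intro!: derivative_eq_intros)
      then show ?thesis by (rule DERIV_cong) (simp add: p'_def algebra_simps)
    qed
    have bnd: "diff_bounded (\<lambda>v. \<psi> R v) N"
      unfolding N_def
      using shifted_energy(1)[OF csol_swap[OF sol] energy_swap[OF W] WM L elim] .
    have "?b u V = ?b R V - sint 0 V (\<lambda>v. of_real (p' v) * ?b R v)"
      unfolding p'_def by (rule csol_characteristic_formula[OF sol']) simp
    also have "\<dots> = p V *\<^sub>R \<psi> R V - integral {0..V} (\<lambda>v. p' v *\<^sub>R \<psi> R v)"
      using V by (simp add: sint_le p_def scaleR_conv_of_real)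
    finally have b: "?b u V = p 0 *\<^sub>R \<psi> R 0 + (p V *\<^sub>R \<psi> R V - p 0 *\<^sub>R \<psi> R 0 - integral {0..V} (\<lambda>v. p' v *\<^sub>R \<psi> R v))"
      by simp
    have "(cmod (p V *\<^sub>R \<psi> R V - p 0 *\<^sub>R \<psi> R 0 - integral {0..V} (\<lambda>v. p' v *\<^sub>R \<psi> R v)))^2
        \<le> integral {0..V} (\<lambda>v. (p v)^2) * N"
      by (rule parts_bound[OF _ bnd p])
        (use V in \<open>auto simp: p'_def intro!: continuous_intros csol_continuous[OF sol]\<close>)
    also have "integral {0..V} (\<lambda>v. (p v)^2) = V * EN ((R - u) * V)"
      unfolding p_def by (rule integral_unique[OF E0_square_has_integral]) (use V in simp)
    finally have 1: "(cmod (p V *\<^sub>R \<psi> R V - p 0 *\<^sub>R \<psi> R 0 - integral {0..V} (\<lambda>v. p' v *\<^sub>R \<psi> R v)))^2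
        \<le> V * EN ((R - u) * V) * N" .
    have "(cmod (p 0 *\<^sub>R \<psi> R 0))^2 = (E0 ((R - u) * V))^2 * (cmod (\<psi> R 0))^2"
      by (simp add: p_def power_mult_distrib)
    also have "\<dots> \<le> (E0 ((R - u) * V))^2 * (2 * N + 2 * M)"
      using psi_boundary_bounded[OF sol W WM L elim] unfolding N_def by (intro mult_left_mono) auto
    finally have 2: "(cmod (p 0 *\<^sub>R \<psi> R 0))^2 \<le> (E0 ((R - u) * V))^2 * (2 * N + 2 * M)" .
    show ?case
      unfolding b by (rule order_trans[OF cmod_add_square_le]) (use 1 2 in linarith)
  qed
qed

lemma J0_integral:
  assumes g: "continuous_on UNIV g" and eq: "\<And>u. 0 < u \<Longrightarrow> g u = g' u" and v: "0 \<le> v" and R: "0 \<le> R"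
  shows "((\<lambda>u. complex_of_real (J0 (2 * sqrt (u * v))) * g' u) has_integral charsol_psi g R 0 v) {0..R}"
proof -
  have "((\<lambda>s. E0 (v * (s - 0)) *\<^sub>R g s) has_integral charsol_psi g R 0 v) {0..R}"
    unfolding charsol_psi_def sint_le[OF R]
    by (intro integrable_integral integrable_continuous_real continuous_intros continuous_on_subset[OF g]) auto
  then show ?thesis
  proof (rule has_integral_spike[OF negligible_sing[of 0], rotated])
    fix u assume "u \<in> {0..R} - {0}"
    then have "0 < u" by auto
    then show "complex_of_real (J0 (2 * sqrt (u * v))) * g' u = E0 (v * (u - 0)) *\<^sub>R g u"
      using v eq by (simp add: J0_eq_E0 power_mult_distrib scaleR_conv_of_real mult.commute)
  qed
qed

lemma continuous_charsol_psi:
  assumes g: "continuous_on UNIV g" shows "continuous_on A (\<lambda>v. charsol_psi g R u v)"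
  by (intro csol_continuous[OF csol_charsol[OF g]] continuous_intros)

text \<open>Bounds on \<open>[0, V]\<close> that are uniform in \<open>V\<close> stand for the
  square integral over the half line. \<open>H_transf_toD\<close> is the converse. Passing from
  \<open>\<le>\<close> to the strict inequality of the definition costs the factor 2 in
  \<open>e / 2\<close>.\<close>

lemma H_transf_toI:
  assumes g: "continuous_on UNIV g" "\<And>u. 0 < u \<Longrightarrow> g u = g' u"
    and k: "continuous_on UNIV k" "\<And>v. 0 < v \<Longrightarrow> k v = k' v"
    and lim: "\<And>e. 0 < e \<Longrightarrow> \<exists>R0. \<forall>R\<ge>R0. \<forall>V\<ge>0. integral {0..V} (\<lambda>v. (cmod (k v - charsol_psi g R 0 v))^2) \<le> e"
  shows "H_transf_to g' k'"
  unfolding H_transf_to_def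
proof (intro conjI allI impI)
  show "(\<lambda>u. complex_of_real (J0 (2 * sqrt (u * v))) * g' u) integrable_on {0..R}" if "0 < R" "0 < v" for R v
    using has_integral_integrable[OF J0_integral[OF g, of v R]] that by simp
  fix e :: real assume e: "0 < e"
  obtain R0 where R0: "\<And>R V. R0 \<le> R \<Longrightarrow> 0 \<le> V \<Longrightarrow> integral {0..V} (\<lambda>v. (cmod (k v - charsol_psi g R 0 v))^2) \<le> e / 2"
    using lim[of "e / 2"] e by auto
  show "\<exists>R0. \<forall>R\<ge>R0.
        (\<lambda>v. (cmod (k' v - integral {0..R} (\<lambda>u. complex_of_real (J0 (2 * sqrt (u * v))) * g' u)))^2)
           integrable_on {0<..}
      \<and> integral {0<..} (\<lambda>v. (cmod (k' v - integral {0..R} (\<lambda>u. complex_of_real (J0 (2 * sqrt (u * v))) * g' u)))^2) < e"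
  proof (intro exI[of _ "max R0 0"] allI impI)
    fix R assume R: "max R0 0 \<le> R"
    obtain L where L: "((\<lambda>v. (cmod (k v - charsol_psi g R 0 v))^2) has_integral L) {0<..}" "L \<le> e / 2"
    proof (rule has_integral_Ioi_bounded[where K = "e / 2"])
      show "integral {0..V} (\<lambda>v. (cmod (k v - charsol_psi g R 0 v))^2) \<le> e / 2" if "0 \<le> V" for V
        using R0 R that by simp
      show "continuous_on {0..} (\<lambda>v. (cmod (k v - charsol_psi g R 0 v))^2)"
        by (intro continuous_intros continuous_charsol_psi g(1) continuous_on_subset[OF k(1)]) auto
    qed simp_all
    have "((\<lambda>v. (cmod (k' v - integral {0..R} (\<lambda>u. complex_of_real (J0 (2 * sqrt (u * v))) * g' u)))^2) has_integral L) {0<..}"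
      using L(1)
    proof (rule has_integral_eq[rotated])
      fix v :: real assume "v \<in> {0<..}"
      then show "(cmod (k v - charsol_psi g R 0 v))^2 =
          (cmod (k' v - integral {0..R} (\<lambda>u. complex_of_real (J0 (2 * sqrt (u * v))) * g' u)))^2"
        using integral_unique[OF J0_integral[OF g, of v R]] k(2) R by simp
    qed
    then show "(\<lambda>v. (cmod (k' v - integral {0..R} (\<lambda>u. complex_of_real (J0 (2 * sqrt (u * v))) * g' u)))^2)
           integrable_on {0<..}
      \<and> integral {0<..} (\<lambda>v. (cmod (k' v - integral {0..R} (\<lambda>u. complex_of_real (J0 (2 * sqrt (u * v))) * g' u)))^2) < e"
      using L(2) e by (auto simp: integral_unique)
  qed
qed

lemma H_transf_toD:
  assumes H: "H_transf_to g' k'"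
    and g: "continuous_on UNIV g" "\<And>u. 0 < u \<Longrightarrow> g u = g' u"
    and k: "continuous_on UNIV k" "\<And>v. 0 < v \<Longrightarrow> k v = k' v" and e: "0 < e"
  shows "\<exists>R0\<ge>0. \<forall>R\<ge>R0. \<forall>V\<ge>0. integral {0..V} (\<lambda>v. (cmod (k v - charsol_psi g R 0 v))^2) \<le> e"
proof -
  let ?t = "\<lambda>R v. (cmod (k' v - integral {0..R} (\<lambda>u. complex_of_real (J0 (2 * sqrt (u * v))) * g' u)))^2"
  from H e obtain R0 where R0: "\<And>R. R0 \<le> R \<Longrightarrow> ?t R integrable_on {0<..}" "\<And>R. R0 \<le> R \<Longrightarrow> integral {0<..} (?t R) < e"
    unfolding H_transf_to_def by blast
  show ?thesis
  proof (intro exI[of _ "max R0 0"] conjI allI impI)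
    fix R V :: real assume R: "max R0 0 \<le> R" and V: "0 \<le> V"
    let ?s = "\<lambda>v. (cmod (k v - charsol_psi g R 0 v))^2"
    have "(?t R has_integral integral {0<..} (?t R)) {0<..}"
      using R0(1)[of R] R by (simp add: integrable_integral)
    then have "(?s has_integral integral {0<..} (?t R)) {0<..}"
    proof (rule has_integral_eq[rotated])
      fix v :: real assume "v \<in> {0<..}"
      then show "?t R v = ?s v"
        using integral_unique[OF J0_integral[OF g, of v R]] k(2) R by simp
    qed
    then have s: "(?s has_integral integral {0<..} (?t R)) {0..}"
      by (simp add: has_integral_Ici_Ioi)
    have "integral {0..V} ?s \<le> integral {0..} ?s"
      by (rule integral_subset_le)
        (use s in \<open>auto intro: has_integral_integrable intro!: integrable_continuous_real continuous_intros
            continuous_charsol_psi g(1) continuous_on_subset[OF k(1)]\<close>)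
    also have "\<dots> = integral {0<..} (?t R)" using s by (rule integral_unique)
    finally show "integral {0..V} ?s \<le> e" using R0(2)[of R] R by simp
  qed simp
qed

text \<open>Once \<open>W R 0\<close> exceeds \<open>E - e\<close>, less than \<open>e\<close> of
  the total energy \<open>E\<close> is left for the flux through \<open>u = R\<close>, for every
  \<open>V\<close> at once. This uniformity is what convergence on the half line requires.\<close>

lemma H_transf_boundary:
  assumes sol: "csol \<phi> \<psi>" and W: "energy_potential \<phi> \<psi> W" and WM: "\<And>s. 0 \<le> s \<Longrightarrow> W s s \<le> M"
    and L: "diff_bounded (\<lambda>s. \<psi> s s) L"
    and g: "\<And>u. 0 < u \<Longrightarrow> \<phi> u 0 = g u" and k: "\<And>v. 0 < v \<Longrightarrow> \<psi> 0 v = k v"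
  shows "H_transf_to g k"
proof (rule H_transf_toI[OF _ g _ k])
  obtain E where E: "((\<lambda>s. W s s) \<longlongrightarrow> E) at_top" "\<And>s. 0 \<le> s \<Longrightarrow> W s s \<le> E"
    by (rule tendsto_mono_bounded_at_top[of "\<lambda>s. W s s" M]) (use energy_mono[OF W] WM in auto)
  fix e :: real assume "0 < e"
  then have lt: "E - e < E" by simp
  have "((\<lambda>R. W R 0) \<longlongrightarrow> E) at_top"
    by (rule energy_limits[OF sol W WM L E(1)])
  from order_tendstoD(1)[OF this lt] have "\<forall>\<^sub>F R in at_top. E - e < W R 0" .
  then obtain R0 where R0: "\<And>R. R0 \<le> R \<Longrightarrow> E - e < W R 0"
    by (auto simp: eventually_at_top_linorder)
  show "\<exists>R0. \<forall>R\<ge>R0. \<forall>V\<ge>0. integral {0..V} (\<lambda>v. (cmod (\<psi> 0 v - charsol_psi (\<lambda>u. \<phi> u 0) R 0 v))^2) \<le> e"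
  proof (intro exI[of _ "max 0 R0"] allI impI)
    fix R V :: real assume R: "max 0 R0 \<le> R" and V: "0 \<le> V"
    have "W R V \<le> E"
      by (rule energy_le[OF W E(2) _ V]) (use R in auto)
    then show "integral {0..V} (\<lambda>v. (cmod (\<psi> 0 v - charsol_psi (\<lambda>u. \<phi> u 0) R 0 v))^2) \<le> e"
      using charsol_error(1)[OF sol W V, of 0 R] R0[of R] R by simp
  qed
next
  show "continuous_on UNIV (\<lambda>u. \<phi> u 0)"
    by (intro csol_continuous[OF sol] continuous_intros)
  show "continuous_on UNIV (\<psi> 0)"
    using continuous_on_section2[OF csolD(2)[OF sol], of UNIV 0] .
qed

section \<open>From the boundary to the Cauchy line\<close>

text \<open>The difference is the integral of \<open>\<psi> u\<close> over \<open>[0, u]\<close>,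
  and differentiating under this integral only uses
  \<open>\<partial>\<^sub>u \<psi> = - \<phi>\<close>. No regularity of the data beyond continuity
  enters.\<close>

lemma boundary_minus_diagonal:
  assumes sol: "csol \<phi> \<psi>"
  shows "((\<lambda>u. \<phi> u 0 - \<phi> u u) has_vector_derivative \<psi> u u - sint 0 u (\<phi> u)) (at u)"
    and "continuous_on UNIV (\<lambda>u. \<psi> u u - sint 0 u (\<phi> u))"
proof -
  have eq: "\<phi> u 0 - \<phi> u u = sint 0 u (\<psi> u)" for u
    using sint_antiderivative[of "\<lambda>v. - \<phi> u v" "\<psi> u" 0 u] has_vector_derivative_minus[OF csolD(4)[OF sol]]
    by simp
  have "((\<lambda>s. sint 0 s (\<psi> s)) has_vector_derivative (\<lambda>x y. sint 0 y (\<lambda>v. - \<phi> x v)) u u + \<psi> u u) (at u)"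
  proof (rule partials_diagonal[where W="\<lambda>x y. sint 0 y (\<psi> x)" and P="\<lambda>x y. sint 0 y (\<lambda>v. - \<phi> x v)" and Q=\<psi>])
    show "((\<lambda>x. sint 0 y (\<psi> x)) has_vector_derivative sint 0 y (\<lambda>v. - \<phi> x v)) (at x)" for x y
      by (rule sint_param_has_vector_derivative[OF csolD(3)[OF sol] continuous_on_section2[OF csolD(2)[OF sol]]])
        (use csolD(1)[OF sol] in \<open>auto simp: split_beta intro!: continuous_intros\<close>)
    show "((\<lambda>y. sint 0 y (\<psi> x)) has_vector_derivative \<psi> x y) (at y)" for x y
      by (rule sint_has_vector_derivative[OF continuous_on_section2[OF csolD(2)[OF sol]]])
  qed (rule csolD(2)[OF sol])
  then show "((\<lambda>u. \<phi> u 0 - \<phi> u u) has_vector_derivative \<psi> u u - sint 0 u (\<phi> u)) (at u)"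
    unfolding eq by (rule has_vector_derivative_eq_rhs) (simp add: sint_def)
  have "continuous_on UNIV (\<lambda>u. sint 0 u (\<phi> u))"
    using csolD(1)[OF sol] by (intro continuous_on_sint continuous_intros) simp
  then show "continuous_on UNIV (\<lambda>u. \<psi> u u - sint 0 u (\<phi> u))"
    by (intro continuous_intros csol_continuous[OF sol])
qed

lemma H1_boundary:
  assumes sol: "csol \<phi> \<psi>" and f0: "H1 f0" "\<And>x. 0 < x \<Longrightarrow> \<phi> x x = f0 x"
    and sb: "square_bounded (\<lambda>u. \<phi> u 0) K" and db: "diff_bounded (\<lambda>u. \<phi> u 0) K'"
  shows "H1 (\<lambda>u. \<phi> u 0)"
proof (rule H1_perturb[OF f0(1)])
  show "square_bounded (\<lambda>u. \<phi> u 0) (max K K')" by (rule square_bounded_mono[OF sb]) simp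
  show "diff_bounded (\<lambda>u. \<phi> u 0) (max K K')" by (rule diff_bounded_mono[OF db]) simp
  show "continuous_on UNIV (\<lambda>u. \<psi> u u - sint 0 u (\<phi> u))" by (rule boundary_minus_diagonal[OF sol])
  show "((\<lambda>u. \<phi> u 0 - \<phi> u u) has_vector_derivative \<psi> u u - sint 0 u (\<phi> u)) (at u)" for u
    by (rule boundary_minus_diagonal[OF sol])
  show "\<phi> x 0 = f0 x + (\<phi> x 0 - \<phi> x x)" if "0 < x" for x
    using f0(2)[OF that] by simp
qed (intro csol_continuous[OF sol] continuous_intros)

lemma H1_diagonal:
  assumes sol: "csol \<phi> \<psi>" and g: "H1 g" "\<And>x. 0 < x \<Longrightarrow> \<phi> x 0 = g x"
    and sb: "square_bounded (\<lambda>s. \<phi> s s) K" and db: "diff_bounded (\<lambda>s. \<phi> s s) K'"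
  shows "H1 (\<lambda>s. \<phi> s s)"
proof (rule H1_perturb[OF g(1)])
  show "square_bounded (\<lambda>s. \<phi> s s) (max K K')" by (rule square_bounded_mono[OF sb]) simp
  show "diff_bounded (\<lambda>s. \<phi> s s) (max K K')" by (rule diff_bounded_mono[OF db]) simp
  show "continuous_on UNIV (\<lambda>u. - (\<psi> u u - sint 0 u (\<phi> u)))"
    by (intro continuous_on_minus boundary_minus_diagonal[OF sol])
  show "((\<lambda>u. - (\<phi> u 0 - \<phi> u u)) has_vector_derivative - (\<psi> u u - sint 0 u (\<phi> u))) (at u)" for u
    by (intro has_vector_derivative_minus boundary_minus_diagonal[OF sol])
  show "\<phi> x x = g x + - (\<phi> x 0 - \<phi> x x)" if "0 < x" for x
    using g(2)[OF that] by simp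
qed (intro csol_continuous[OF sol] continuous_intros)

text \<open>Convergence is required only on bounded intervals, because the constants with which it
  moves from one \<open>u\<close> to another depend on \<open>V\<close>.\<close>

definition transform_limit ::
  "(real \<Rightarrow> real \<Rightarrow> complex) \<Rightarrow> (real \<Rightarrow> real \<Rightarrow> complex) \<Rightarrow> real \<Rightarrow> bool" where
  "transform_limit \<phi> \<psi> u \<longleftrightarrow> (\<forall>V\<ge>0. \<forall>e>0. \<exists>R0. \<forall>R\<ge>R0.
     integral {0..V} (\<lambda>v. (cmod (\<psi> u v - charsol_psi (\<lambda>u. \<phi> u 0) R u v))^2) \<le> e)"

text \<open>The remainder vanishes in its first component on \<open>v = 0\<close>, so the
  characteristic formula expresses it at \<open>u\<close> through its values on \<open>u = 0\<close>
  by a Volterra operator with a kernel bounded on \<open>[0, V]\<close>. \<open>D\<close> collects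
  the resulting constants.\<close>

lemma transform_limit_propagates:
  assumes sol: "csol \<phi> \<psi>" and lim: "transform_limit \<phi> \<psi> 0"
  shows "transform_limit \<phi> \<psi> u"
  unfolding transform_limit_def
proof (intro allI impI)
  fix V e :: real assume V: "0 \<le> V" and e: "0 < e"
  let ?b = "\<lambda>R u v. \<psi> u v - charsol_psi (\<lambda>u. \<phi> u 0) R u v"
  let ?q = "\<lambda>v r. (0 - u) * E1 ((0 - u) * (v - r))"
  have "compact ((\<lambda>y. u * E1 (- u * y)) ` {0..V})"
    by (intro compact_continuous_image continuous_intros) auto
  from compact_imp_bounded[OF this] obtain C0 where C0: "\<forall>y\<in>{0..V}. \<bar>u * E1 (- u * y)\<bar> \<le> C0"
    unfolding bounded_iff by auto
  define C where "C = max 0 C0"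
  have C: "(?q v r)^2 \<le> C^2" if "0 \<le> r" "r \<le> v" "v \<le> V" for v r
  proof -
    have "\<bar>?q v r\<bar> \<le> C" using C0[rule_format, of "v - r"] that by (simp add: C_def abs_mult)
    then have "\<bar>?q v r\<bar>^2 \<le> C^2" by (intro power_mono) auto
    then show ?thesis by simp
  qed
  define D where "D = 2 + 2 * V^2 * C^2"
  have D: "0 < D" by (simp add: D_def add_pos_nonneg)
  obtain R0 where R0: "\<And>R. R0 \<le> R \<Longrightarrow> integral {0..V} (\<lambda>v. (cmod (?b R 0 v))^2) \<le> e / D"
    using lim V e D unfolding transform_limit_def by (meson divide_pos_pos)
  show "\<exists>R0. \<forall>R\<ge>R0. integral {0..V} (\<lambda>v. (cmod (?b R u v))^2) \<le> e"
  proof (intro exI[of _ R0] allI impI)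
    fix R assume R: "R0 \<le> R"
    define \<beta> where "\<beta> = integral {0..V} (\<lambda>v. (cmod (?b R 0 v))^2)"
    have sol': "csol (\<lambda>u v. \<phi> u v - charsol_phi (\<lambda>u. \<phi> u 0) R u v) (?b R)"
      by (intro csol_diff sol csol_charsol csol_continuous[OF sol] continuous_intros)
    note cont = csol_continuous[OF sol']
    have "(cmod (?b R u v))^2 \<le> 2 * (cmod (?b R 0 v))^2 + 2 * (V * C^2 * \<beta>)" if v: "v \<in> {0..V}" for v
    proof -
      have "?b R u v = ?b R 0 v - sint 0 v (\<lambda>r. of_real (?q v r) * ?b R 0 r)"
        by (rule csol_characteristic_formula[OF sol']) simp
      also have "\<dots> = ?b R 0 v + - integral {0..v} (\<lambda>r. ?q v r *\<^sub>R ?b R 0 r)"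
        using v by (simp add: sint_le scaleR_conv_of_real)
      finally have b: "?b R u v = ?b R 0 v + - integral {0..v} (\<lambda>r. ?q v r *\<^sub>R ?b R 0 r)" .
      have "(cmod (integral {0..v} (\<lambda>r. ?q v r *\<^sub>R ?b R 0 r)))^2
         \<le> integral {0..v} (\<lambda>r. (?q v r)^2) * integral {0..v} (\<lambda>r. (cmod (?b R 0 r))^2)"
        by (intro cauchy_schwarz_integral continuous_intros cont)
      also have "\<dots> \<le> (V * C^2) * \<beta>"
      proof (rule mult_mono)
        have "integral {0..v} (\<lambda>r. (?q v r)^2) \<le> integral {0..v} (\<lambda>r. C^2)"
          by (rule integral_le) (use v C in \<open>auto intro!: integrable_continuous_real continuous_intros\<close>)
        also have "\<dots> \<le> V * C^2" using v by (simp add: mult_right_mono)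
        finally show "integral {0..v} (\<lambda>r. (?q v r)^2) \<le> V * C^2" .
        show "integral {0..v} (\<lambda>r. (cmod (?b R 0 r))^2) \<le> \<beta>"
          unfolding \<beta>_def using v
          by (intro integral_subset_le integrable_continuous_real continuous_intros cont) auto
        show "0 \<le> integral {0..v} (\<lambda>r. (cmod (?b R 0 r))^2)"
          by (intro integral_nonneg integrable_continuous_real continuous_intros cont) auto
      qed (use V in auto)
      finally show ?thesis
        unfolding b by (intro order_trans[OF cmod_add_square_le]) simp
    qed
    then have "integral {0..V} (\<lambda>v. (cmod (?b R u v))^2)
        \<le> integral {0..V} (\<lambda>v. 2 * (cmod (?b R 0 v))^2 + 2 * (V * C^2 * \<beta>))"
      by (intro integral_le integrable_continuous_real continuous_intros cont)
    also have "\<dots> = 2 * \<beta> + V * (2 * (V * C^2 * \<beta>))"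
      unfolding \<beta>_def using V
      by (subst integral_add) (auto intro!: integrable_continuous_real continuous_intros cont)
    also have "\<dots> = D * \<beta>" by (simp add: D_def algebra_simps power2_eq_square)
    also have "\<dots> \<le> e" using R0[OF R] D by (simp add: \<beta>_def field_simps)
    finally show "integral {0..V} (\<lambda>v. (cmod (?b R u v))^2) \<le> e" .
  qed
qed

lemma charsol_psi_energy:
  assumes g: "continuous_on UNIV g" and V: "0 \<le> V" and u: "u \<le> R"
  shows "integral {0..V} (\<lambda>v. (cmod (charsol_psi g R u v))^2) \<le> integral {u..R} (\<lambda>s. (cmod (g s))^2)"
proof -
  obtain W where W: "energy_potential (charsol_phi g R) (charsol_psi g R) W"
    by (rule energy_potential_exists[OF csol_charsol[OF g]])
  have "W R V = W R 0"
    using integral_unique[OF energy_v[OF W V, of R]] by simp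
  then show ?thesis
    using integral_unique[OF energy_v[OF W V, of u]] integral_unique[OF energy_u[OF W u, of 0]]
      energy_mono[OF W u, of V V] by simp
qed

text \<open>The cut-off solutions obey a bound \<open>K\<close> that does not depend on
  \<open>R\<close>, and the remainder becomes small. The factor 2 comes from splitting the square of
  a sum.\<close>

lemma transform_limit_square_bounded:
  assumes sol: "csol \<phi> \<psi>" and lim: "transform_limit \<phi> \<psi> u" and u: "0 \<le> u"
    and g: "square_bounded (\<lambda>u. \<phi> u 0) K"
  shows "square_bounded (\<psi> u) (2 * K)"
  unfolding square_bounded_def
proof (intro allI impI)
  fix V :: real assume V: "0 \<le> V"
  let ?g = "\<lambda>u. \<phi> u 0"
  have cg: "continuous_on A ?g" for A by (intro csol_continuous[OF sol] continuous_intros)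
  note cont = csol_continuous[OF sol] csol_continuous[OF csol_charsol[OF cg]]
  show "integral {0..V} (\<lambda>v. (cmod (\<psi> u v))^2) \<le> 2 * K"
  proof (rule field_le_epsilon)
    fix e :: real assume "0 < e"
    then obtain R0 where R0: "\<And>R. R0 \<le> R \<Longrightarrow> integral {0..V} (\<lambda>v. (cmod (\<psi> u v - charsol_psi ?g R u v))^2) \<le> e / 2"
      using lim V unfolding transform_limit_def by (meson half_gt_zero)
    define R where "R = max R0 u"
    have R: "u \<le> R" "0 \<le> R" using u by (auto simp: R_def)
    have "integral {0..V} (\<lambda>v. (cmod (\<psi> u v))^2)
       = integral {0..V} (\<lambda>v. (cmod ((\<psi> u v - charsol_psi ?g R u v) + charsol_psi ?g R u v))^2)" by simp
    also have "\<dots> \<le> 2 * integral {0..V} (\<lambda>v. (cmod (\<psi> u v - charsol_psi ?g R u v))^2)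
       + 2 * integral {0..V} (\<lambda>v. (cmod (charsol_psi ?g R u v))^2)"
      by (intro square_integral_add_le continuous_intros cont)
    also have "integral {0..V} (\<lambda>v. (cmod (\<psi> u v - charsol_psi ?g R u v))^2) \<le> e / 2"
      by (rule R0) (simp add: R_def)
    also have "integral {0..V} (\<lambda>v. (cmod (charsol_psi ?g R u v))^2) \<le> integral {u..R} (\<lambda>s. (cmod (?g s))^2)"
      by (rule charsol_psi_energy[OF cg V R(1)])
    also have "\<dots> \<le> integral {0..R} (\<lambda>s. (cmod (?g s))^2)"
      by (rule integral_subset_le) (use u in \<open>auto intro!: integrable_continuous_real continuous_intros cont\<close>)
    also have "\<dots> \<le> K" by (rule square_boundedD[OF g R(2)])
    finally show "integral {0..V} (\<lambda>v. (cmod (\<psi> u v))^2) \<le> 2 * K + e" by simp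
  qed
qed

lemma sint_shift:
  fixes f :: "real \<Rightarrow> 'a::banach"
  assumes "continuous_on UNIV f" shows "sint a b (\<lambda>s. f (s + h)) = sint (a + h) (b + h) f"
proof -
  have "((\<lambda>x. sint (a + h) (x + h) f) has_vector_derivative f (x + h)) (at x)" for x
  proof -
    have "((\<lambda>x. x + h) has_vector_derivative 1) (at x)"
      by (auto intro!: derivative_eq_intros)
    from vector_diff_chain_at[OF this sint_has_vector_derivative[OF assms]]
    show ?thesis by (simp add: o_def)
  qed
  from sint_antiderivative[OF this] show ?thesis by simp
qed

lemma sint_diff:
  assumes "continuous_on UNIV f" "continuous_on UNIV g"
  shows "sint a b (\<lambda>s. f s - g s) = sint a b f - sint a b g"
  using sint_antiderivative[OF has_vector_derivative_diff[OF sint_has_vector_derivative[OF assms(1), of a]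
    sint_has_vector_derivative[OF assms(2), of a]], of a b] by simp

text \<open>For the difference with a translate, the limit at 0 combines the limits of the original
  solution at \<open>h\<close> and at 0; this is why the limit has to be propagated in
  \<open>u\<close>.\<close>

lemma transform_limit_shift:
  assumes sol: "csol \<phi> \<psi>" and lim: "transform_limit \<phi> \<psi> 0"
  shows "transform_limit (\<lambda>u v. \<phi> (u + h) v - \<phi> u v) (\<lambda>u v. \<psi> (u + h) v - \<psi> u v) 0"
  unfolding transform_limit_def
proof (intro allI impI)
  fix V e :: real assume V: "0 \<le> V" and e: "0 < e"
  let ?g = "\<lambda>u. \<phi> u 0"
  have cg: "continuous_on A ?g" for A by (intro csol_continuous[OF sol] continuous_intros)
  note [continuous_intros] = csol_continuous[OF sol] csol_continuous[OF csol_charsol[OF cg]]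
  obtain R1 where R1: "\<And>R. R1 \<le> R \<Longrightarrow> integral {0..V} (\<lambda>v. (cmod (\<psi> 0 v - charsol_psi ?g R 0 v))^2) \<le> e / 4"
    using lim V e unfolding transform_limit_def by (meson divide_pos_pos zero_less_numeral)
  obtain R2 where R2: "\<And>R. R2 \<le> R \<Longrightarrow> integral {0..V} (\<lambda>v. (cmod (\<psi> h v - charsol_psi ?g R h v))^2) \<le> e / 4"
    using transform_limit_propagates[OF sol lim, of h] V e unfolding transform_limit_def
    by (meson divide_pos_pos zero_less_numeral)
  show "\<exists>R0. \<forall>R\<ge>R0. integral {0..V} (\<lambda>v. (cmod (\<psi> (0 + h) v - \<psi> 0 v
      - charsol_psi (\<lambda>u. \<phi> (u + h) 0 - \<phi> u 0) R 0 v))^2) \<le> e"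
  proof (intro exI[of _ "max R1 (R2 - h)"] allI impI)
    fix R assume R: "max R1 (R2 - h) \<le> R"
    \<comment> \<open>Translation turns the cut-off at \<open>R\<close> into one at
      \<open>R + h\<close>, which explains the threshold \<open>R2 - h\<close>.\<close>
    have eq: "charsol_psi (\<lambda>u. \<phi> (u + h) 0 - \<phi> u 0) R 0 v = charsol_psi ?g (R + h) h v - charsol_psi ?g R 0 v" for v
    proof -
      have "charsol_psi (\<lambda>u. \<phi> (u + h) 0 - \<phi> u 0) R 0 v
        = sint 0 R (\<lambda>s. E0 (v * (s + h - h)) *\<^sub>R \<phi> (s + h) 0 - E0 (v * (s - 0)) *\<^sub>R \<phi> s 0)"
        by (simp add: charsol_psi_def scaleR_diff_right)
      also have "\<dots> = sint 0 R (\<lambda>s. E0 (v * (s + h - h)) *\<^sub>R \<phi> (s + h) 0) - charsol_psi ?g R 0 v"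
        unfolding charsol_psi_def by (intro sint_diff continuous_intros)
      also have "sint 0 R (\<lambda>s. E0 (v * (s + h - h)) *\<^sub>R \<phi> (s + h) 0) = charsol_psi ?g (R + h) h v"
        unfolding charsol_psi_def
        using sint_shift[of "\<lambda>s. E0 (v * (s - h)) *\<^sub>R \<phi> s 0" 0 R h]
        by (simp add: continuous_intros)
      finally show ?thesis .
    qed
    have "integral {0..V} (\<lambda>v. (cmod (\<psi> (0 + h) v - \<psi> 0 v - charsol_psi (\<lambda>u. \<phi> (u + h) 0 - \<phi> u 0) R 0 v))^2)
      = integral {0..V} (\<lambda>v. (cmod ((\<psi> h v - charsol_psi ?g (R + h) h v) + (charsol_psi ?g R 0 v - \<psi> 0 v)))^2)"
      unfolding eq by (simp add: algebra_simps)
    also have "\<dots> \<le> 2 * integral {0..V} (\<lambda>v. (cmod (\<psi> h v - charsol_psi ?g (R + h) h v))^2)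
      + 2 * integral {0..V} (\<lambda>v. (cmod (charsol_psi ?g R 0 v - \<psi> 0 v))^2)"
      by (intro square_integral_add_le continuous_intros)
    also have "\<dots> \<le> e"
      using R1[of R] R2[of "R + h"] R by (simp add: norm_minus_commute)
    finally show "integral {0..V} (\<lambda>v. (cmod (\<psi> (0 + h) v - \<psi> 0 v
      - charsol_psi (\<lambda>u. \<phi> (u + h) 0 - \<phi> u 0) R 0 v))^2) \<le> e" .
  qed
qed

text \<open>The path from \<open>(0, 0)\<close> to \<open>(s, s)\<close> runs along
  \<open>v = 0\<close>, which costs \<open>K\<close>, and then up the line of constant
  \<open>u = s\<close>, which costs \<open>2 * K\<close>.\<close>

lemma diagonal_energy_from_boundary:
  assumes sol: "csol \<phi> \<psi>" and W: "energy_potential \<phi> \<psi> W" and lim: "transform_limit \<phi> \<psi> 0"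
    and g: "square_bounded (\<lambda>u. \<phi> u 0) K" and s: "0 \<le> s"
  shows "W s s \<le> 3 * K"
  using square_boundedD[OF g s] integral_unique[OF energy_u[OF W s, of 0]] energy_0[OF W]
    square_boundedD[OF transform_limit_square_bounded[OF sol transform_limit_propagates[OF sol lim] s g] s]
    integral_unique[OF energy_v[OF W s, of s]] by simp

lemma diagonal_square_bounded:
  assumes sol: "csol \<phi> \<psi>" and lim: "transform_limit \<phi> \<psi> 0" and g: "square_bounded (\<lambda>u. \<phi> u 0) K"
  shows "square_bounded (\<lambda>s. \<phi> s s) (3 * K)"
  unfolding square_bounded_def
proof safe
  fix U :: real assume U: "0 \<le> U"
  obtain W where W: "energy_potential \<phi> \<psi> W" by (rule energy_potential_exists[OF sol])
  have "integral {0..U} (\<lambda>s. (cmod (\<phi> s s))^2) \<le> integral {0..U} (\<lambda>s. (cmod (\<phi> s s))^2 + (cmod (\<psi> s s))^2)"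
    by (rule integral_le) (auto intro!: integrable_continuous_real continuous_intros csol_continuous[OF sol])
  also have "\<dots> = W U U"
    using integral_unique[OF energy_diag[OF W U]] energy_0[OF W] by simp
  also have "\<dots> \<le> 3 * K" by (rule diagonal_energy_from_boundary[OF sol W lim g U])
  finally show "integral {0..U} (\<lambda>s. (cmod (\<phi> s s))^2) \<le> 3 * K" .
qed

text \<open>The reverse of the passage in \<open>shifted_diagonal\<close>: the bound for the
  translated solution at \<open>(s + h, s)\<close> is completed to \<open>(s + h, s + h)\<close> by
  \<open>near_diagonal\<close>.\<close>

lemma diagonal_diff_bounded:
  assumes sol: "csol \<phi> \<psi>" and lim: "transform_limit \<phi> \<psi> 0" and g: "square_bounded (\<lambda>u. \<phi> u 0) K"
    and dg: "diff_bounded (\<lambda>u. \<phi> u 0) K"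
  shows "diff_bounded (\<lambda>s. \<phi> s s) (12 * K)"
  unfolding diff_bounded_def
proof safe
  fix h :: real assume h: "0 < h" "h \<le> 1"
  obtain W where W: "energy_potential \<phi> \<psi> W" by (rule energy_potential_exists[OF sol])
  have WM: "W s s \<le> 3 * K" if "0 \<le> s" for s
    by (rule diagonal_energy_from_boundary[OF sol W lim g that])
  have 1: "square_bounded (\<lambda>s. \<phi> (s + h) s - \<phi> s s) (3 * (K * h^2))"
    using diagonal_square_bounded[OF csol_diff[OF csol_shift[OF sol] sol] transform_limit_shift[OF sol lim]
        diff_boundedD[OF dg h]] .
  have 2: "square_bounded (\<lambda>s. \<phi> (s + h) (s + h) - \<phi> (s + h) s) (3 * K * h^2)"
    using near_diagonal(2)[OF sol W WM h(1)] by (simp add: square_bounded_def norm_minus_commute)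
  have "square_bounded (\<lambda>s. (\<phi> (s + h) s - \<phi> s s) + (\<phi> (s + h) (s + h) - \<phi> (s + h) s))
     (2 * (3 * (K * h^2)) + 2 * (3 * K * h^2))"
    by (rule square_bounded_add[OF _ _ 1 2]) (intro continuous_intros csol_continuous[OF sol])+
  then show "square_bounded (\<lambda>s. \<phi> (s + h) (s + h) - \<phi> s s) (12 * K * h^2)"
    by (simp add: algebra_simps)
qed

section \<open>The wedge\<close>

lemma norm_integral_le_power:
  fixes f :: "real \<Rightarrow> complex"
  assumes f: "(f has_integral I) {0..d}" and d: "0 \<le> d"
    and le: "\<And>r. 0 \<le> r \<Longrightarrow> r \<le> d \<Longrightarrow> cmod (f r) \<le> M * r^n / fact n"
  shows "cmod I \<le> M * d^(Suc n) / fact (Suc n)"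
proof -
  have "((\<lambda>r. M * r^(Suc n) / fact (Suc n)) has_vector_derivative M * r^n / fact n) (at r within {0..d})" for r
  proof -
    have "((\<lambda>r. M * r^(Suc n) / fact (Suc n)) has_real_derivative M * (real (Suc n) * r^n) / fact (Suc n)) (at r within {0..d})"
      using DERIV_pow[of "Suc n" r "{0..d}"]
      by (intro DERIV_cdivide DERIV_cmult) simp
    then show ?thesis
      by (simp add: has_real_derivative_iff_has_vector_derivative)
  qed
  from fundamental_theorem_of_calculus[OF d this]
  have p: "((\<lambda>r. M * r^n / fact n) has_integral M * d^(Suc n) / fact (Suc n)) {0..d}" by simp
  have "cmod (integral {0..d} f) \<le> integral {0..d} (\<lambda>r. M * r^n / fact n)"
    by (rule integral_norm_bound_integral[OF has_integral_integrable[OF f] has_integral_integrable[OF p]])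
      (use le in auto)
  then show ?thesis using integral_unique[OF f] integral_unique[OF p] by simp
qed

lemma norm_integral_le_power_reflected:
  fixes f :: "real \<Rightarrow> complex"
  assumes f: "(f has_integral I) {0..d}" and d: "0 \<le> d"
    and le: "\<And>r. 0 \<le> r \<Longrightarrow> r \<le> d \<Longrightarrow> cmod (f r) \<le> M * (d - r)^n / fact n"
  shows "cmod I \<le> M * d^(Suc n) / fact (Suc n)"
proof (rule norm_integral_le_power[OF _ d])
  have "((\<lambda>r. f (- r)) has_integral I) {-d..0}"
    using f has_integral_reflect_real[of f I d 0] by simp
  then have "((\<lambda>r. f (- r)) has_integral I) {0 + - d..d + - d}" by simp
  then show "((\<lambda>r. f (d - r)) has_integral I) {0..d}"
    unfolding has_integral_shift_Icc_real[symmetric] by (simp add: o_def)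
  show "cmod (f (d - r)) \<le> M * r^n / fact n" if "0 \<le> r" "r \<le> d" for r
    using le[of "d - r"] that by simp
qed

text \<open>On a square away from the corner, iterating the integral equations from the diagonal
  bounds the difference of two solutions by \<open>M * \<bar>u - v\<bar>^n / fact n\<close> for all \<open>n\<close>.\<close>

lemma is_solution_unique:
  assumes 1: "is_solution F G \<psi>\<^sub>1 \<phi>\<^sub>1" and 2: "is_solution F G \<psi>\<^sub>2 \<phi>\<^sub>2" and tx: "(t, x) \<in> wedge"
  shows "\<psi>\<^sub>1 t x = \<psi>\<^sub>2 t x \<and> \<phi>\<^sub>1 t x = \<phi>\<^sub>2 t x"
proof -
  define D\<psi> where "D\<psi> t x = \<psi>\<^sub>1 t x - \<psi>\<^sub>2 t x" for t x
  define D\<phi> where "D\<phi> t x = \<phi>\<^sub>1 t x - \<phi>\<^sub>2 t x" for t x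
  define a where "a u v = D\<phi> (v - u) (u + v)" for u v
  define b where "b u v = D\<psi> (v - u) (u + v)" for u v
  have cD: "continuous_on wedge (\<lambda>(t, x). D\<psi> t x)" "continuous_on wedge (\<lambda>(t, x). D\<phi> t x)"
    using 1 2 unfolding is_solution_def D\<psi>_def D\<phi>_def split_beta
    by (auto intro!: continuous_on_diff)
  have wedge: "(v - u, u + v) \<in> wedge" if "0 < u" "0 < v" for u v
    using that by (auto simp: wedge_def)
  have a_path: "((\<lambda>r. - b u (v + r)) has_integral (a u (v + s) - a u v)) {0..s}"
    if "0 < u" "0 < v" "0 \<le> s" for u v s
  proof -
    have w: "(v - u, u + v) \<in> wedge" "(v - u + s, u + v + s) \<in> wedge"
      using that by (auto simp: wedge_def)
    have "((\<lambda>r. - \<psi>\<^sub>1 (v - u + r) (u + v + r) - - \<psi>\<^sub>2 (v - u + r) (u + v + r)) has_integral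
       (\<phi>\<^sub>1 (v - u + s) (u + v + s) - \<phi>\<^sub>1 (v - u) (u + v)) - (\<phi>\<^sub>2 (v - u + s) (u + v + s) - \<phi>\<^sub>2 (v - u) (u + v))) {0..s}"
      using 1 2 w that(3) unfolding is_solution_def by (intro has_integral_diff) blast+
    then show ?thesis
      by (simp add: a_def b_def D\<phi>_def D\<psi>_def algebra_simps)
  qed
  have b_path: "((\<lambda>r. a (u - r) v) has_integral (b (u - s) v - b u v)) {0..s}"
    if "0 < v" "0 \<le> s" "s < u" for u v s
  proof -
    have w: "(v - u, u + v) \<in> wedge" "(v - u + s, u + v - s) \<in> wedge"
      using that by (auto simp: wedge_def)
    have "((\<lambda>r. \<phi>\<^sub>1 (v - u + r) (u + v - r) - \<phi>\<^sub>2 (v - u + r) (u + v - r)) has_integral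
       (\<psi>\<^sub>1 (v - u + s) (u + v - s) - \<psi>\<^sub>1 (v - u) (u + v)) - (\<psi>\<^sub>2 (v - u + s) (u + v - s) - \<psi>\<^sub>2 (v - u) (u + v))) {0..s}"
      using 1 2 w that(2) unfolding is_solution_def by (intro has_integral_diff) blast+
    then show ?thesis
      by (simp add: a_def b_def D\<phi>_def D\<psi>_def algebra_simps)
  qed
  have diag: "a u u = 0" "b u u = 0" if "0 < u" for u
    using 1 2 that by (auto simp: is_solution_def a_def b_def D\<phi>_def D\<psi>_def)
  have zero: "a u v = 0 \<and> b u v = 0" if uv: "0 < u" "0 < v" for u v
  proof -
    \<comment> \<open>The characteristics from \<open>(u, v)\<close> to the diagonal stay in the
      square \<open>[\<epsilon>, X] \<times> [\<epsilon>, X]\<close>, which is compact and avoids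
      the missing corner of the wedge.\<close>
    define \<epsilon> X where "\<epsilon> = min u v" and "X = max u v"
    have \<epsilon>: "0 < \<epsilon>" using uv by (simp add: \<epsilon>_def)
    define S where "S = (\<lambda>(u, v). (v - u, u + v)) ` ({\<epsilon>..X} \<times> {\<epsilon>..X})"
    have "compact S"
      unfolding S_def split_beta
      by (intro compact_continuous_image compact_Times continuous_intros) auto
    have "S \<subseteq> wedge"
      unfolding S_def using \<epsilon> wedge by (auto simp: wedge_def)
    have "bounded ((\<lambda>(t, x). D\<psi> t x) ` S)" "bounded ((\<lambda>(t, x). D\<phi> t x) ` S)"
      by (intro compact_imp_bounded compact_continuous_image \<open>compact S\<close>
          continuous_on_subset[OF cD(1) \<open>S \<subseteq> wedge\<close>] continuous_on_subset[OF cD(2) \<open>S \<subseteq> wedge\<close>])+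
    then obtain M1 M2 where M: "\<forall>z\<in>S. cmod (D\<psi> (fst z) (snd z)) \<le> M1" "\<forall>z\<in>S. cmod (D\<phi> (fst z) (snd z)) \<le> M2"
      unfolding bounded_iff by (auto simp: split_beta)
    define M where "M = max M1 M2"
    have base: "cmod (a u v) \<le> M \<and> cmod (b u v) \<le> M" if "u \<in> {\<epsilon>..X}" "v \<in> {\<epsilon>..X}" for u v
    proof -
      have "(v - u, u + v) \<in> S" unfolding S_def using that by (auto intro!: image_eqI[of _ _ "(u, v)"])
      then show ?thesis using M by (force simp: a_def b_def M_def)
    qed
    have bound: "cmod (a u v) \<le> M * \<bar>u - v\<bar>^n / fact n \<and> cmod (b u v) \<le> M * \<bar>u - v\<bar>^n / fact n"
      if "u \<in> {\<epsilon>..X}" "v \<in> {\<epsilon>..X}" for u v n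
      using that
    proof (induction n arbitrary: u v)
      case 0
      then show ?case using base by simp
    next
      case (Suc n)
      have pos: "0 < u" "0 < v" using Suc.prems \<epsilon> by auto
      show ?case
      proof (cases "v \<le> u")
        case True
        \<comment> \<open>Here the path ends on the diagonal and the distance to it is
          \<open>u - v - r\<close>, hence the reflected estimate. In the other case the path starts
          on the diagonal.\<close>
        have "cmod (a u (v + (u - v)) - a u v) \<le> M * (u - v)^(Suc n) / fact (Suc n)"
        proof (rule norm_integral_le_power_reflected[OF a_path[OF pos]])
          show "cmod (- b u (v + r)) \<le> M * (u - v - r)^n / fact n" if "0 \<le> r" "r \<le> u - v" for r
            using Suc.IH[of u "v + r"] Suc.prems that by (simp add: algebra_simps)
        qed (use True in auto)
        moreover have "cmod (b (u - (u - v)) v - b u v) \<le> M * (u - v)^(Suc n) / fact (Suc n)"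
        proof (rule norm_integral_le_power_reflected[OF b_path[OF pos(2)]])
          show "cmod (a (u - r) v) \<le> M * (u - v - r)^n / fact n" if "0 \<le> r" "r \<le> u - v" for r
            using Suc.IH[of "u - r" v] Suc.prems that by (simp add: algebra_simps)
        qed (use True pos in auto)
        ultimately show ?thesis using diag pos True by simp
      next
        case False
        have "cmod (a u (u + (v - u)) - a u u) \<le> M * (v - u)^(Suc n) / fact (Suc n)"
        proof (rule norm_integral_le_power[OF a_path[OF pos(1) pos(1)]])
          show "cmod (- b u (u + r)) \<le> M * r^n / fact n" if "0 \<le> r" "r \<le> v - u" for r
            using Suc.IH[of u "u + r"] Suc.prems that by simp
        qed (use False in auto)
        moreover have "cmod (b (v - (v - u)) v - b v v) \<le> M * (v - u)^(Suc n) / fact (Suc n)"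
        proof (rule norm_integral_le_power[OF b_path[OF pos(2)]])
          show "cmod (a (v - r) v) \<le> M * r^n / fact n" if "0 \<le> r" "r \<le> v - u" for r
            using Suc.IH[of "v - r" v] Suc.prems that by simp
        qed (use False pos in auto)
        ultimately show ?thesis using diag pos False by (simp add: abs_if)
      qed
    qed
    have "(\<lambda>n. M * (\<bar>u - v\<bar>^n / fact n)) \<longlonglongrightarrow> M * 0"
      using summable_LIMSEQ_zero[OF summable_exp[of "\<bar>u - v\<bar>"]]
      by (intro tendsto_mult_left) (simp add: field_simps)
    then have lim: "(\<lambda>n. M * \<bar>u - v\<bar>^n / fact n) \<longlonglongrightarrow> 0" by simp
    have mem: "u \<in> {\<epsilon>..X}" "v \<in> {\<epsilon>..X}" by (auto simp: \<epsilon>_def X_def)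
    have "cmod (a u v) \<le> 0" "cmod (b u v) \<le> 0"
      by (rule LIMSEQ_le_const[OF lim]; use bound[OF mem] in blast)+
    then show ?thesis by simp
  qed
  \<comment> \<open>Points on the boundary rays are reached from the interior by moving to the
    right.\<close>
  define p where "p n = (t, x + inverse (real (Suc n)))" for n
  have p: "p n \<in> wedge" for n
    using tx by (auto simp: p_def wedge_def add_pos_pos add_increasing2)
  have lim: "p \<longlonglongrightarrow> (t, x)"
    unfolding p_def using tendsto_add[OF tendsto_const[of x] LIMSEQ_inverse_real_of_nat]
    by (intro tendsto_Pair tendsto_const) simp
  have z: "D\<psi> t (x + inverse (real (Suc n))) = 0" "D\<phi> t (x + inverse (real (Suc n))) = 0" for n
  proof -
    define y where "y = x + inverse (real (Suc n))"
    have "\<bar>t\<bar> < y" using tx by (auto simp: y_def wedge_def intro: le_less_trans)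
    then have "a ((y - t) / 2) ((y + t) / 2) = 0 \<and> b ((y - t) / 2) ((y + t) / 2) = 0"
      by (intro zero) auto
    moreover have "(y + t) / 2 - (y - t) / 2 = t" "(y - t) / 2 + (y + t) / 2 = y"
      by (simp_all add: field_simps)
    ultimately show "D\<psi> t (x + inverse (real (Suc n))) = 0" "D\<phi> t (x + inverse (real (Suc n))) = 0"
      by (auto simp: a_def b_def y_def)
  qed
  have "(\<lambda>n. (\<lambda>(t, x). D\<psi> t x) (p n)) \<longlonglongrightarrow> D\<psi> t x" "(\<lambda>n. (\<lambda>(t, x). D\<phi> t x) (p n)) \<longlonglongrightarrow> D\<phi> t x"
    using continuous_on_tendsto_compose[OF cD(1) lim tx] continuous_on_tendsto_compose[OF cD(2) lim tx] p
    by auto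
  then have "(\<lambda>n. 0) \<longlonglongrightarrow> D\<psi> t x" "(\<lambda>n. 0) \<longlonglongrightarrow> D\<phi> t x"
    by (simp_all only: p_def case_prod_conv z)
  then have "D\<psi> t x = 0" "D\<phi> t x = 0"
    by (auto dest: LIMSEQ_unique[OF tendsto_const])
  then show ?thesis by (simp add: D\<psi>_def D\<phi>_def)
qed

lemma is_solution_csol:
  assumes sol: "csol \<phi> \<psi>"
    and F: "\<And>x. 0 < x \<Longrightarrow> \<phi> (x / 2) (x / 2) = F x" and G: "\<And>x. 0 < x \<Longrightarrow> \<psi> (x / 2) (x / 2) = G x"
  shows "is_solution F G (\<lambda>t x. \<psi> ((x - t) / 2) ((x + t) / 2)) (\<lambda>t x. \<phi> ((x - t) / 2) ((x + t) / 2))"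
  unfolding is_solution_def
proof (intro conjI allI impI)
  show "continuous_on wedge (\<lambda>(t, x). \<psi> ((x - t) / 2) ((x + t) / 2))"
    "continuous_on wedge (\<lambda>(t, x). \<phi> ((x - t) / 2) ((x + t) / 2))"
    unfolding split_beta by (intro csol_continuous[OF sol] continuous_intros; simp)+
  fix t x s :: real
  assume s: "0 \<le> s"
  show "((\<lambda>r. \<phi> ((x - r - (t + r)) / 2) ((x - r + (t + r)) / 2)) has_integral
        (\<psi> ((x - s - (t + s)) / 2) ((x - s + (t + s)) / 2) - \<psi> ((x - t) / 2) ((x + t) / 2))) {0..s}"
  proof -
    have "((\<lambda>r. \<psi> ((x - t) / 2 - r) ((x + t) / 2)) has_vector_derivative \<phi> ((x - t) / 2 - r) ((x + t) / 2))
       (at r within {0..s})" for r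
    proof -
      have "((\<lambda>r. (x - t) / 2 - r) has_vector_derivative - 1) (at r)"
        by (auto intro!: derivative_eq_intros)
      from vector_diff_chain_at[OF this csolD(3)[OF sol]]
      show ?thesis by (simp add: o_def has_vector_derivative_at_within)
    qed
    from fundamental_theorem_of_calculus[OF s this] show ?thesis
      by (simp add: diff_divide_distrib add_divide_distrib algebra_simps)
  qed
  show "((\<lambda>r. - \<psi> ((x + r - (t + r)) / 2) ((x + r + (t + r)) / 2)) has_integral
        (\<phi> ((x + s - (t + s)) / 2) ((x + s + (t + s)) / 2) - \<phi> ((x - t) / 2) ((x + t) / 2))) {0..s}"
  proof -
    have "((\<lambda>r. \<phi> ((x - t) / 2) ((x + t) / 2 + r)) has_vector_derivative - \<psi> ((x - t) / 2) ((x + t) / 2 + r))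
       (at r within {0..s})" for r
    proof -
      have "((\<lambda>r. (x + t) / 2 + r) has_vector_derivative 1) (at r)"
        by (auto intro!: derivative_eq_intros)
      from vector_diff_chain_at[OF this csolD(4)[OF sol]]
      show ?thesis by (simp add: o_def has_vector_derivative_at_within)
    qed
    from fundamental_theorem_of_calculus[OF s this] show ?thesis
      by (simp add: diff_divide_distrib add_divide_distrib algebra_simps)
  qed
qed (use F G in simp_all)

section \<open>The kernels of the integral formulas\<close>

lemma K0_eq: "0 \<le> x * (2 * w - x) \<Longrightarrow> K0 x w = E0 (x * (2 * w - x) / 4)"
  by (simp add: K0_def J0_eq_E0)

lemma K1_eq:
  assumes "0 < x * (2 * w - x)" shows "K1 x w = x / 2 * E1 (x * (2 * w - x) / 4)"
proof -
  define r where "r = sqrt (x * (2 * w - x))"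
  have "r \<noteq> 0" "r^2 = x * (2 * w - x)" using assms by (auto simp: r_def)
  then show ?thesis unfolding K1_def J1_eq_E1 r_def[symmetric] by simp
qed

text \<open>At the diagonal point \<open>(x / 2, x / 2)\<close> the argument of \<open>E0\<close> in
  \<open>charsol_psi\<close> is \<open>x * (2 * s - x) / 4\<close>, so the cut-off solution is
  exactly the partial integral up to \<open>R\<close>.\<close>

lemma K0_improper:
  assumes g: "continuous_on UNIV g" "\<And>u. 0 < u \<Longrightarrow> g u = g' u" and x: "0 < x"
    and lim: "((\<lambda>R. charsol_psi g R (x / 2) (x / 2)) \<longlongrightarrow> l) at_top"
  shows "improper_int (\<lambda>u. complex_of_real (K0 x u) * g' u) (x / 2) l"
proof -
  have int: "((\<lambda>u. complex_of_real (K0 x u) * g' u) has_integral charsol_psi g R (x / 2) (x / 2)) {x / 2..R}"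
    if R: "x / 2 \<le> R" for R
  proof -
    have "((\<lambda>s. E0 (x / 2 * (s - x / 2)) *\<^sub>R g s) has_integral charsol_psi g R (x / 2) (x / 2)) {x / 2..R}"
      unfolding charsol_psi_def sint_le[OF R]
      by (intro integrable_integral integrable_continuous_real continuous_intros continuous_on_subset[OF g(1)]) auto
    then show ?thesis
    proof (rule has_integral_eq[rotated])
      fix s assume "s \<in> {x / 2..R}"
      then have "0 < s" "0 \<le> x * (2 * s - x)" using x by auto
      moreover have "x / 2 * (s - x / 2) = x * (2 * s - x) / 4" by (simp add: field_simps)
      ultimately show "E0 (x / 2 * (s - x / 2)) *\<^sub>R g s = complex_of_real (K0 x s) * g' s"
        using g(2) by (simp only: K0_eq scaleR_conv_of_real)
    qed
  qed
  have "\<forall>\<^sub>F R in at_top. charsol_psi g R (x / 2) (x / 2) = integral {x / 2..R} (\<lambda>u. complex_of_real (K0 x u) * g' u)"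
    using eventually_ge_at_top[of "x / 2"] by eventually_elim (simp add: integral_unique[OF int])
  from Lim_transform_eventually[OF lim this] int show ?thesis
    by (auto simp: improper_int_def intro: has_integral_integrable)
qed

lemma K1_improper:
  assumes g: "continuous_on UNIV g" "\<And>u. 0 < u \<Longrightarrow> g u = g' u" and x: "0 < x"
    and lim: "((\<lambda>R. charsol_phi g R (x / 2) (x / 2)) \<longlongrightarrow> l) at_top"
  shows "improper_int (\<lambda>u. complex_of_real (K1 x u) * g' u) (x / 2) (g' (x / 2) - l)"
proof -
  have int: "((\<lambda>u. complex_of_real (K1 x u) * g' u) has_integral g' (x / 2) - charsol_phi g R (x / 2) (x / 2)) {x / 2..R}"
    if R: "x / 2 \<le> R" for R
  proof -
    have "((\<lambda>s. (x / 2 * E1 (x / 2 * (s - x / 2))) *\<^sub>R g s) has_integral g (x / 2) - charsol_phi g R (x / 2) (x / 2)) {x / 2..R}"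
      unfolding charsol_phi_def sint_le[OF R] diff_diff_eq2 add_diff_cancel_left'
      by (intro integrable_integral integrable_continuous_real continuous_intros continuous_on_subset[OF g(1)]) auto
    then have "((\<lambda>s. (x / 2 * E1 (x / 2 * (s - x / 2))) *\<^sub>R g s) has_integral g' (x / 2) - charsol_phi g R (x / 2) (x / 2)) {x / 2..R}"
      using g(2)[of "x / 2"] x by simp
    then show ?thesis
    \<comment> \<open>At \<open>s = x / 2\<close> the quotient in \<open>K1\<close> is a division by
      zero with value 0, while the entire kernel has the value \<open>x / 2\<close>.\<close>
    proof (rule has_integral_spike[OF negligible_sing[of "x / 2"], rotated])
      fix s assume "s \<in> {x / 2..R} - {x / 2}"
      then have "0 < s" "0 < x * (2 * s - x)" using x by auto
      moreover have "x / 2 * (s - x / 2) = x * (2 * s - x) / 4" by (simp add: field_simps)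
      ultimately show "complex_of_real (K1 x s) * g' s = (x / 2 * E1 (x / 2 * (s - x / 2))) *\<^sub>R g s"
        using g(2) by (simp only: K1_eq scaleR_conv_of_real)
    qed
  qed
  have "\<forall>\<^sub>F R in at_top. g' (x / 2) - charsol_phi g R (x / 2) (x / 2) = integral {x / 2..R} (\<lambda>u. complex_of_real (K1 x u) * g' u)"
    using eventually_ge_at_top[of "x / 2"] by eventually_elim (simp add: integral_unique[OF int])
  from Lim_transform_eventually[OF tendsto_diff[OF tendsto_const lim] this] int show ?thesis
    by (auto simp: improper_int_def intro: has_integral_integrable)
qed

lemma cauchy_phi_boundary:
  assumes F: "continuous_on UNIV F" "\<And>x. 0 < x \<Longrightarrow> F x = F' x"
    and G: "continuous_on UNIV G" "\<And>x. 0 < x \<Longrightarrow> G x = G' x" and u: "0 < u"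
  shows "(\<lambda>x. complex_of_real (K0 x u) * G' x) integrable_on {0..2 * u}"
    "(\<lambda>x. complex_of_real (K1 x u) * F' x) integrable_on {0..2 * u}"
    "cauchy_phi F G u 0 = F' (2 * u) + integral {0..2 * u} (\<lambda>x. complex_of_real (K0 x u) * G' x) / 2
       - integral {0..2 * u} (\<lambda>x. complex_of_real (K1 x u) * F' x) / 2"
proof -
  let ?k0 = "\<lambda>x. E0 (x * (2 * u - x) / 4) *\<^sub>R G x" and ?k1 = "\<lambda>x. (x / 2 * E1 (x * (2 * u - x) / 4)) *\<^sub>R F x"
  have int: "?k0 integrable_on {a..b}" "?k1 integrable_on {a..b}" for a b
    by (intro integrable_continuous_real continuous_intros continuous_on_subset[OF F(1)] continuous_on_subset[OF G(1)]; simp)+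
  \<comment> \<open>\<open>F\<close> and \<open>F'\<close> need not agree at 0, and at
    \<open>2 * u\<close> the quotient in \<open>K1\<close> divides by zero.\<close>
  have neg: "negligible {0, 2 * u}" by simp
  have eq: "complex_of_real (K0 x u) * G' x = ?k0 x" "complex_of_real (K1 x u) * F' x = ?k1 x"
    if "x \<in> {0..2 * u} - {0, 2 * u}" for x
  proof -
    have "0 < x" "0 < x * (2 * u - x)" using that by auto
    then show "complex_of_real (K0 x u) * G' x = ?k0 x" "complex_of_real (K1 x u) * F' x = ?k1 x"
      using F(2) G(2) by (simp_all only: K0_eq[OF less_imp_le] K1_eq scaleR_conv_of_real)
  qed
  have i0: "((\<lambda>x. complex_of_real (K0 x u) * G' x) has_integral integral {0..2 * u} ?k0) {0..2 * u}"
    by (rule has_integral_spike[OF neg eq(1) integrable_integral[OF int(1)]])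
  have i1: "((\<lambda>x. complex_of_real (K1 x u) * F' x) has_integral integral {0..2 * u} ?k1) {0..2 * u}"
    by (rule has_integral_spike[OF neg eq(2) integrable_integral[OF int(2)]])
  show "(\<lambda>x. complex_of_real (K0 x u) * G' x) integrable_on {0..2 * u}"
    "(\<lambda>x. complex_of_real (K1 x u) * F' x) integrable_on {0..2 * u}"
    using i0 i1 by (auto intro: has_integral_integrable)
  have im: "(\<lambda>x. x / 2) ` {0..2 * u} = {0..u}"
    using image_divide_atLeastAtMost[of 2 0 "2 * u"] by simp
  have h0: "((\<lambda>s. ?k0 (2 * s)) has_integral (1 / 2) *\<^sub>R integral {0..2 * u} ?k0) {0..u}"
    using has_integral_stretch_real[OF integrable_integral[OF int(1)[of 0 "2 * u"]], of 2] by (simp only: im) simp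
  have h1: "((\<lambda>s. ?k1 (2 * s)) has_integral (1 / 2) *\<^sub>R integral {0..2 * u} ?k1) {0..u}"
    using has_integral_stretch_real[OF integrable_integral[OF int(2)[of 0 "2 * u"]], of 2] by (simp only: im) simp
  have "cauchy_phi F G u 0 = F (2 * u) + integral {0..u} (\<lambda>s. ?k0 (2 * s) - ?k1 (2 * s))"
  proof -
    have "2 * s * (2 * u - 2 * s) / 4 = (s - 0) * (u - s)" "2 * s / 2 = s - 0" for s :: real
      by (simp_all add: field_simps)
    then show ?thesis
      unfolding cauchy_phi_def sint_le[OF less_imp_le[OF u]] by (simp only:)
  qed
  also have "\<dots> = F (2 * u) + ((1 / 2) *\<^sub>R integral {0..2 * u} ?k0 - (1 / 2) *\<^sub>R integral {0..2 * u} ?k1)"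
    using integral_unique[OF has_integral_diff[OF h0 h1]] by simp
  finally show "cauchy_phi F G u 0 = F' (2 * u) + integral {0..2 * u} (\<lambda>x. complex_of_real (K0 x u) * G' x) / 2
       - integral {0..2 * u} (\<lambda>x. complex_of_real (K1 x u) * F' x) / 2"
    using F(2)[of "2 * u"] u by (simp add: integral_unique[OF i0] integral_unique[OF i1] scaleR_conv_of_real)
qed

section \<open>Solutions with regular Cauchy data\<close>

lemma H1_cong:
  assumes "H1 f" "\<And>x. 0 < x \<Longrightarrow> f x = g x" shows "H1 g"
proof -
  from assms(1) obtain f' where f: "(\<lambda>x. (cmod (f x))^2) integrable_on {0<..}"
    "(\<lambda>x. (cmod (f' x))^2) integrable_on {0<..}"
    "\<And>a b. 0 < a \<Longrightarrow> a \<le> b \<Longrightarrow> (f' has_integral (f b - f a)) {a..b}"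
    unfolding H1_def by blast
  have "(\<lambda>x. (cmod (g x))^2) integrable_on {0<..}"
    by (rule integrable_eq[OF f(1)]) (use assms(2) in auto)
  moreover have "(f' has_integral (g b - g a)) {a..b}" if "0 < a" "a \<le> b" for a b
    using f(3)[OF that] assms(2)[of a] assms(2)[of b] that by simp
  ultimately show ?thesis using f(2) unfolding H1_def by blast
qed

lemma continuous_zero_at_0:
  fixes f :: "real \<Rightarrow> complex"
  assumes f: "continuous_on UNIV f" and a: "0 < a" and z: "\<And>x. 0 < x \<Longrightarrow> x < a \<Longrightarrow> f x = 0"
  shows "f 0 = 0"
proof -
  have "(f \<longlongrightarrow> f 0) (at_right 0)"
    using f by (auto simp: continuous_on_def intro: filterlim_mono[OF _ order_refl at_le])
  moreover have "(f \<longlongrightarrow> 0) (at_right 0)"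
    by (rule tendsto_eventually, rule eventually_at_rightI[of 0 a]) (use a z in auto)
  ultimately show ?thesis by (rule tendsto_unique[rotated]) simp
qed

text \<open>One constant for all four bounds keeps the notion invariant under reflection, so each
  consequence for \<open>v = 0\<close> also holds for \<open>u = 0\<close>.\<close>

definition regular_sol ::
  "(real \<Rightarrow> real \<Rightarrow> complex) \<Rightarrow> (real \<Rightarrow> real \<Rightarrow> complex) \<Rightarrow> real \<Rightarrow> bool" where
  "regular_sol \<phi> \<psi> A \<longleftrightarrow> csol \<phi> \<psi> \<and>
     square_bounded (\<lambda>s. \<phi> s s) A \<and> diff_bounded (\<lambda>s. \<phi> s s) A \<and>
     square_bounded (\<lambda>s. \<psi> s s) A \<and> diff_bounded (\<lambda>s. \<psi> s s) A"

lemma regular_sol_swap: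
  "regular_sol \<phi> \<psi> A \<Longrightarrow> regular_sol (\<lambda>u v. \<psi> v u) (\<lambda>u v. \<phi> v u) A"
  by (simp add: regular_sol_def csol_swap)

lemma regular_sol_energy:
  assumes "regular_sol \<phi> \<psi> A"
  obtains W where "energy_potential \<phi> \<psi> W" "\<And>s. 0 \<le> s \<Longrightarrow> W s s \<le> A + A"
proof -
  from assms obtain W where W: "energy_potential \<phi> \<psi> W"
    by (auto simp: regular_sol_def elim: energy_potential_exists)
  have "W s s \<le> A + A" if "0 \<le> s" for s
    using assms that by (intro diagonal_energy_bound[OF _ W]) (auto simp: regular_sol_def)
  with W that show thesis by blast
qed

lemma regular_sol_H1:
  assumes reg: "regular_sol \<phi> \<psi> A" and F: "H1 F" "\<And>x. 0 < x \<Longrightarrow> \<phi> (x / 2) (x / 2) = F x"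
    and g: "\<And>u. 0 < u \<Longrightarrow> \<phi> u 0 = g u"
  shows "H1 g"
proof -
  obtain W where W: "energy_potential \<phi> \<psi> W" and WM: "\<And>s. 0 \<le> s \<Longrightarrow> W s s \<le> A + A"
    by (rule regular_sol_energy[OF reg]) (rule that)
  from reg have sol: "csol \<phi> \<psi>" and L: "diff_bounded (\<lambda>s. \<phi> s s) A"
    by (simp_all add: regular_sol_def)
  have sb: "square_bounded (\<lambda>u. \<phi> u 0) (A + A)"
    using energy_square_bounded(1)[OF W WM, of 0] by simp
  have db: "diff_bounded (\<lambda>u. \<phi> u 0) (2 * A + 3 * (A + A))"
    using shifted_energy(1)[OF sol W WM L, of 0] by simp
  have "H1 (\<lambda>u. \<phi> u 0)"
  proof (rule H1_boundary[OF sol _ _ sb db])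
    show "H1 (\<lambda>x. F (2 * x))" by (rule H1_scale[OF F(1)]) simp
    show "\<phi> x x = F (2 * x)" if "0 < x" for x using F(2)[of "2 * x"] that by simp
  qed
  then show ?thesis by (rule H1_cong) (rule g)
qed

lemma regular_sol_H_transf:
  assumes reg: "regular_sol \<phi> \<psi> A"
    and g: "\<And>u. 0 < u \<Longrightarrow> \<phi> u 0 = g u" and k: "\<And>v. 0 < v \<Longrightarrow> \<psi> 0 v = k v"
  shows "H_transf_to g k"
proof -
  obtain W where "energy_potential \<phi> \<psi> W" "\<And>s. 0 \<le> s \<Longrightarrow> W s s \<le> A + A"
    by (rule regular_sol_energy[OF reg]) (rule that)
  then show ?thesis
    by (rule H_transf_boundary[rotated]) (use reg g k in \<open>auto simp: regular_sol_def\<close>)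
qed

lemma regular_sol_improper:
  assumes reg: "regular_sol \<phi> \<psi> A" and g: "\<And>u. 0 < u \<Longrightarrow> \<phi> u 0 = g u" and x: "0 < x"
  shows "improper_int (\<lambda>u. complex_of_real (K0 x u) * g u) (x / 2) (\<psi> (x / 2) (x / 2))"
    and "improper_int (\<lambda>u. complex_of_real (K1 x u) * g u) (x / 2) (g (x / 2) - \<phi> (x / 2) (x / 2))"
proof -
  obtain W where W: "energy_potential \<phi> \<psi> W" and WM: "\<And>s. 0 \<le> s \<Longrightarrow> W s s \<le> A + A"
    by (rule regular_sol_energy[OF reg]) (rule that)
  from reg have sol: "csol \<phi> \<psi>" and L: "diff_bounded (\<lambda>s. \<psi> s s) A"
    by (simp_all add: regular_sol_def)
  have cg: "continuous_on UNIV (\<lambda>u. \<phi> u 0)"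
    by (intro csol_continuous[OF sol] continuous_intros)
  show "improper_int (\<lambda>u. complex_of_real (K0 x u) * g u) (x / 2) (\<psi> (x / 2) (x / 2))"
    by (rule K0_improper[OF cg g x charsol_psi_tendsto[OF sol W WM L]]) (use x in simp_all)
  show "improper_int (\<lambda>u. complex_of_real (K1 x u) * g u) (x / 2) (g (x / 2) - \<phi> (x / 2) (x / 2))"
    by (rule K1_improper[OF cg g x charsol_phi_tendsto[OF sol W WM L]]) (use x in simp_all)
qed

lemma regular_sol_boundary_integral:
  assumes reg: "regular_sol \<phi> \<psi> A" and W: "energy_potential \<phi> \<psi> W"
    and lim: "((\<lambda>s. W s s) \<longlongrightarrow> E) at_top"
  shows "((\<lambda>u. (cmod (\<phi> u 0))^2) has_integral E) {0<..}"
proof -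
  from reg have sol: "csol \<phi> \<psi>" and L: "diff_bounded (\<lambda>s. \<psi> s s) A"
    by (simp_all add: regular_sol_def)
  have WM: "W s s \<le> A + A" if "0 \<le> s" for s
    using reg that by (intro diagonal_energy_bound[OF _ W]) (auto simp: regular_sol_def)
  have "((\<lambda>u. (cmod (\<phi> u 0))^2) has_integral E) {0..}"
  proof (rule has_integral_to_inf)
    show "(\<lambda>u. (cmod (\<phi> u 0))^2) integrable_on {0..y}" for y
      by (intro integrable_continuous_real continuous_intros csol_continuous[OF sol])
    have "\<forall>\<^sub>F U in at_top. W U 0 = integral {0..U} (\<lambda>u. (cmod (\<phi> u 0))^2)"
      using eventually_ge_at_top[of 0]
      by eventually_elim (use integral_unique[OF energy_u[OF W]] energy_0[OF W] in simp)
    from Lim_transform_eventually[OF energy_limits[OF sol W WM L lim] this]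
    show "((\<lambda>U. integral {0..U} (\<lambda>u. (cmod (\<phi> u 0))^2)) \<longlongrightarrow> E) at_top" .
  qed simp
  then show ?thesis by (simp add: has_integral_Ici_Ioi)
qed

text \<open>\<open>E\<close> is the limit of \<open>W\<close> along the diagonal. Both boundaries
  collect all of it, and the factor 2 comes from the coordinate \<open>x = 2 * s\<close> on the
  Cauchy line.\<close>

lemma regular_sol_integrals:
  assumes reg: "regular_sol \<phi> \<psi> A"
  obtains E where "((\<lambda>u. (cmod (\<phi> u 0))^2) has_integral E) {0<..}"
    "((\<lambda>v. (cmod (\<psi> 0 v))^2) has_integral E) {0<..}"
    "((\<lambda>x. (cmod (\<phi> (x / 2) (x / 2)))^2 + (cmod (\<psi> (x / 2) (x / 2)))^2) has_integral 2 * E) {0<..}"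
proof -
  obtain W where W: "energy_potential \<phi> \<psi> W" and WM: "\<And>s. 0 \<le> s \<Longrightarrow> W s s \<le> A + A"
    by (rule regular_sol_energy[OF reg]) (rule that)
  from reg have sol: "csol \<phi> \<psi>" by (simp add: regular_sol_def)
  obtain E where E: "((\<lambda>s. W s s) \<longlongrightarrow> E) at_top"
    by (rule tendsto_mono_bounded_at_top[of "\<lambda>s. W s s" "A + A"]) (use energy_mono[OF W] WM in auto)
  let ?f = "\<lambda>x. (cmod (\<phi> (x / 2) (x / 2)))^2 + (cmod (\<psi> (x / 2) (x / 2)))^2"
  have "(?f has_integral 2 * E) {0..}"
  proof (rule has_integral_to_inf)
    show "?f integrable_on {0..y}" for y
      by (intro integrable_continuous_real continuous_intros csol_continuous[OF sol]) auto
    have "integral {0..y} ?f = 2 * W (y / 2) (y / 2)" if "0 \<le> y" for y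
    proof -
      have "(?f has_integral 2 *\<^sub>R (W (y / 2) (y / 2) - W 0 0)) {0..y}"
        using has_integral_stretch_real[OF energy_diag[OF W, of 0 "y / 2"], of "1 / 2"] that
          image_divide_atLeastAtMost[of "1 / 2" 0 "y / 2"] by simp
      then show ?thesis using energy_0[OF W] by (simp add: integral_unique)
    qed
    then have "\<forall>\<^sub>F y in at_top. 2 * W (y / 2) (y / 2) = integral {0..y} ?f"
      by (intro eventually_mono[OF eventually_ge_at_top[of 0]]) simp
    moreover have "((\<lambda>y. 2 * W (y / 2) (y / 2)) \<longlongrightarrow> 2 * E) at_top"
    proof -
      have "filterlim (\<lambda>y::real. y * (1 / 2)) at_top at_top"
        by (rule filterlim_at_top_mult_tendsto_pos[OF tendsto_const _ filterlim_ident]) simp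
      then have "filterlim (\<lambda>y::real. y / 2) at_top at_top" by simp
      from tendsto_mult_left[OF filterlim_compose[OF E this], of 2] show ?thesis .
    qed
    ultimately show "((\<lambda>y. integral {0..y} ?f) \<longlongrightarrow> 2 * E) at_top"
      by (rule Lim_transform_eventually[rotated])
  qed simp
  then have "(?f has_integral 2 * E) {0<..}" by (simp add: has_integral_Ici_Ioi)
  moreover have "((\<lambda>v. (cmod (\<psi> 0 v))^2) has_integral E) {0<..}"
    by (rule regular_sol_boundary_integral[OF regular_sol_swap[OF reg] energy_swap[OF W] E])
  ultimately show thesis
    using that regular_sol_boundary_integral[OF reg W E] by blast
qed

text \<open>The characteristic formula with \<open>R = 0\<close> involves only boundary values on
  \<open>[0, U]\<close> and \<open>[0, V]\<close>. The corner, not covered by the hypotheses,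
  follows by continuity.\<close>

lemma psi_eq_0_of_boundary:
  assumes sol: "csol \<phi> \<psi>" and "0 < U" "U < a" "0 < V" "V < a"
    and g: "\<And>u. 0 < u \<Longrightarrow> u < a \<Longrightarrow> \<phi> u 0 = 0" and k: "\<And>v. 0 < v \<Longrightarrow> v < a \<Longrightarrow> \<psi> 0 v = 0"
  shows "\<psi> U V = 0"
proof -
  have "\<phi> 0 0 = 0"
    by (rule continuous_zero_at_0[of "\<lambda>u. \<phi> u 0" a])
      (use assms in \<open>auto intro: continuous_on_section1[OF csolD(1)[OF sol]]\<close>)
  moreover have "\<psi> 0 0 = 0"
    by (rule continuous_zero_at_0[of "\<psi> 0" a])
      (use assms in \<open>auto intro: continuous_on_section2[OF csolD(2)[OF sol]]\<close>)
  ultimately have z: "\<phi> u 0 = 0" "\<psi> 0 u = 0" if "0 \<le> u" "u < a" for u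
    using g k that by (cases "u = 0"; simp)+
  have "\<psi> U V = \<psi> 0 V - sint 0 V (\<lambda>v. of_real ((0 - U) * E1 ((0 - U) * (V - v))) * \<psi> 0 v)"
    by (rule csol_characteristic_formula[OF sol]) (use z assms in auto)
  also have "sint 0 V (\<lambda>v. of_real ((0 - U) * E1 ((0 - U) * (V - v))) * \<psi> 0 v) = 0"
    by (rule sint_zero) (use z assms in auto)
  finally show ?thesis using z[of V] assms by simp
qed

lemma cauchy_phi_eq_0:
  assumes F: "continuous_on UNIV F" and G: "continuous_on UNIV G" and u: "0 < u" "u < a"
    and z: "\<And>x. 0 < x \<Longrightarrow> x < 2 * a \<Longrightarrow> F x = 0 \<and> G x = 0"
  shows "cauchy_phi F G u 0 = 0"
proof -
  have "F 0 = 0" "G 0 = 0"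
    using continuous_zero_at_0[OF F, of "2 * a"] continuous_zero_at_0[OF G, of "2 * a"] z u by auto
  then have "F x = 0" "G x = 0" if "0 \<le> x" "x < 2 * a" for x
    using z[of x] that by (cases "x = 0"; simp)+
  then show ?thesis
    unfolding cauchy_phi_def using u by (simp add: sint_zero)
qed

section \<open>The Cauchy problem and the characteristic problem\<close>

lemma cauchy_problem:
  assumes F: "H1 F" and G: "H1 G"
  obtains F' G' A where "continuous_on UNIV F'" "continuous_on UNIV G'"
    "\<And>x. 0 < x \<Longrightarrow> F' x = F x" "\<And>x. 0 < x \<Longrightarrow> G' x = G x"
    "regular_sol (cauchy_phi F' G') (\<lambda>u v. cauchy_phi G' F' v u) A"
proof -
  \<comment> \<open>\<open>cauchy_phi\<close> evaluates its data at \<open>2 * s\<close>. Rescaling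
    before the extension makes the bounds refer to the diagonal values of the solution
    themselves.\<close>
  have F2: "H1 (\<lambda>x. F (2 * x))" and G2: "H1 (\<lambda>x. G (2 * x))"
    using H1_scale[OF F, of 2] H1_scale[OF G, of 2] by auto
  obtain F' K where F': "continuous_on UNIV F'" "\<And>x. 0 < x \<Longrightarrow> F' x = F (2 * x)"
    "square_bounded F' K" "diff_bounded F' K"
    by (rule H1_extend[OF F2]) (rule that)
  obtain G' L where G': "continuous_on UNIV G'" "\<And>x. 0 < x \<Longrightarrow> G' x = G (2 * x)"
    "square_bounded G' L" "diff_bounded G' L"
    by (rule H1_extend[OF G2]) (rule that)
  define A where "A = max K L"
  have c: "continuous_on UNIV (\<lambda>x. F' (x / 2))" "continuous_on UNIV (\<lambda>x. G' (x / 2))"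
    by (rule continuous_on_compose_UNIV[OF F'(1)] continuous_on_compose_UNIV[OF G'(1)];
        intro continuous_intros; simp)+
  have "regular_sol (cauchy_phi (\<lambda>x. F' (x / 2)) (\<lambda>x. G' (x / 2)))
     (\<lambda>u v. cauchy_phi (\<lambda>x. G' (x / 2)) (\<lambda>x. F' (x / 2)) v u) A"
    unfolding regular_sol_def
  proof (intro conjI)
    show "csol (cauchy_phi (\<lambda>x. F' (x / 2)) (\<lambda>x. G' (x / 2)))
     (\<lambda>u v. cauchy_phi (\<lambda>x. G' (x / 2)) (\<lambda>x. F' (x / 2)) v u)"
      by (rule csol_cauchy[OF c])
  qed (use square_bounded_mono[OF F'(3), of A] diff_bounded_mono[OF F'(4), of A]
      square_bounded_mono[OF G'(3), of A] diff_bounded_mono[OF G'(4), of A] in \<open>simp_all add: A_def\<close>)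
  then show thesis
    using c F'(2) G'(2) by (intro that[of "\<lambda>x. F' (x / 2)" "\<lambda>x. G' (x / 2)" A]) auto
qed

text \<open>The solution exists for any continuous boundary values: of its two summands, each
  vanishes in the component and on the boundary where the other takes its data. The transform
  relation enters through the energy on the diagonal, each half of \<open>H_pair\<close> giving one
  component.\<close>

lemma H_pair_diagonal:
  assumes g: "H1 g" and k: "H1 k" and H: "H_pair g k"
  obtains \<phi> \<psi> where "csol \<phi> \<psi>" "\<And>u. 0 < u \<Longrightarrow> \<phi> u 0 = g u" "\<And>v. 0 < v \<Longrightarrow> \<psi> 0 v = k v"
    "H1 (\<lambda>x. \<phi> (x / 2) (x / 2))" "H1 (\<lambda>x. \<psi> (x / 2) (x / 2))"
proof -
  obtain g' K where g': "continuous_on UNIV g'" "\<And>x. 0 < x \<Longrightarrow> g' x = g x"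
    "square_bounded g' K" "diff_bounded g' K"
    by (rule H1_extend[OF g]) (rule that)
  obtain k' L where k': "continuous_on UNIV k'" "\<And>x. 0 < x \<Longrightarrow> k' x = k x"
    "square_bounded k' L" "diff_bounded k' L"
    by (rule H1_extend[OF k]) (rule that)
  define \<phi> where "\<phi> u v = charsol_phi g' 0 u v + charsol_psi k' 0 v u" for u v
  define \<psi> where "\<psi> u v = charsol_psi g' 0 u v + charsol_phi k' 0 v u" for u v
  have sol: "csol \<phi> \<psi>"
    unfolding \<phi>_def \<psi>_def
    by (rule csol_add[OF csol_charsol[OF g'(1)] csol_swap[OF csol_charsol[OF k'(1)]]])
  have \<phi>0: "\<phi> u 0 = g' u" and \<psi>0: "\<psi> 0 v = k' v" for u v
    by (simp_all add: \<phi>_def \<psi>_def)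
  \<comment> \<open>Quantified over all data, so that it can be applied a second time to the
    reflected solution with \<open>g\<close> and \<open>k\<close> exchanged.\<close>
  have diag: "H1 (\<lambda>x. \<phi> (x / 2) (x / 2))"
    if sol: "csol \<phi> \<psi>" and \<phi>0: "\<And>u. \<phi> u 0 = g' u" and \<psi>0: "\<And>v. \<psi> 0 v = k' v"
      and g: "H1 g" and H: "H_transf_to g k" and g': "continuous_on UNIV g'" "\<And>x. 0 < x \<Longrightarrow> g' x = g x"
        "square_bounded g' K" "diff_bounded g' K" and k': "continuous_on UNIV k'" "\<And>x. 0 < x \<Longrightarrow> k' x = k x"
    for \<phi> \<psi> g g' k k' K
  proof -
    have g0: "(\<lambda>u. \<phi> u 0) = g'" using \<phi>0 by auto
    have lim: "transform_limit \<phi> \<psi> 0"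
      unfolding transform_limit_def g0 \<psi>0 using H_transf_toD[OF H g'(1,2) k'] by meson
    have "H1 (\<lambda>s. \<phi> s s)"
    proof (rule H1_diagonal[OF sol g])
      show "\<phi> x 0 = g x" if "0 < x" for x using g'(2)[OF that] \<phi>0 by simp
      show "square_bounded (\<lambda>s. \<phi> s s) (3 * K)"
        by (rule diagonal_square_bounded[OF sol lim]) (simp add: g0 g')
      show "diff_bounded (\<lambda>s. \<phi> s s) (12 * K)"
        by (rule diagonal_diff_bounded[OF sol lim]) (simp_all add: g0 g')
    qed
    from H1_scale[OF this, of "1 / 2"] show ?thesis by simp
  qed
  show thesis
  proof (rule that[OF sol])
    show "H1 (\<lambda>x. \<phi> (x / 2) (x / 2))"
      by (rule diag[OF sol \<phi>0 \<psi>0 g _ g' k'(1,2)]) (use H in \<open>simp add: H_pair_def\<close>)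
    show "H1 (\<lambda>x. \<psi> (x / 2) (x / 2))"
      by (rule diag[OF csol_swap[OF sol] \<psi>0 \<phi>0 k _ k' g'(1,2)]) (use H in \<open>simp add: H_pair_def\<close>)
  qed (use \<phi>0 \<psi>0 g' k' in auto)
qed

theorem theorem4:
  shows
  "(\<forall>F G. H1 F \<and> H1 G \<longrightarrow>
      (\<exists>\<psi> \<phi>. is_solution F G \<psi> \<phi>) \<and>
      (\<forall>\<psi> \<phi>. is_solution F G \<psi> \<phi> \<longrightarrow>
        (let g = (\<lambda>u. \<phi> (-u) u); k = (\<lambda>v. \<psi> v v) in
          \<comment> \<open>(i)\<close>
          H1 g \<and> H1 k \<and> H_pair g k \<and>
          \<comment> \<open>(ii)\<close>
          (\<forall>a>0. ((\<forall>x\<in>{0<..<2 * a}. F x = 0 \<and> G x = 0) \<longleftrightarrow>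
                  (\<forall>u\<in>{0<..<a}. g u = 0 \<and> k u = 0))) \<and>
          \<comment> \<open>(iv)\<close>
          (\<forall>x>0.
             improper_int (\<lambda>v. complex_of_real (K0 x v) * k v) (x/2) (F x) \<and>
             improper_int (\<lambda>u. complex_of_real (K1 x u) * g u) (x/2) (g (x/2) - F x) \<and>
             improper_int (\<lambda>v. complex_of_real (K1 x v) * k v) (x/2) (k (x/2) - G x) \<and>
             improper_int (\<lambda>u. complex_of_real (K0 x u) * g u) (x/2) (G x)) \<and>
          (\<forall>u>0.
             (\<lambda>x. complex_of_real (K0 x u) * G x) integrable_on {0 .. 2 * u} \<and>
             (\<lambda>x. complex_of_real (K1 x u) * F x) integrable_on {0 .. 2 * u} \<and>
             g u = F (2 * u) + integral {0 .. 2 * u} (\<lambda>x. complex_of_real (K0 x u) * G x) / 2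
                   - integral {0 .. 2 * u} (\<lambda>x. complex_of_real (K1 x u) * F x) / 2) \<and>
          (\<forall>v>0.
             (\<lambda>x. complex_of_real (K0 x v) * F x) integrable_on {0 .. 2 * v} \<and>
             (\<lambda>x. complex_of_real (K1 x v) * G x) integrable_on {0 .. 2 * v} \<and>
             k v = G (2 * v) + integral {0 .. 2 * v} (\<lambda>x. complex_of_real (K0 x v) * F x) / 2
                   - integral {0 .. 2 * v} (\<lambda>x. complex_of_real (K1 x v) * G x) / 2) \<and>
          \<comment> \<open>(v)\<close>
          2 * integral {0<..} (\<lambda>v. (cmod (k v))^2)
            = integral {0<..} (\<lambda>x. (cmod (F x))^2 + (cmod (G x))^2) \<and>
          integral {0<..} (\<lambda>x. (cmod (F x))^2 + (cmod (G x))^2)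
            = 2 * integral {0<..} (\<lambda>u. (cmod (g u))^2)))) \<and>
   \<comment> \<open>(iii)\<close>
   (\<forall>g k. H1 g \<and> H1 k \<and> H_pair g k \<longrightarrow>
      (\<exists>F G \<psi> \<phi>. H1 F \<and> H1 G \<and> is_solution F G \<psi> \<phi> \<and>
         (\<forall>u>0. \<phi> (-u) u = g u) \<and> (\<forall>v>0. \<psi> v v = k v)))"
proof (intro conjI allI impI)
  fix F G :: "real \<Rightarrow> complex"
  assume FG: "H1 F \<and> H1 G"
  obtain F' G' A where F': "continuous_on UNIV F'" "\<And>x. 0 < x \<Longrightarrow> F' x = F x"
    and G': "continuous_on UNIV G'" "\<And>x. 0 < x \<Longrightarrow> G' x = G x"
    and reg0: "regular_sol (cauchy_phi F' G') (\<lambda>u v. cauchy_phi G' F' v u) A"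
    by (rule cauchy_problem[OF conjunct1[OF FG] conjunct2[OF FG]]) (rule that)
  define \<phi> where "\<phi> = cauchy_phi F' G'"
  define \<psi> where "\<psi> u v = cauchy_phi G' F' v u" for u v
  have reg: "regular_sol \<phi> \<psi> A"
    using reg0 by (simp add: \<phi>_def \<psi>_def[abs_def])
  note reg' = regular_sol_swap[OF reg]
  have sol: "csol \<phi> \<psi>" using reg by (simp add: regular_sol_def)
  have diag: "\<phi> (x / 2) (x / 2) = F x" "\<psi> (x / 2) (x / 2) = G x" if "0 < x" for x
    using F'(2) G'(2) that by (simp_all add: \<phi>_def \<psi>_def)
  have is_sol: "is_solution F G (\<lambda>t x. \<psi> ((x - t) / 2) ((x + t) / 2)) (\<lambda>t x. \<phi> ((x - t) / 2) ((x + t) / 2))"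
    by (rule is_solution_csol[OF sol diag])
  then show "\<exists>\<psi> \<phi>. is_solution F G \<psi> \<phi>" by (intro exI)
  fix \<Psi> \<Phi> :: "real \<Rightarrow> real \<Rightarrow> complex"
  assume S: "is_solution F G \<Psi> \<Phi>"
  define g where "g = (\<lambda>u. \<Phi> (-u) u)"
  define k where "k = (\<lambda>v. \<Psi> v v)"
  \<comment> \<open>The wedge points \<open>(-u, u)\<close> and \<open>(v, v)\<close> have
    light-cone coordinates \<open>(u, 0)\<close> and \<open>(0, v)\<close>. By uniqueness the
    arbitrary solution takes there the values of the constructed one.\<close>
  have g: "\<phi> u 0 = g u" if "0 < u" for u
    using is_solution_unique[OF S is_sol, of "-u" u] that by (simp add: g_def wedge_def)
  have k: "\<psi> 0 v = k v" if "0 < v" for v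
    using is_solution_unique[OF S is_sol, of v v] that by (simp add: k_def wedge_def)
  obtain E where E: "((\<lambda>u. (cmod (\<phi> u 0))^2) has_integral E) {0<..}"
    "((\<lambda>v. (cmod (\<psi> 0 v))^2) has_integral E) {0<..}"
    "((\<lambda>x. (cmod (\<phi> (x / 2) (x / 2)))^2 + (cmod (\<psi> (x / 2) (x / 2)))^2) has_integral 2 * E) {0<..}"
    by (rule regular_sol_integrals[OF reg]) (rule that)
  have Eg: "integral {0<..} (\<lambda>u. (cmod (g u))^2) = E"
    by (rule integral_unique, rule has_integral_eq[OF _ E(1)]) (simp add: g)
  have Ek: "integral {0<..} (\<lambda>v. (cmod (k v))^2) = E"
    by (rule integral_unique, rule has_integral_eq[OF _ E(2)]) (simp add: k)
  have EFG: "integral {0<..} (\<lambda>x. (cmod (F x))^2 + (cmod (G x))^2) = 2 * E"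
    by (rule integral_unique, rule has_integral_eq[OF _ E(3)]) (simp add: diag)
  have "H1 g" by (rule regular_sol_H1[OF reg _ diag(1) g]) (use FG in simp)
  moreover have "H1 k" by (rule regular_sol_H1[OF reg' _ diag(2) k]) (use FG in simp)
  moreover have "H_pair g k"
    unfolding H_pair_def
    using regular_sol_H_transf[OF reg g k] regular_sol_H_transf[OF reg' k g] by simp
  moreover have "\<forall>a>0. ((\<forall>x\<in>{0<..<2 * a}. F x = 0 \<and> G x = 0) \<longleftrightarrow> (\<forall>u\<in>{0<..<a}. g u = 0 \<and> k u = 0))"
  proof (intro allI impI iffI ballI)
    fix a u :: real
    assume z: "\<forall>x\<in>{0<..<2 * a}. F x = 0 \<and> G x = 0" and u: "u \<in> {0<..<a}"
    have z': "F' x = 0 \<and> G' x = 0" if "0 < x" "x < 2 * a" for x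
      using z F'(2) G'(2) that by simp
    have "\<phi> u 0 = 0" "\<psi> 0 u = 0"
      unfolding \<phi>_def \<psi>_def
      using cauchy_phi_eq_0[OF F'(1) G'(1), of u a] cauchy_phi_eq_0[OF G'(1) F'(1), of u a] z' u by auto
    then show "g u = 0 \<and> k u = 0" using g[of u] k[of u] u by simp
  next
    fix a x :: real
    assume z: "\<forall>u\<in>{0<..<a}. g u = 0 \<and> k u = 0" and x: "x \<in> {0<..<2 * a}"
    have z': "\<phi> u 0 = 0" "\<psi> 0 u = 0" if "0 < u" "u < a" for u
      using z g[of u] k[of u] that by auto
    have "0 < x / 2" "x / 2 < a" using x by auto
    \<comment> \<open>Doubled because the vanishing lemma asks for the same bounds on both
      coordinates of the diagonal point.\<close>
    note x' = this this
    have "\<psi> (x / 2) (x / 2) = 0" by (rule psi_eq_0_of_boundary[OF sol x' z'])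
    moreover have "\<phi> (x / 2) (x / 2) = 0" by (rule psi_eq_0_of_boundary[OF csol_swap[OF sol] x' z'(2,1)])
    ultimately show "F x = 0 \<and> G x = 0" using diag[of x] x by simp
  qed
  moreover have "\<forall>x>0.
     improper_int (\<lambda>v. complex_of_real (K0 x v) * k v) (x/2) (F x) \<and>
     improper_int (\<lambda>u. complex_of_real (K1 x u) * g u) (x/2) (g (x/2) - F x) \<and>
     improper_int (\<lambda>v. complex_of_real (K1 x v) * k v) (x/2) (k (x/2) - G x) \<and>
     improper_int (\<lambda>u. complex_of_real (K0 x u) * g u) (x/2) (G x)"
    using regular_sol_improper[OF reg g] regular_sol_improper[OF reg' k] diag by simp
  moreover have "\<forall>u>0.
     (\<lambda>x. complex_of_real (K0 x u) * G x) integrable_on {0 .. 2 * u} \<and>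
     (\<lambda>x. complex_of_real (K1 x u) * F x) integrable_on {0 .. 2 * u} \<and>
     g u = F (2 * u) + integral {0 .. 2 * u} (\<lambda>x. complex_of_real (K0 x u) * G x) / 2
           - integral {0 .. 2 * u} (\<lambda>x. complex_of_real (K1 x u) * F x) / 2"
    using cauchy_phi_boundary[OF F' G'] g by (simp add: \<phi>_def)
  moreover have "\<forall>v>0.
     (\<lambda>x. complex_of_real (K0 x v) * F x) integrable_on {0 .. 2 * v} \<and>
     (\<lambda>x. complex_of_real (K1 x v) * G x) integrable_on {0 .. 2 * v} \<and>
     k v = G (2 * v) + integral {0 .. 2 * v} (\<lambda>x. complex_of_real (K0 x v) * F x) / 2
           - integral {0 .. 2 * v} (\<lambda>x. complex_of_real (K1 x v) * G x) / 2"
    using cauchy_phi_boundary[OF G' F'] k by (simp add: \<psi>_def)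
  moreover have "2 * integral {0<..} (\<lambda>v. (cmod (k v))^2)
      = integral {0<..} (\<lambda>x. (cmod (F x))^2 + (cmod (G x))^2)"
    "integral {0<..} (\<lambda>x. (cmod (F x))^2 + (cmod (G x))^2) = 2 * integral {0<..} (\<lambda>u. (cmod (g u))^2)"
    using Eg Ek EFG by simp_all
  ultimately show "let g = (\<lambda>u. \<Phi> (-u) u); k = (\<lambda>v. \<Psi> v v) in
          H1 g \<and> H1 k \<and> H_pair g k \<and>
          (\<forall>a>0. ((\<forall>x\<in>{0<..<2 * a}. F x = 0 \<and> G x = 0) \<longleftrightarrow>
                  (\<forall>u\<in>{0<..<a}. g u = 0 \<and> k u = 0))) \<and>
          (\<forall>x>0.
             improper_int (\<lambda>v. complex_of_real (K0 x v) * k v) (x/2) (F x) \<and>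
             improper_int (\<lambda>u. complex_of_real (K1 x u) * g u) (x/2) (g (x/2) - F x) \<and>
             improper_int (\<lambda>v. complex_of_real (K1 x v) * k v) (x/2) (k (x/2) - G x) \<and>
             improper_int (\<lambda>u. complex_of_real (K0 x u) * g u) (x/2) (G x)) \<and>
          (\<forall>u>0.
             (\<lambda>x. complex_of_real (K0 x u) * G x) integrable_on {0 .. 2 * u} \<and>
             (\<lambda>x. complex_of_real (K1 x u) * F x) integrable_on {0 .. 2 * u} \<and>
             g u = F (2 * u) + integral {0 .. 2 * u} (\<lambda>x. complex_of_real (K0 x u) * G x) / 2
                   - integral {0 .. 2 * u} (\<lambda>x. complex_of_real (K1 x u) * F x) / 2) \<and>
          (\<forall>v>0.
             (\<lambda>x. complex_of_real (K0 x v) * F x) integrable_on {0 .. 2 * v} \<and>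
             (\<lambda>x. complex_of_real (K1 x v) * G x) integrable_on {0 .. 2 * v} \<and>
             k v = G (2 * v) + integral {0 .. 2 * v} (\<lambda>x. complex_of_real (K0 x v) * F x) / 2
                   - integral {0 .. 2 * v} (\<lambda>x. complex_of_real (K1 x v) * G x) / 2) \<and>
          2 * integral {0<..} (\<lambda>v. (cmod (k v))^2)
            = integral {0<..} (\<lambda>x. (cmod (F x))^2 + (cmod (G x))^2) \<and>
          integral {0<..} (\<lambda>x. (cmod (F x))^2 + (cmod (G x))^2)
            = 2 * integral {0<..} (\<lambda>u. (cmod (g u))^2)"
    unfolding g_def[symmetric] k_def[symmetric] unfolding Let_def by (intro conjI)
next
  fix g k :: "real \<Rightarrow> complex"
  assume gk: "H1 g \<and> H1 k \<and> H_pair g k"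
  obtain \<phi> \<psi> where sol: "csol \<phi> \<psi>" and g: "\<And>u. 0 < u \<Longrightarrow> \<phi> u 0 = g u"
    and k: "\<And>v. 0 < v \<Longrightarrow> \<psi> 0 v = k v"
    and H1: "H1 (\<lambda>x. \<phi> (x / 2) (x / 2))" "H1 (\<lambda>x. \<psi> (x / 2) (x / 2))"
    by (rule H_pair_diagonal[of g k]) (use gk in \<open>blast intro: that\<close>)+
  let ?F = "\<lambda>x. \<phi> (x / 2) (x / 2)" and ?G = "\<lambda>x. \<psi> (x / 2) (x / 2)"
  let ?\<Psi> = "\<lambda>t x. \<psi> ((x - t) / 2) ((x + t) / 2)" and ?\<Phi> = "\<lambda>t x. \<phi> ((x - t) / 2) ((x + t) / 2)"
  have "is_solution ?F ?G ?\<Psi> ?\<Phi>"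
    by (rule is_solution_csol[OF sol refl refl])
  moreover have "\<forall>u>0. ?\<Phi> (-u) u = g u" "\<forall>v>0. ?\<Psi> v v = k v"
    using g k by simp_all
  ultimately show "\<exists>F G \<psi> \<phi>. H1 F \<and> H1 G \<and> is_solution F G \<psi> \<phi> \<and>
         (\<forall>u>0. \<phi> (-u) u = g u) \<and> (\<forall>v>0. \<psi> v v = k v)"
    using H1 by (intro exI[of _ ?F] exI[of _ ?G] exI[of _ ?\<Psi>] exI[of _ ?\<Phi>] conjI)
qed

end
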